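(* Let $\alpha>0$, let $p,q,r$ be pairwise distinct integers, and let $u\in L^1(\mathbb{R})$ be such that ${}_{-\infty}D_x^{\alpha+3}u$ and its Fourier transform belong to $L^1(\mathbb{R})$. For $h>0$ define the 3-WSGD operator $${}_L\mathcal{G}_{h,p,q,r}^{\alpha}u(x)=\lambda_1A_{h,p}^{\alpha}u(x)+\lambda_2A_{h,q}^{\alpha}u(x)+\lambda_3A_{h,r}^{\alpha}u(x),$$ where $$\lambda_1=\frac{12qr-(6q+6r+1)\alpha+3\alpha^2}{12(qr-pq-pr+p^2)},\quad \lambda_2=\frac{12pr-(6p+6r+1)\alpha+3\alpha^2}{12(pr-pq-qr+q^2)},\quad \lambda_3=\frac{12pq-(6p+6q+1)\alpha+3\alpha^2}{12(pq-pr-qr+r^2)}.$$ Then $${}_L\mathcal{G}_{h,p,q,r}^{\alpha}u(x)={}_{-\infty}D_x^{\alpha}u(x)+O(h^3)$$ uniformly for $x\in\mathbb{R}$.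
   Context: For $\alpha>0$ with $n-1<\alpha<n$, $n$ a positive integer, the left Riemann-Liouville fractional derivative is ${}_{-\infty}D_x^{\alpha}u(x)=\frac{1}{\Gamma(n-\alpha)}\frac{\mathrm{d}^n}{\mathrm{d}x^n}\int_{-\infty}^x\frac{u(\xi)}{(x-\xi)^{\alpha-n+1}}\,\mathrm{d}\xi$; if $\alpha=n$ it is the ordinary derivative $\frac{\mathrm{d}^n}{\mathrm{d}x^n}u(x)$. The Fourier transform is $\hat u(\omega)=\int_{\mathbb{R}}e^{-i\omega x}u(x)\,\mathrm{d}x$. For an integer $s$ and $h>0$, the shifted Grünwald difference operator is $A_{h,s}^{\alpha}u(x)=\frac{1}{h^\alpha}\sum_{k=0}^{\infty}g_k^{(\alpha)}u(x-(k-s)h)$, where $g_k^{(\alpha)}=(-1)^k\binom{\alpha}{k}$ are the coefficients of the power series $(1-z)^\alpha=\sum_{k\ge0}g_k^{(\alpha)}z^k$; that is, $g_0^{(\alpha)}=1$ and $g_k^{(\alpha)}=\left(1-\frac{\alpha+1}{k}\right)g_{k-1}^{(\alpha)}$ for $k\ge1$. "$O(h^3)$ uniformly for $x\in\mathbb{R}$" means that the absolute difference is bounded by $Ch^3$ as $h\to0^+$, with $C$ independent of $x$ and $h$.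
   Formalization: The difference operator is applied to the continuous function v equal to u almost everywhere (v = u if u is continuous); for non-integer α and an arbitrary representative such as u = indicator of {0}, the estimate at every x fails. *)

theory Defs
  imports "HOL-Analysis.Analysis"
begin

definition fourier :: "(real \<Rightarrow> complex) \<Rightarrow> real \<Rightarrow> complex" where
  "fourier u \<omega> = (LINT x|lebesgue. exp (- (\<i> * of_real (\<omega> * x))) * u x)"

definition nth_deriv :: "nat \<Rightarrow> (real \<Rightarrow> complex) \<Rightarrow> real \<Rightarrow> complex" where
  "nth_deriv n = (\<lambda>f x. vector_derivative f (at x)) ^^ n"

definition n_times_differentiable :: "nat \<Rightarrow> (real \<Rightarrow> complex) \<Rightarrow> bool" where
  "n_times_differentiable n f \<longleftrightarrow> (\<forall>k<n. \<forall>x. nth_deriv k f differentiable (at x))"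

text \<open>Left Riemann--Liouville derivative of order \<open>\<alpha> > 0\<close>, with \<open>n - 1 < \<alpha> \<le> n\<close> for
  \<open>n = nat \<lceil>\<alpha>\<rceil>\<close>. The integrand below has exponent \<open>\<alpha> - n + 1\<close> in \<open>(0,1)\<close> when \<open>\<alpha>\<close> is
  not an integer.\<close>

definition rl_integrand :: "real \<Rightarrow> (real \<Rightarrow> complex) \<Rightarrow> real \<Rightarrow> real \<Rightarrow> complex" where
  "rl_integrand \<alpha> u x \<xi> = u \<xi> /\<^sub>R (x - \<xi>) powr (\<alpha> - real (nat \<lceil>\<alpha>\<rceil>) + 1)"

definition rl_integral :: "real \<Rightarrow> (real \<Rightarrow> complex) \<Rightarrow> real \<Rightarrow> complex" where
  "rl_integral \<alpha> u x = (LINT \<xi>:{..<x}|lebesgue. rl_integrand \<alpha> u x \<xi>)"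

definition rl_deriv :: "real \<Rightarrow> (real \<Rightarrow> complex) \<Rightarrow> real \<Rightarrow> complex" where
  "rl_deriv \<alpha> u x =
     (if \<alpha> \<in> \<int> then nth_deriv (nat \<lceil>\<alpha>\<rceil>) u x
      else nth_deriv (nat \<lceil>\<alpha>\<rceil>) (rl_integral \<alpha> u) x /\<^sub>R Gamma (real (nat \<lceil>\<alpha>\<rceil>) - \<alpha>))"

text \<open>Since \<^const>\<open>rl_deriv\<close> is total, its existence at every point of the line is a separate
  predicate: the integrals converge absolutely and the required classical derivatives exist.\<close>

definition rl_differentiable :: "real \<Rightarrow> (real \<Rightarrow> complex) \<Rightarrow> bool" where
  "rl_differentiable \<alpha> u \<longleftrightarrow>
     (if \<alpha> \<in> \<int> then n_times_differentiable (nat \<lceil>\<alpha>\<rceil>) u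
      else (\<forall>x. set_integrable lebesgue {..<x} (rl_integrand \<alpha> u x)) \<and>
           n_times_differentiable (nat \<lceil>\<alpha>\<rceil>) (rl_integral \<alpha> u))"

definition gruenwald_coeff :: "real \<Rightarrow> nat \<Rightarrow> real" where
  "gruenwald_coeff \<alpha> k = (-1) ^ k * (\<alpha> gchoose k)"

definition gruenwald_term ::
  "real \<Rightarrow> real \<Rightarrow> int \<Rightarrow> (real \<Rightarrow> complex) \<Rightarrow> real \<Rightarrow> nat \<Rightarrow> complex" where
  "gruenwald_term \<alpha> h s u x k = gruenwald_coeff \<alpha> k *\<^sub>R u (x - (real k - of_int s) * h)"

definition shifted_gruenwald ::
  "real \<Rightarrow> real \<Rightarrow> int \<Rightarrow> (real \<Rightarrow> complex) \<Rightarrow> real \<Rightarrow> complex" where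
  "shifted_gruenwald \<alpha> h s u x = (\<Sum>k. gruenwald_term \<alpha> h s u x k) /\<^sub>R h powr \<alpha>"

text \<open>The three weights arise from this one formula, which is symmetric in its last two arguments.\<close>

definition wsgd_weight :: "real \<Rightarrow> int \<Rightarrow> int \<Rightarrow> int \<Rightarrow> real" where
  "wsgd_weight \<alpha> p q r =
     (12 * of_int (q * r) - of_int (6 * q + 6 * r + 1) * \<alpha> + 3 * \<alpha>\<^sup>2)
     / (12 * of_int (q * r - p * q - p * r + p\<^sup>2))"

definition wsgd ::
  "real \<Rightarrow> int \<Rightarrow> int \<Rightarrow> int \<Rightarrow> real \<Rightarrow> (real \<Rightarrow> complex) \<Rightarrow> real \<Rightarrow> complex" where
  "wsgd \<alpha> p q r h u x =
     wsgd_weight \<alpha> p q r *\<^sub>R shifted_gruenwald \<alpha> h p u x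
   + wsgd_weight \<alpha> q p r *\<^sub>R shifted_gruenwald \<alpha> h q u x
   + wsgd_weight \<alpha> r p q *\<^sub>R shifted_gruenwald \<alpha> h r u x"

text \<open>Point values of \<open>u \<in> L\<^sup>1\<close> are those of its continuous representative \<open>v\<close> (unique, and equal
  to \<open>u\<close> when \<open>u\<close> is continuous). Some such convention is needed: for non-integer \<open>\<alpha>\<close>, changing
  \<open>u\<close> on a null set leaves \<open>rl_deriv \<alpha> u\<close> unchanged but not the Gruenwald sums, so an arbitrary
  representative cannot satisfy an estimate at every point. Convergence of the series and existence of the
  derivative are part of the claim.\<close>

end

theory Submission
  imports Defs "HOL-Probability.Characteristic_Functions" "HOL-Real_Asymp.Real_Asymp"
begin

text \<open>Let \<open>\<phi>\<close> be the Fourier transform of \<open>u\<close> and \<open>\<beta> = \<alpha> + 3\<close>. The transform of the derivative of order \<open>\<beta>\<close> is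
  \<open>(\<i> \<omega>) powr \<beta> * \<phi> \<omega>\<close>: the fractional integral of \<open>u\<close> need not be integrable, but its
  \<open>n\<close>-th differences are, and they are convolutions both of \<open>u\<close> with a difference of power kernels and of the
  top derivative with a B-spline. Hence \<open>\<bar>\<omega>\<bar> powr \<beta> * norm (\<phi> \<omega>)\<close> is integrable, so \<open>\<phi>\<close> is, and \<open>u\<close> agrees almost
  everywhere with the continuous inverse transform \<open>v\<close> of \<open>\<phi>\<close>. Inserting a factor \<open>exp (- \<epsilon> t)\<close> in the fractional integral
  and letting \<open>\<epsilon>\<close> tend to \<open>0\<close> represents the derivative of order \<open>\<alpha>\<close> at every point as the inverse transform of
  \<open>(\<i> \<omega>) powr \<alpha> * \<phi> \<omega>\<close>. The difference operator acts on \<open>v\<close> as the multiplier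
  \<open>h powr - \<alpha> * (\<Sum>j. \<lambda>\<^sub>j * cis (p\<^sub>j \<theta>)) * (1 - cis (- \<theta>)) powr \<alpha>\<close> with \<open>\<theta> = \<omega> h\<close>. Since
  \<open>1 - cis (- \<theta>) = \<i> \<theta> * cis (- \<theta> / 2) * S\<close> with \<open>S = sin (\<theta> / 2) / (\<theta> / 2)\<close> and \<open>S powr \<alpha> = 1 - \<alpha> \<theta>\<^sup>2 / 24 + O(\<theta>\<^sup>3)\<close>,
  the weights are exactly those with moments \<open>1, 0, - \<alpha> / 12\<close> at the nodes \<open>p\<^sub>j - \<alpha> / 2\<close>, and the multiplier
  differs from \<open>(\<i> \<omega>) powr \<alpha>\<close> by at most \<open>C * h ^ 3 * \<bar>\<omega>\<bar> powr \<beta>\<close>.\<close>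

subsection \<open>Fourier transform and backward differences\<close>

text \<open>Taken over \<open>lborel\<close> with \<open>cis\<close>, so that Fubini and Borel
  measurability apply directly; \<open>fourier_eq_ft\<close> gives agreement with
  \<open>fourier\<close> on Borel functions.\<close>

definition ft :: "(real \<Rightarrow> complex) \<Rightarrow> real \<Rightarrow> complex" where
  "ft f \<omega> = (LINT x|lborel. cis (- (\<omega> * x)) * f x)"

lemma cis_measurable [measurable]: "cis \<in> borel_measurable borel"
  by (intro borel_measurable_continuous_onI) (simp add: continuous_on_cis continuous_on_id)

lemma integrable_cis_mult:
  assumes "integrable lborel f" "g \<in> borel_measurable borel"
  shows "integrable lborel (\<lambda>x. cis (g x) * f x)"
  by (rule Bochner_Integration.integrable_bound[OF assms(1)])
     (use assms in \<open>auto simp: norm_mult\<close>)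

lemma ft_diff:
  assumes "integrable lborel f" "integrable lborel g"
  shows "ft (\<lambda>x. f x - g x) \<omega> = ft f \<omega> - ft g \<omega>"
  unfolding ft_def
  by (subst Bochner_Integration.integral_diff[symmetric])
     (auto intro!: integrable_cis_mult assms simp: right_diff_distrib)

lemma norm_ft_le: "norm (ft f \<omega>) \<le> (LINT x|lborel. norm (f x))"
  unfolding ft_def by (rule order_trans[OF integral_norm_bound]) (simp add: norm_mult)

lemma integrable_shift:
  fixes f :: "real \<Rightarrow> complex"
  assumes "integrable lborel f"
  shows "integrable lborel (\<lambda>x. f (x - a))"
  using lborel_integrable_real_affine[OF assms, of 1 "-a"] by simp

lemma integral_shift:
  fixes f :: "real \<Rightarrow> 'a :: {banach, second_countable_topology}"
  shows "(LINT x|lborel. f (x - a)) = (LINT x|lborel. f x)"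
  using lborel_integral_real_affine[of 1 f "-a"] by simp

lemma ft_shift: "ft (\<lambda>x. f (x - a)) \<omega> = cis (- (\<omega> * a)) * ft f \<omega>"
proof -
  have "ft (\<lambda>x. f (x - a)) \<omega> = (LINT x|lborel. (\<lambda>x. cis (- (\<omega> * (x + a))) * f x) (x - a))"
    unfolding ft_def by simp
  also have "\<dots> = (LINT x|lborel. cis (- (\<omega> * (x + a))) * f x)"
    by (rule integral_shift)
  also have "\<dots> = (LINT x|lborel. cis (- (\<omega> * a)) * (cis (- (\<omega> * x)) * f x))"
    by (intro Bochner_Integration.integral_cong)
       (auto simp: cis_mult algebra_simps simp flip: mult.assoc)
  finally show ?thesis
    unfolding ft_def by simp
qed

text \<open>Tonelli: for fixed \<open>t\<close> the integral of the norm over \<open>x\<close> is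
  translation invariant, hence the norm of \<open>f\<close> in L1 times \<open>norm (k t)\<close>.
  Both facts about convolutions below are Fubini applied to this pair function.\<close>

lemma convolution_integrable_pair:
  fixes f k :: "real \<Rightarrow> complex"
  assumes f: "integrable lborel f" and k: "integrable lborel k"
  shows "integrable (lborel \<Otimes>\<^sub>M lborel) (\<lambda>(t, x). f (x - t) * k t)"
proof (rule lborel_pair.Fubini_integrable)
  have [measurable]: "f \<in> borel_measurable borel" "k \<in> borel_measurable borel"
    using f k by auto
  show "(\<lambda>(t, x). f (x - t) * k t) \<in> borel_measurable (lborel \<Otimes>\<^sub>M lborel)"
    by measurable
  have "(LINT x|lborel. norm (f (x - t) * k t)) = (LINT x|lborel. norm (f x)) * norm (k t)" for t
    using integral_shift[of "\<lambda>x. norm (f x)" t] by (simp add: norm_mult)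
  then show "integrable lborel (\<lambda>t. LINT x|lborel. norm (case (t, x) of (t, x) \<Rightarrow> f (x - t) * k t))"
    using k by simp
  show "AE t in lborel. integrable lborel (\<lambda>x. case (t, x) of (t, x) \<Rightarrow> f (x - t) * k t)"
    using integrable_shift[OF f] by simp
qed

lemma integrable_convolution:
  fixes f k :: "real \<Rightarrow> complex"
  assumes "integrable lborel f" and "integrable lborel k"
  shows "integrable lborel (\<lambda>x. LINT t|lborel. f (x - t) * k t)"
  using lborel_pair.integrable_snd[of "\<lambda>t x. f (x - t) * k t"] convolution_integrable_pair[OF assms]
  by simp

lemma ft_convolution:
  assumes f: "integrable lborel f" and k: "integrable lborel k"
  shows "ft (\<lambda>x. LINT t|lborel. f (x - t) * k t) \<omega> = ft f \<omega> * ft k \<omega>"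
proof -
  have [measurable]: "f \<in> borel_measurable borel" "k \<in> borel_measurable borel"
    using f k by auto
  have int: "integrable (lborel \<Otimes>\<^sub>M lborel) (\<lambda>(t, x). cis (- (\<omega> * x)) * (f (x - t) * k t))"
    by (rule Bochner_Integration.integrable_bound[OF convolution_integrable_pair[OF f k]])
       (auto simp: norm_mult)
  have "ft (\<lambda>x. LINT t|lborel. f (x - t) * k t) \<omega>
      = (LINT x|lborel. LINT t|lborel. cis (- (\<omega> * x)) * (f (x - t) * k t))"
    unfolding ft_def by simp
  also have "\<dots> = (LINT t|lborel. LINT x|lborel. cis (- (\<omega> * x)) * (f (x - t) * k t))"
    by (rule lborel_pair.Fubini_integral[OF int])
  also have "\<dots> = (LINT t|lborel. ft (\<lambda>x. f (x - t)) \<omega> * k t)"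
    unfolding ft_def by (simp flip: mult.assoc)
  also have "\<dots> = (LINT t|lborel. ft f \<omega> * (cis (- (\<omega> * t)) * k t))"
    unfolding ft_shift by (simp add: mult_ac)
  also have "\<dots> = ft f \<omega> * ft k \<omega>"
    unfolding ft_def[of k] by (rule Bochner_Integration.integral_mult_right_zero)
  finally show ?thesis .
qed

section \<open>Backward differences and box kernels\<close>

definition bdiff :: "real \<Rightarrow> (real \<Rightarrow> complex) \<Rightarrow> real \<Rightarrow> complex" where
  "bdiff \<eta> f x = f x - f (x - \<eta>)"

lemma integrable_bdiff: "integrable lborel f \<Longrightarrow> integrable lborel (bdiff \<eta> f)"
  unfolding bdiff_def by (intro Bochner_Integration.integrable_diff integrable_shift)

lemma ft_bdiff: "integrable lborel f \<Longrightarrow> ft (bdiff \<eta> f) \<omega> = (1 - cis (- (\<omega> * \<eta>))) * ft f \<omega>"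
  unfolding bdiff_def by (simp add: ft_diff integrable_shift ft_shift algebra_simps)

lemma integrable_bdiff_pow: "integrable lborel f \<Longrightarrow> integrable lborel ((bdiff \<eta> ^^ n) f)"
  by (induction n) (auto intro: integrable_bdiff)

lemma ft_bdiff_pow:
  "integrable lborel f \<Longrightarrow> ft ((bdiff \<eta> ^^ n) f) \<omega> = (1 - cis (- (\<omega> * \<eta>))) ^ n * ft f \<omega>"
  by (induction n) (auto simp: ft_bdiff integrable_bdiff_pow)

lemma bdiff_pow_has_vector_derivative:
  assumes "\<And>x. (f has_vector_derivative f' x) (at x)"
  shows "((bdiff \<eta> ^^ n) f has_vector_derivative (bdiff \<eta> ^^ n) f' x) (at x)"
proof (induction n arbitrary: x)
  case 0
  then show ?case using assms by simp
next
  case (Suc n)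
  have eq: "(bdiff \<eta> ^^ Suc n) g = (\<lambda>x. (bdiff \<eta> ^^ n) g x - (bdiff \<eta> ^^ n) g (x - \<eta>))" for g
    by (rule ext) (simp add: bdiff_def[of \<eta> "(bdiff \<eta> ^^ n) g"])
  have "((\<lambda>x. (bdiff \<eta> ^^ n) f (x - \<eta>)) has_vector_derivative (bdiff \<eta> ^^ n) f' (x - \<eta>)) (at x)"
  proof -
    have "((\<lambda>x. x - \<eta>) has_vector_derivative 1) (at x)"
      by (auto intro!: derivative_eq_intros)
    from vector_diff_chain_at[OF this Suc] show ?thesis
      by (simp add: o_def)
  qed
  from has_vector_derivative_diff[OF Suc this] show ?case
    unfolding eq .
qed

text \<open>The B-spline of lowest order; its \<open>n\<close>-fold convolution power turns an
  \<open>n\<close>-th derivative into an \<open>n\<close>-fold difference.\<close>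

definition box_kernel :: "real \<Rightarrow> real \<Rightarrow> complex" where
  "box_kernel \<eta> s = of_real (indicator {0..\<eta>} s)"

text \<open>The fundamental theorem of calculus over \<open>{x - \<eta>..x}\<close>, followed by the
  reflection of \<open>s\<close> to \<open>x - s\<close>. Only the derivative has to be integrable,
  not \<open>F\<close>.\<close>

lemma bdiff_eq_convolution:
  assumes F: "\<And>x. (F has_vector_derivative f x) (at x)" and f: "integrable lborel f" and "\<eta> > 0"
  shows "bdiff \<eta> F x = (LINT s|lborel. f (x - s) * box_kernel \<eta> s)"
proof -
  have sint: "set_integrable lborel {x - \<eta>..x} f"
    unfolding set_integrable_def by (rule integrable_mult_indicator[OF _ f]) simp
  have "(f has_integral F x - F (x - \<eta>)) {x - \<eta>..x}"
    using \<open>\<eta> > 0\<close> by (intro fundamental_theorem_of_calculus has_vector_derivative_at_within[OF F]) auto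
  then have "bdiff \<eta> F x = (LINT s:{x - \<eta>..x}|lborel. f s)"
    using set_borel_integral_eq_integral(2)[OF sint] by (simp add: bdiff_def integral_unique)
  also have "\<dots> = (LINT s|lborel. indicator {x - \<eta>..x} s *\<^sub>R f s)"
    by (simp add: set_lebesgue_integral_def)
  also have "\<dots> = (LINT s|lborel. indicator {x - \<eta>..x} (x - s) *\<^sub>R f (x - s))"
    using lborel_integral_real_affine[of "-1" "\<lambda>s. indicator {x - \<eta>..x} s *\<^sub>R f s" x] by simp
  also have "\<dots> = (LINT s|lborel. f (x - s) * box_kernel \<eta> s)"
    by (intro Bochner_Integration.integral_cong) (auto simp: indicator_def box_kernel_def)
  finally show ?thesis .
qed

lemma integrable_box_kernel: "integrable lborel (box_kernel \<eta>)"
  unfolding box_kernel_def by (intro integrable_of_real) (simp add: emeasure_lborel_Icc_eq)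

text \<open>Keeping the factor \<open>\<i> * \<omega>\<close> on the left avoids a division and
  covers \<open>\<omega> = 0\<close>.\<close>

lemma ft_box_kernel:
  assumes "\<eta> > 0"
  shows "\<i> * \<omega> * ft (box_kernel \<eta>) \<omega> = 1 - cis (- (\<omega> * \<eta>))"
proof -
  have "((\<lambda>x. \<i> * \<omega> * cis (- (\<omega> * x))) has_integral (- cis (- (\<omega> * \<eta>)) - (- cis (- (\<omega> * 0))))) {0..\<eta>}"
    using assms
    by (intro fundamental_theorem_of_calculus)
       (auto simp: cis_conv_exp mult_ac intro!: derivative_eq_intros has_vector_derivative_real_field)
  note ftc = integral_unique[OF this]
  have "(LINT x:{0..\<eta>}|lborel. \<i> * \<omega> * cis (- (\<omega> * x)))
      = integral {0..\<eta>} (\<lambda>x. \<i> * \<omega> * cis (- (\<omega> * x)))"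
    by (intro set_borel_integral_eq_integral borel_integrable_atLeastAtMost')
       (auto intro!: continuous_intros)
  then have "(LINT x:{0..\<eta>}|lborel. \<i> * \<omega> * cis (- (\<omega> * x))) = 1 - cis (- (\<omega> * \<eta>))"
    unfolding ftc by simp
  moreover have "(LINT x:{0..\<eta>}|lborel. \<i> * \<omega> * cis (- (\<omega> * x)))
      = (LINT x|lborel. \<i> * \<omega> * (cis (- (\<omega> * x)) * box_kernel \<eta> x))"
    unfolding set_lebesgue_integral_def
    by (intro Bochner_Integration.integral_cong) (auto simp: indicator_def box_kernel_def)
  ultimately have "(LINT x|lborel. \<i> * \<omega> * (cis (- (\<omega> * x)) * box_kernel \<eta> x)) = 1 - cis (- (\<omega> * \<eta>))"
    by simp
  then show ?thesis
    unfolding ft_def by (simp only: Bochner_Integration.integral_mult_right_zero)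
qed

section \<open>Iterated derivatives and their differences\<close>

lemma nth_deriv_Suc: "nth_deriv (Suc n) f = nth_deriv n (\<lambda>x. vector_derivative f (at x))"
  unfolding nth_deriv_def funpow_Suc_right o_def ..

lemma nth_deriv_Suc': "nth_deriv (Suc n) f x = vector_derivative (nth_deriv n f) (at x)"
  by (simp add: nth_deriv_def)

text \<open>Peels off the first derivative instead of the last, which is the shape required by
  inductions that generalise over the function.\<close>

lemma n_times_differentiable_Suc:
  "n_times_differentiable (Suc n) f \<longleftrightarrow>
     (\<forall>x. f differentiable (at x)) \<and> n_times_differentiable n (\<lambda>x. vector_derivative f (at x))"
proof -
  have "(\<forall>k<Suc n. \<forall>x. nth_deriv k f differentiable (at x)) \<longleftrightarrow>
     (\<forall>x. nth_deriv 0 f differentiable (at x)) \<and> (\<forall>k<n. \<forall>x. nth_deriv (Suc k) f differentiable (at x))"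
    by (auto simp: less_Suc_eq_0_disj)
  then show ?thesis
    unfolding n_times_differentiable_def nth_deriv_Suc by (simp add: nth_deriv_def)
qed

text \<open>Taking \<open>n\<close>-fold differences makes the conclusion independent of any integrability of \<open>f\<close> itself:
  only the top derivative is assumed integrable.\<close>

lemma bdiff_pow_nth_deriv:
  assumes "n_times_differentiable n f" "integrable lborel (nth_deriv n f)" "\<eta> > 0"
  shows "integrable lborel ((bdiff \<eta> ^^ n) f) \<and>
         ft ((bdiff \<eta> ^^ n) f) \<omega> = ft (box_kernel \<eta>) \<omega> ^ n * ft (nth_deriv n f) \<omega>"
  using assms
proof (induction n arbitrary: f)
  case 0
  then show ?case by (simp add: nth_deriv_def)
next
  case (Suc n)
  define f' where "f' = (\<lambda>x. vector_derivative f (at x))"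
  have f': "(f has_vector_derivative f' x) (at x)" for x
    using Suc.prems(1) by (auto simp: n_times_differentiable_Suc f'_def vector_derivative_works)
  have IH: "integrable lborel ((bdiff \<eta> ^^ n) f')"
     "ft ((bdiff \<eta> ^^ n) f') \<omega> = ft (box_kernel \<eta>) \<omega> ^ n * ft (nth_deriv n f') \<omega>"
    using Suc by (auto simp: n_times_differentiable_Suc nth_deriv_Suc f'_def)
  \<comment> \<open>Differences commute with differentiation, so the last difference of the already
    differenced \<open>f\<close> is a box convolution of the differenced \<open>f'\<close>, which is
    integrable by induction.\<close>
  have eq: "(bdiff \<eta> ^^ Suc n) f = (\<lambda>x. LINT s|lborel. (bdiff \<eta> ^^ n) f' (x - s) * box_kernel \<eta> s)"
    using bdiff_eq_convolution[OF bdiff_pow_has_vector_derivative[OF f'] IH(1) \<open>\<eta> > 0\<close>]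
    by (simp add: fun_eq_iff)
  show ?case
    unfolding eq nth_deriv_Suc f'_def[symmetric]
    using integrable_convolution[OF IH(1) integrable_box_kernel[of \<eta>]]
      ft_convolution[OF IH(1) integrable_box_kernel[of \<eta>]] IH(2) by simp
qed

subsection \<open>The symbol of the weighted difference operator\<close>

lemma one_minus_cis: "1 - cis (- \<theta>) = 2 * \<i> * sin (\<theta> / 2) * cis (- (\<theta> / 2))"
proof -
  have "1 - cis (- \<theta>) = cis (- (\<theta> / 2)) * (cis (\<theta> / 2) - cis (- (\<theta> / 2)))"
    by (simp add: right_diff_distrib cis_mult)
  then show ?thesis
    by (simp add: complex_eq_iff)
qed

lemma Ln_i_times:
  assumes "\<theta> \<noteq> 0"
  shows "Ln (\<i> * of_real \<theta>) = of_real (ln \<bar>\<theta>\<bar>) + \<i> * (sgn \<theta> * pi / 2)"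
proof (rule Ln_unique)
  show "exp (of_real (ln \<bar>\<theta>\<bar>) + \<i> * of_real (sgn \<theta> * pi / 2)) = \<i> * of_real \<theta>"
  proof -
    have "exp (\<i> * of_real (sgn \<theta> * pi / 2)) = cis (sgn \<theta> * pi / 2)"
      by (simp only: cis_conv_exp)
    also have "\<dots> = \<i> * of_real (sgn \<theta>)"
      using assms by (auto simp: sgn_if complex_eq_iff)
    finally show ?thesis
      using assms by (simp only: exp_add exp_of_real) (auto simp: sgn_if complex_eq_iff)
  qed
qed (auto simp: sgn_if)

text \<open>A complex power of a product splits only when the principal logarithms add. Here the
  arguments are \<open>sgn \<theta> * pi / 2\<close>, \<open>- \<theta> / 2\<close> and 0, and their
  sum stays inside the principal strip because |\<theta>| < pi.\<close>

lemma powr_one_minus_cis: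
  assumes "0 < \<bar>\<theta>\<bar>" "\<bar>\<theta>\<bar> < pi"
  shows "(1 - cis (- \<theta>)) powr of_real \<alpha>
           = (\<i> * of_real \<theta>) powr of_real \<alpha> * cis (- (\<alpha> * \<theta> / 2)) * of_real ((sin (\<theta> / 2) / (\<theta> / 2)) powr \<alpha>)"
proof -
  define S where "S = sin (\<theta> / 2) / (\<theta> / 2)"
  have "S > 0"
  proof (cases "\<theta> > 0")
    case True
    then show ?thesis using assms by (auto simp: S_def intro!: divide_pos_pos sin_gt_zero)
  next
    case False
    then have "sin (- (\<theta> / 2)) > 0" using assms by (intro sin_gt_zero) auto
    then show ?thesis using False assms by (auto simp: S_def intro!: divide_neg_neg)
  qed
  have eq: "1 - cis (- \<theta>) = \<i> * of_real \<theta> * cis (- (\<theta> / 2)) * of_real S"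
    using assms by (subst one_minus_cis) (simp add: S_def)
  have "Ln (1 - cis (- \<theta>)) = Ln (\<i> * of_real \<theta>) + \<i> * of_real (- (\<theta> / 2)) + of_real (ln S)"
  proof (rule Ln_unique)
    show "exp (Ln (\<i> * of_real \<theta>) + \<i> * of_real (- (\<theta> / 2)) + of_real (ln S)) = 1 - cis (- \<theta>)"
      unfolding exp_add eq using assms \<open>S > 0\<close> by (simp add: exp_of_real cis_conv_exp)
  qed (use assms in \<open>auto simp: Ln_i_times sgn_if\<close>)
  note Ln_eq = this
  have "1 - cis (- \<theta>) \<noteq> 0"
    unfolding eq using assms \<open>S > 0\<close> by simp
  then have "(1 - cis (- \<theta>)) powr of_real \<alpha>
      = exp (of_real \<alpha> * Ln (\<i> * of_real \<theta>) + \<i> * of_real (- (\<alpha> * \<theta> / 2)) + of_real (\<alpha> * ln S))"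
    unfolding powr_def Ln_eq by (simp add: algebra_simps)
  also have "\<dots> = (\<i> * of_real \<theta>) powr of_real \<alpha> * cis (- (\<alpha> * \<theta> / 2)) * of_real (S powr \<alpha>)"
    using assms \<open>S > 0\<close> unfolding exp_add by (simp add: powr_def cis_conv_exp flip: exp_of_real)
  finally show ?thesis unfolding S_def .
qed

lemma sinc_powr_expansion:
  fixes \<alpha> :: real
  shows
  "\<exists>c \<delta>. \<delta> > 0 \<and> (\<forall>\<theta>. 0 < \<bar>\<theta>\<bar> \<and> \<bar>\<theta>\<bar> < \<delta> \<longrightarrow>
     \<bar>(sin (\<theta> / 2) / (\<theta> / 2)) powr \<alpha> - (1 - \<alpha> * \<theta>\<^sup>2 / 24)\<bar> \<le> c * \<bar>\<theta>\<bar> ^ 3)"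
proof -
  have "(\<lambda>\<theta>::real. (sin (\<theta> / 2) / (\<theta> / 2)) powr \<alpha> - (1 - \<alpha> * \<theta>\<^sup>2 / 24)) \<in> O[at_right 0](\<lambda>\<theta>. \<theta> ^ 3)"
    by real_asymp
  then obtain c where "eventually (\<lambda>\<theta>::real. norm ((sin (\<theta> / 2) / (\<theta> / 2)) powr \<alpha> - (1 - \<alpha> * \<theta>\<^sup>2 / 24)) \<le> c * norm (\<theta> ^ 3)) (at_right 0)"
    by (elim landau_o.bigE)
  then obtain \<delta> where "\<delta> > 0" and
    \<delta>: "\<And>\<theta>. 0 < \<theta> \<Longrightarrow> \<theta> < \<delta> \<Longrightarrow> \<bar>(sin (\<theta> / 2) / (\<theta> / 2)) powr \<alpha> - (1 - \<alpha> * \<theta>\<^sup>2 / 24)\<bar> \<le> c * \<theta> ^ 3"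
    unfolding eventually_at_right_field by auto
  \<comment> \<open>The left side is even in \<theta>, so the one-sided expansion at 0 also covers
    negative \<theta>.\<close>
  have "\<bar>(sin (\<theta> / 2) / (\<theta> / 2)) powr \<alpha> - (1 - \<alpha> * \<theta>\<^sup>2 / 24)\<bar> \<le> c * \<bar>\<theta>\<bar> ^ 3" if "0 < \<bar>\<theta>\<bar>" "\<bar>\<theta>\<bar> < \<delta>" for \<theta>
    using \<delta>[OF that] by (cases "\<theta> > 0") (auto simp: abs_if)
  then show ?thesis using \<open>\<delta> > 0\<close> by blast
qed

lemma cis_quadratic_expansion:
  "norm (cis t - (1 + \<i> * of_real t - of_real (t\<^sup>2 / 2))) \<le> \<bar>t\<bar> ^ 3 / 6"
  using iexp_approx1[of t 2]
  by (simp add: numeral_eq_Suc cis_conv_exp power_mult_distrib field_simps)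

text \<open>The three moments are the coefficients needed to cancel the expansion of the symbol
  through second order. The nodes are moved by \<open>\<alpha> / 2\<close> because
  \<open>(1 - cis (- \<theta>)) powr \<alpha>\<close> carries the phase
  \<open>cis (- (\<alpha> * \<theta> / 2))\<close>.\<close>

lemma wsgd_weight_moments:
  fixes \<alpha> :: real and p q r :: int
  assumes "p \<noteq> q" "p \<noteq> r" "q \<noteq> r"
  defines "a \<equiv> wsgd_weight \<alpha> p q r" and "b \<equiv> wsgd_weight \<alpha> q p r" and "c \<equiv> wsgd_weight \<alpha> r p q"
  shows "a + b + c = 1"
    and "a * (p - \<alpha> / 2) + b * (q - \<alpha> / 2) + c * (r - \<alpha> / 2) = 0"
    and "a * (p - \<alpha> / 2)\<^sup>2 + b * (q - \<alpha> / 2)\<^sup>2 + c * (r - \<alpha> / 2)\<^sup>2 = - \<alpha> / 12"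
proof -
  define P Q R where "P = p - \<alpha> / 2" and "Q = q - \<alpha> / 2" and "R = r - \<alpha> / 2"
  have ne: "P - Q \<noteq> 0" "P - R \<noteq> 0" "Q - R \<noteq> 0"
    using assms by (auto simp: P_def Q_def R_def)
  have ne': "Q - P \<noteq> 0" "R - P \<noteq> 0" "R - Q \<noteq> 0" using ne by auto
  \<comment> \<open>This is the value on the Lagrange basis polynomial
    \<open>(X - Q) * (X - R) / ((P - Q) * (P - R))\<close> of the functional sending
    \<open>1, X, X^2\<close> to \<open>1, 0, - \<alpha> / 12\<close>.\<close>
  have a: "a = (Q * R - \<alpha> / 12) / ((P - Q) * (P - R))"
  proof -
    have "12 * of_int (q * r - p * q - p * r + p\<^sup>2) = 12 * ((P - Q) * (P - R))"
      by (simp add: P_def Q_def R_def algebra_simps power2_eq_square)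
    moreover have "12 * of_int (q * r) - of_int (6 * q + 6 * r + 1) * \<alpha> + 3 * \<alpha>\<^sup>2 = 12 * (Q * R - \<alpha> / 12)"
      by (simp add: P_def Q_def R_def field_simps power2_eq_square)
    ultimately show ?thesis
      unfolding a_def wsgd_weight_def by (simp only: mult_divide_mult_cancel_left_if) simp
  qed
  have b: "b = (P * R - \<alpha> / 12) / ((Q - P) * (Q - R))"
  proof -
    have "12 * of_int (p * r - q * p - q * r + q\<^sup>2) = 12 * ((Q - P) * (Q - R))"
      by (simp add: P_def Q_def R_def algebra_simps power2_eq_square)
    moreover have "12 * of_int (p * r) - of_int (6 * p + 6 * r + 1) * \<alpha> + 3 * \<alpha>\<^sup>2 = 12 * (P * R - \<alpha> / 12)"
      by (simp add: P_def Q_def R_def field_simps power2_eq_square)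
    ultimately show ?thesis
      unfolding b_def wsgd_weight_def by (simp only: mult_divide_mult_cancel_left_if) simp
  qed
  have c: "c = (P * Q - \<alpha> / 12) / ((R - P) * (R - Q))"
  proof -
    have "12 * of_int (p * q - r * p - r * q + r\<^sup>2) = 12 * ((R - P) * (R - Q))"
      by (simp add: P_def Q_def R_def algebra_simps power2_eq_square)
    moreover have "12 * of_int (p * q) - of_int (6 * p + 6 * q + 1) * \<alpha> + 3 * \<alpha>\<^sup>2 = 12 * (P * Q - \<alpha> / 12)"
      by (simp add: P_def Q_def R_def field_simps power2_eq_square)
    ultimately show ?thesis
      unfolding c_def wsgd_weight_def by (simp only: mult_divide_mult_cancel_left_if) simp
  qed
  \<comment> \<open>Up to sign the Vandermonde determinant of the nodes; multiplying by it makes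
    each moment identity polynomial.\<close>
  define D where "D = (P - Q) * (P - R) * (Q - R)"
  have "D \<noteq> 0" using ne by (simp add: D_def)
  have "a * ((P - Q) * (P - R)) = Q * R - \<alpha> / 12" "b * ((Q - P) * (Q - R)) = P * R - \<alpha> / 12"
    "c * ((R - P) * (R - Q)) = P * Q - \<alpha> / 12"
    unfolding a b c using ne ne' by auto
  moreover have "D = (P - Q) * (P - R) * (Q - R)" "D = (Q - P) * (Q - R) * - (P - R)"
    "D = (R - P) * (R - Q) * (P - Q)"
    by (auto simp: D_def algebra_simps)
  ultimately have a': "a * D = (Q * R - \<alpha> / 12) * (Q - R)" and b': "b * D = (P * R - \<alpha> / 12) * - (P - R)"
    and c': "c * D = (P * Q - \<alpha> / 12) * (P - Q)"
    by (metis mult.assoc)+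
  have "(a + b + c) * D = a * D + b * D + c * D"
    by (simp add: algebra_simps)
  also have "\<dots> = 1 * D"
    unfolding a' b' c' unfolding D_def by (simp add: field_simps)
  finally have "(a + b + c) * D = 1 * D" .
  then show "a + b + c = 1" using \<open>D \<noteq> 0\<close> by simp
  have "(a * P + b * Q + c * R) * D = a * D * P + b * D * Q + c * D * R"
    by (simp add: algebra_simps)
  also have "\<dots> = 0"
    unfolding a' b' c' by (simp add: field_simps)
  finally show "a * (p - \<alpha> / 2) + b * (q - \<alpha> / 2) + c * (r - \<alpha> / 2) = 0"
    using \<open>D \<noteq> 0\<close> by (simp add: P_def Q_def R_def)
  have "(a * P\<^sup>2 + b * Q\<^sup>2 + c * R\<^sup>2) * D = a * D * P\<^sup>2 + b * D * Q\<^sup>2 + c * D * R\<^sup>2"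
    by (simp add: algebra_simps)
  also have "\<dots> = (- \<alpha> / 12) * D"
    unfolding a' b' c' unfolding D_def by (simp add: field_simps power2_eq_square)
  finally show "a * (p - \<alpha> / 2)\<^sup>2 + b * (q - \<alpha> / 2)\<^sup>2 + c * (r - \<alpha> / 2)\<^sup>2 = - \<alpha> / 12"
    using \<open>D \<noteq> 0\<close> unfolding P_def Q_def R_def by (simp only: mult_cancel_right) simp
qed

text \<open>With \<open>x = \<alpha> * \<theta>^2 / 24\<close>, the moments make the exponential sum
  \<open>1 + x + y\<close>, while the sinc power is \<open>1 - x + z\<close>, with \<open>y\<close>
  and \<open>z\<close> of third order. The quadratic terms cancel in the product.\<close>

lemma wsgd_symbol_near_zero:
  fixes \<alpha> a b c P Q R :: real
  assumes "a + b + c = 1" "a * P + b * Q + c * R = 0" "a * P\<^sup>2 + b * Q\<^sup>2 + c * R\<^sup>2 = - \<alpha> / 12" "\<alpha> > 0"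
  shows "\<exists>C \<delta>. \<delta> > 0 \<and> \<delta> \<le> 1 \<and> (\<forall>\<theta>. 0 < \<bar>\<theta>\<bar> \<and> \<bar>\<theta>\<bar> < \<delta> \<longrightarrow>
    norm ((a * cis (P * \<theta>) + b * cis (Q * \<theta>) + c * cis (R * \<theta>)) * of_real ((sin (\<theta> / 2) / (\<theta> / 2)) powr \<alpha>) - 1)
      \<le> C * \<bar>\<theta>\<bar> ^ 3)"
proof -
  obtain B \<delta> where "\<delta> > 0" and B: "\<And>\<theta>. 0 < \<bar>\<theta>\<bar> \<Longrightarrow> \<bar>\<theta>\<bar> < \<delta> \<Longrightarrow>
     \<bar>(sin (\<theta> / 2) / (\<theta> / 2)) powr \<alpha> - (1 - \<alpha> * \<theta>\<^sup>2 / 24)\<bar> \<le> B * \<bar>\<theta>\<bar> ^ 3"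
    using sinc_powr_expansion[of \<alpha>] by auto
  define E where "E = \<bar>a\<bar> * \<bar>P\<bar> ^ 3 + \<bar>b\<bar> * \<bar>Q\<bar> ^ 3 + \<bar>c\<bar> * \<bar>R\<bar> ^ 3"
  have "E \<ge> 0" by (simp add: E_def)
  \<comment> \<open>The three summands bound, in this order, \<open>x^2\<close>,
    \<open>(1 + x) * z\<close> and \<open>y * (1 - x + z)\<close>, each after division by
    |\<theta>|^3.\<close>
  define C where "C = (\<alpha> / 24)\<^sup>2 + (1 + \<alpha> / 24) * \<bar>B\<bar> + E * (1 + \<alpha> / 24 + \<bar>B\<bar>)"
  have "norm ((a * cis (P * \<theta>) + b * cis (Q * \<theta>) + c * cis (R * \<theta>)) * of_real ((sin (\<theta> / 2) / (\<theta> / 2)) powr \<alpha>) - 1)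
      \<le> C * \<bar>\<theta>\<bar> ^ 3" if \<theta>: "0 < \<bar>\<theta>\<bar>" "\<bar>\<theta>\<bar> < min 1 \<delta>" for \<theta>
  proof -
    define e where "e t = cis t - (1 + \<i> * of_real t - of_real (t\<^sup>2 / 2))" for t
    define y where "y = a * e (P * \<theta>) + b * e (Q * \<theta>) + c * e (R * \<theta>)"
    define x where "x = \<alpha> * \<theta>\<^sup>2 / 24"
    define z where "z = (sin (\<theta> / 2) / (\<theta> / 2)) powr \<alpha> - (1 - x)"
    define t where "t = \<bar>\<theta>\<bar> ^ 3"
    have t: "0 \<le> t" "t \<le> 1" using \<theta> by (auto simp: t_def power_le_one)
    have ne: "norm (e s) \<le> \<bar>s\<bar> ^ 3" for s
      using cis_quadratic_expansion[of s] zero_le_power[of "\<bar>s\<bar>" 3] unfolding e_def by linarith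
    have "norm y \<le> \<bar>a\<bar> * norm (e (P * \<theta>)) + \<bar>b\<bar> * norm (e (Q * \<theta>)) + \<bar>c\<bar> * norm (e (R * \<theta>))"
      unfolding y_def by (intro norm_triangle_le add_mono) (auto simp: norm_mult)
    also have "\<dots> \<le> \<bar>a\<bar> * \<bar>P * \<theta>\<bar> ^ 3 + \<bar>b\<bar> * \<bar>Q * \<theta>\<bar> ^ 3 + \<bar>c\<bar> * \<bar>R * \<theta>\<bar> ^ 3"
      by (intro add_mono mult_left_mono ne) auto
    also have "\<dots> = E * t"
      by (simp add: E_def t_def abs_mult power_mult_distrib algebra_simps)
    finally have y: "norm y \<le> E * t" .
    have z: "\<bar>z\<bar> \<le> \<bar>B\<bar> * t"
      using B[of \<theta>] \<theta> mult_right_mono[OF abs_ge_self[of B] t(1)] unfolding z_def x_def t_def by linarith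
    have x0: "0 \<le> x" using assms(4) by (simp add: x_def)
    have "x \<le> \<alpha> * 1 / 24"
      unfolding x_def using \<theta> assms(4)
      by (intro divide_right_mono mult_left_mono) (auto simp: abs_square_le_1)
    then have x1: "x \<le> \<alpha> / 24" by simp
    \<comment> \<open>The term is of fourth order; one factor |\<theta>| is given away using
      |\<theta>| < 1.\<close>
    have "x\<^sup>2 = (\<alpha> / 24)\<^sup>2 * (\<bar>\<theta>\<bar> * t)"
      by (simp add: x_def t_def power2_eq_square power3_eq_cube)
    also have "\<dots> \<le> (\<alpha> / 24)\<^sup>2 * (1 * t)"
      using \<theta> t by (intro mult_left_mono mult_right_mono) auto
    finally have x2: "x\<^sup>2 \<le> (\<alpha> / 24)\<^sup>2 * t" by simp
    have "a * cis (P * \<theta>) + b * cis (Q * \<theta>) + c * cis (R * \<theta>)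
       = of_real (a + b + c) + \<i> * of_real ((a * P + b * Q + c * R) * \<theta>)
         - of_real ((a * P\<^sup>2 + b * Q\<^sup>2 + c * R\<^sup>2) * \<theta>\<^sup>2 / 2) + y"
      unfolding y_def e_def by (simp add: field_simps power_mult_distrib)
    also have "\<dots> = 1 + of_real x + y"
      unfolding assms by (simp add: x_def)
    finally have "(a * cis (P * \<theta>) + b * cis (Q * \<theta>) + c * cis (R * \<theta>)) * of_real ((sin (\<theta> / 2) / (\<theta> / 2)) powr \<alpha>) - 1
       = (1 + of_real x + y) * of_real (1 - x + z) - 1"
      by (simp add: z_def)
    also have "\<dots> = of_real (- (x\<^sup>2)) + of_real ((1 + x) * z) + y * of_real (1 - x + z)"
      by (simp add: algebra_simps power2_eq_square)
    also have "norm \<dots> \<le> norm (complex_of_real (- (x\<^sup>2))) + norm (complex_of_real ((1 + x) * z)) + norm (y * of_real (1 - x + z))"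
      by (intro norm_triangle_le add_mono) auto
    also have "\<dots> = x\<^sup>2 + (1 + x) * \<bar>z\<bar> + norm y * \<bar>1 - x + z\<bar>"
      unfolding norm_of_real norm_mult using x0 by (simp add: abs_mult)
    also have "\<dots> \<le> (\<alpha> / 24)\<^sup>2 * t + (1 + \<alpha> / 24) * (\<bar>B\<bar> * t) + (E * t) * (1 + \<alpha> / 24 + \<bar>B\<bar>)"
    proof (intro add_mono mult_mono x2 z y)
      have "\<bar>B\<bar> * t \<le> \<bar>B\<bar> * 1" using t by (intro mult_left_mono) auto
      then show "\<bar>1 - x + z\<bar> \<le> 1 + \<alpha> / 24 + \<bar>B\<bar>" using x0 x1 z by linarith
    qed (use x0 x1 t \<open>E \<ge> 0\<close> assms(4) in auto)
    also have "\<dots> = C * t" by (simp add: C_def algebra_simps)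
    finally show ?thesis unfolding t_def .
  qed
  then show ?thesis using \<open>\<delta> > 0\<close>
    by (intro exI[of _ C] exI[of _ "min 1 \<delta>"]) auto
qed

lemma norm_i_times_powr: "norm ((\<i> * of_real \<theta>) powr of_real \<alpha>) = \<bar>\<theta>\<bar> powr \<alpha>"
  by (simp add: norm_powr_real_powr' norm_mult)

text \<open>The expansion at 0 gives the bound for small \<theta>. For |\<theta>| at least \<delta>,
  both parts of the difference are at most a constant times \<open>|\<theta>| powr \<alpha>\<close>,
  and three further powers of |\<theta>| cost only a constant. A bound for all real \<theta> is
  required since \<open>\<omega> * h\<close> is unbounded for every fixed \<open>h\<close>.\<close>

lemma wsgd_symbol_bound:
  fixes \<alpha> :: real and p q r :: int
  assumes "\<alpha> > 0" "p \<noteq> q" "p \<noteq> r" "q \<noteq> r"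
  shows "\<exists>C. \<forall>\<theta>::real. norm ((wsgd_weight \<alpha> p q r * cis (p * \<theta>) + wsgd_weight \<alpha> q p r * cis (q * \<theta>)
      + wsgd_weight \<alpha> r p q * cis (r * \<theta>)) * (1 - cis (- \<theta>)) powr of_real \<alpha>
      - (\<i> * of_real \<theta>) powr of_real \<alpha>) \<le> C * \<bar>\<theta>\<bar> powr (\<alpha> + 3)"
proof -
  define a b c where "a = wsgd_weight \<alpha> p q r" and "b = wsgd_weight \<alpha> q p r" and "c = wsgd_weight \<alpha> r p q"
  define W where "W \<theta> = a * cis (p * \<theta>) + b * cis (q * \<theta>) + c * cis (r * \<theta>)" for \<theta> :: real
  obtain C \<delta> where "\<delta> > 0" "\<delta> \<le> 1" and C: "\<And>\<theta>. 0 < \<bar>\<theta>\<bar> \<Longrightarrow> \<bar>\<theta>\<bar> < \<delta> \<Longrightarrow>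
    norm ((a * cis ((p - \<alpha> / 2) * \<theta>) + b * cis ((q - \<alpha> / 2) * \<theta>) + c * cis ((r - \<alpha> / 2) * \<theta>))
      * of_real ((sin (\<theta> / 2) / (\<theta> / 2)) powr \<alpha>) - 1) \<le> C * \<bar>\<theta>\<bar> ^ 3"
    using wsgd_symbol_near_zero[OF wsgd_weight_moments[OF assms(2-4)] assms(1)]
    unfolding a_def b_def c_def by blast
  have near: "norm (W \<theta> * (1 - cis (- \<theta>)) powr of_real \<alpha> - (\<i> * of_real \<theta>) powr of_real \<alpha>) \<le> C * \<bar>\<theta>\<bar> powr (\<alpha> + 3)"
    if \<theta>: "0 < \<bar>\<theta>\<bar>" "\<bar>\<theta>\<bar> < \<delta>" for \<theta>
  proof -
    have shift: "cis (p * \<theta>) * cis (- (\<alpha> * \<theta> / 2)) = cis ((p - \<alpha> / 2) * \<theta>)" for p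
      by (simp add: cis_mult field_simps)
    have "\<bar>\<theta>\<bar> < pi" using \<theta> \<open>\<delta> \<le> 1\<close> pi_gt3 by linarith
    have "W \<theta> * (1 - cis (- \<theta>)) powr of_real \<alpha> - (\<i> * of_real \<theta>) powr of_real \<alpha>
      = (\<i> * of_real \<theta>) powr of_real \<alpha> *
        ((a * cis ((p - \<alpha> / 2) * \<theta>) + b * cis ((q - \<alpha> / 2) * \<theta>) + c * cis ((r - \<alpha> / 2) * \<theta>))
          * of_real ((sin (\<theta> / 2) / (\<theta> / 2)) powr \<alpha>) - 1)"
      unfolding powr_one_minus_cis[OF \<theta>(1) \<open>\<bar>\<theta>\<bar> < pi\<close>] W_def shift[symmetric]
      by (simp add: algebra_simps)
    also have "norm \<dots> \<le> \<bar>\<theta>\<bar> powr \<alpha> * (C * \<bar>\<theta>\<bar> ^ 3)"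
      unfolding norm_mult[of "_ powr _"] norm_i_times_powr by (intro mult_left_mono C \<theta>) auto
    also have "\<dots> = C * \<bar>\<theta>\<bar> powr (\<alpha> + 3)"
      using \<theta> by (simp add: powr_add)
    finally show ?thesis .
  qed
  define A where "A = \<bar>a\<bar> + \<bar>b\<bar> + \<bar>c\<bar>"
  have far: "norm (W \<theta> * (1 - cis (- \<theta>)) powr of_real \<alpha> - (\<i> * of_real \<theta>) powr of_real \<alpha>)
      \<le> (A * (2 / \<delta>) powr \<alpha> + 1) / \<delta> ^ 3 * \<bar>\<theta>\<bar> powr (\<alpha> + 3)" if \<theta>: "\<delta> \<le> \<bar>\<theta>\<bar>" for \<theta>
  proof -
    have "A \<ge> 0" by (simp add: A_def)
    have W: "norm (W \<theta>) \<le> A"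
      unfolding W_def A_def by (intro norm_triangle_le add_mono) (auto simp: norm_mult)
    have "norm (1 - cis (- \<theta>)) \<le> 2"
      using norm_triangle_ineq4[of 1 "cis (- \<theta>)"] by simp
    also have "\<dots> \<le> 2 / \<delta> * \<bar>\<theta>\<bar>" using \<theta> \<open>\<delta> > 0\<close> by (simp add: field_simps)
    finally have "norm (1 - cis (- \<theta>)) powr \<alpha> \<le> (2 / \<delta> * \<bar>\<theta>\<bar>) powr \<alpha>"
      using assms by (intro powr_mono2) auto
    then have D: "norm ((1 - cis (- \<theta>)) powr of_real \<alpha>) \<le> (2 / \<delta>) powr \<alpha> * \<bar>\<theta>\<bar> powr \<alpha>"
      using \<open>\<delta> > 0\<close> by (simp add: norm_powr_real_powr' powr_mult powr_divide)
    have "norm (W \<theta> * (1 - cis (- \<theta>)) powr of_real \<alpha> - (\<i> * of_real \<theta>) powr of_real \<alpha>)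
       \<le> norm (W \<theta>) * norm ((1 - cis (- \<theta>)) powr of_real \<alpha>) + \<bar>\<theta>\<bar> powr \<alpha>"
      by (rule order_trans[OF norm_triangle_ineq4]) (simp add: norm_mult norm_i_times_powr)
    also have "\<dots> \<le> A * ((2 / \<delta>) powr \<alpha> * \<bar>\<theta>\<bar> powr \<alpha>) + \<bar>\<theta>\<bar> powr \<alpha>"
      using \<open>A \<ge> 0\<close> by (intro add_mono mult_mono W D) auto
    also have "\<dots> = (A * (2 / \<delta>) powr \<alpha> + 1) * \<bar>\<theta>\<bar> powr \<alpha> * 1"
      by (simp add: algebra_simps)
    \<comment> \<open>The missing third power is inserted as
      \<open>(|\<theta>| / \<delta>) ^ 3\<close>, which is at least 1 in this range.\<close>
    also have "\<dots> \<le> (A * (2 / \<delta>) powr \<alpha> + 1) * \<bar>\<theta>\<bar> powr \<alpha> * (\<bar>\<theta>\<bar> / \<delta>) ^ 3"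
      using \<open>A \<ge> 0\<close> \<theta> \<open>\<delta> > 0\<close> by (intro mult_left_mono one_le_power) (auto simp: field_simps intro!: add_nonneg_nonneg)
    also have "\<dots> = (A * (2 / \<delta>) powr \<alpha> + 1) / \<delta> ^ 3 * \<bar>\<theta>\<bar> powr (\<alpha> + 3)"
      using \<theta> \<open>\<delta> > 0\<close> by (simp add: powr_add power_divide)
    finally show ?thesis .
  qed
  define K where "K = max C ((A * (2 / \<delta>) powr \<alpha> + 1) / \<delta> ^ 3)"
  have "norm (W \<theta> * (1 - cis (- \<theta>)) powr of_real \<alpha> - (\<i> * of_real \<theta>) powr of_real \<alpha>) \<le> K * \<bar>\<theta>\<bar> powr (\<alpha> + 3)" for \<theta>
  proof -
    \<comment> \<open>At 0 every power in the claim has base 0 and so vanishes.\<close>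
    consider "\<theta> = 0" | "0 < \<bar>\<theta>\<bar>" "\<bar>\<theta>\<bar> < \<delta>" | "\<delta> \<le> \<bar>\<theta>\<bar>" by fastforce
    then show ?thesis
    proof cases
      case 2
      from near[OF this] show ?thesis
        by (rule order_trans) (rule mult_right_mono, simp_all add: K_def)
    next
      case 3
      from far[OF this] show ?thesis
        by (rule order_trans) (rule mult_right_mono, simp_all add: K_def)
    qed simp
  qed
  then show ?thesis unfolding W_def a_def b_def c_def by blast
qed

subsection \<open>Laplace transform of power kernels\<close>

text \<open>Extended by zero to the negative half line, so that half-line integrals become
  convolutions on the whole line. There is no Gamma factor, in agreement with
  \<open>rl_integral\<close>.\<close>

definition power_kernel :: "real \<Rightarrow> real \<Rightarrow> real" where
  "power_kernel \<sigma> t = (if t > 0 then t powr (\<sigma> - 1) else 0)"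

lemma power_kernel_measurable [measurable]: "power_kernel \<sigma> \<in> borel_measurable borel"
  unfolding power_kernel_def[abs_def] by measurable

lemma power_kernel_nonneg [simp]: "power_kernel \<sigma> t \<ge> 0"
  by (simp add: power_kernel_def)

lemma has_bochner_integral_power_kernel_exp:
  assumes "\<sigma> > 0"
  shows "has_bochner_integral lborel (\<lambda>t. power_kernel \<sigma> t * exp (- t)) (Gamma \<sigma>)"
proof (rule has_bochner_integral_nn_integral)
  have "(\<integral>\<^sup>+ t. ennreal (power_kernel \<sigma> t * exp (- t)) \<partial>lborel)
      = (\<integral>\<^sup>+ t. ennreal (indicator {0..} t * t powr (\<sigma> - 1) / exp t) \<partial>lborel)"
    by (intro nn_integral_cong) (auto simp: power_kernel_def indicator_def exp_minus field_simps)
  then show "(\<integral>\<^sup>+ t. ennreal (power_kernel \<sigma> t * exp (- t)) \<partial>lborel) = ennreal (Gamma \<sigma>)"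
    using Gamma_conv_nn_integral_real[OF assms] by simp
qed (use Gamma_real_pos[OF assms] in \<open>auto\<close>)

lemma gbinomial_of_real: "(complex_of_real a gchoose k) = of_real (a gchoose k)"
proof -
  have "pochhammer (- complex_of_real a) k = of_real (pochhammer (- a) k)"
    using pochhammer_of_real[of "- a" k] by simp
  then show ?thesis by (simp add: gbinomial_pochhammer)
qed

text \<open>Expanding \<open>exp (z t)\<close> turns the integral into the binomial series of \<open>(1 - z) powr (- \<sigma>)\<close>.\<close>

lemma power_kernel_laplace_near_one:
  fixes z :: complex
  assumes "\<sigma> > 0" "norm z < 1"
  shows "has_bochner_integral lborel (\<lambda>t. of_real (power_kernel \<sigma> t) * exp (- (1 - z) * of_real t))
           (Gamma (of_real \<sigma>) * (1 - z) powr (- of_real \<sigma>))"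
proof -
  define f where "f k t = complex_of_real (power_kernel \<sigma> t * exp (- t)) * ((z * of_real t) ^ k / fact k)" for k t
  have power: "power_kernel \<sigma> t * exp (- t) * t ^ k = power_kernel (\<sigma> + real k) t * exp (- t)" for t k
    by (auto simp: power_kernel_def powr_add powr_realpow powr_diff field_simps)
  have mom: "has_bochner_integral lborel (\<lambda>t. power_kernel \<sigma> t * exp (- t) * t ^ k) (Gamma (\<sigma> + real k))" for k
    unfolding power using assms by (intro has_bochner_integral_power_kernel_exp) auto
  have nonpos: "\<sigma> \<notin> \<int>\<^sub>\<le>\<^sub>0" using assms by (auto simp: nonpos_Ints_def)
  \<comment> \<open>The moments of the Gamma density are Pochhammer multiples of
    \<open>Gamma \<sigma>\<close>; this identifies them with the binomial coefficients of
    \<open>- \<sigma>\<close>.\<close>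
  have coeff: "Gamma (\<sigma> + real k) / fact k = Gamma \<sigma> * ((- 1) ^ k * ((- \<sigma>) gchoose k))" for k
    using Gamma_real_pos[OF assms(1)]
    by (simp add: gbinomial_pochhammer pochhammer_Gamma[OF nonpos] flip: power_mult_distrib)
  have f_eq: "f k t = (z ^ k / fact k) * of_real (power_kernel \<sigma> t * exp (- t) * t ^ k)" for k t
    by (simp add: f_def power_mult_distrib)
  have f_int: "has_bochner_integral lborel (f k) ((z ^ k / fact k) * of_real (Gamma (\<sigma> + real k)))" for k
    unfolding f_eq by (intro has_bochner_integral_mult_right has_bochner_integral_of_real mom)
  have norm_f: "norm (f k t) = (norm z ^ k / fact k) * (power_kernel \<sigma> t * exp (- t) * t ^ k)" for k t
    by (auto simp: f_eq norm_mult norm_divide norm_power power_kernel_def)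
  have norm_int: "(LINT t|lborel. norm (f k t)) = (norm z ^ k / fact k) * Gamma (\<sigma> + real k)" for k
    unfolding norm_f using has_bochner_integral_integral_eq[OF has_bochner_integral_mult_right[OF mom]] by auto
  have fsum: "(\<lambda>k. f k t) sums (of_real (power_kernel \<sigma> t) * exp (- (1 - z) * of_real t))" for t
  proof -
    have "(\<lambda>k. (z * of_real t) ^ k / fact k) sums exp (z * of_real t)"
      using exp_converges[of "z * of_real t"] by (simp add: scaleR_conv_of_real divide_inverse mult.commute)
    then have "(\<lambda>k. f k t) sums (complex_of_real (power_kernel \<sigma> t * exp (- t)) * exp (z * of_real t))"
      unfolding f_def by (rule sums_mult)
    also have "complex_of_real (power_kernel \<sigma> t * exp (- t)) * exp (z * of_real t)
       = of_real (power_kernel \<sigma> t) * exp (- (1 - z) * of_real t)"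
      by (simp add: algebra_simps exp_diff exp_minus flip: exp_of_real)
         (simp add: field_simps)
    finally show ?thesis .
  qed
  have nsum: "summable (\<lambda>k. norm (f k t))" for t
  proof -
    have "summable (\<lambda>k. power_kernel \<sigma> t * exp (- t) * (inverse (fact k) * (norm z * \<bar>t\<bar>) ^ k))"
      by (intro summable_mult summable_exp)
    also have "(\<lambda>k. power_kernel \<sigma> t * exp (- t) * (inverse (fact k) * (norm z * \<bar>t\<bar>) ^ k)) = (\<lambda>k. norm (f k t))"
      by (auto simp: norm_f fun_eq_iff power_kernel_def power_mult_distrib field_simps)
    finally show ?thesis .
  qed
  \<comment> \<open>The integrals of the norms form the same binomial series at the real point
    \<open>norm z < 1\<close>, so sum and integral may be exchanged.\<close>
  have isum: "summable (\<lambda>k. LINT t|lborel. norm (f k t))"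
  proof -
    have "summable (\<lambda>k. Gamma \<sigma> * (((- \<sigma>) gchoose k) * (- norm z) ^ k))"
      using gen_binomial_real[of "- norm z" "- \<sigma>"] assms by (intro summable_mult sums_summable) auto
    also have "(\<lambda>k. Gamma \<sigma> * (((- \<sigma>) gchoose k) * (- norm z) ^ k)) = (\<lambda>k. LINT t|lborel. norm (f k t))"
      unfolding norm_int
    proof
      fix k
      have "norm z ^ k / fact k * Gamma (\<sigma> + real k) = norm z ^ k * (Gamma (\<sigma> + real k) / fact k)" by simp
      also have "\<dots> = Gamma \<sigma> * (((- \<sigma>) gchoose k) * (- norm z) ^ k)"
        unfolding coeff by (simp add: power_minus[of "norm z"])
      finally show "Gamma \<sigma> * (((- \<sigma>) gchoose k) * (- norm z) ^ k) = norm z ^ k / fact k * Gamma (\<sigma> + real k)" ..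
    qed
    finally show ?thesis .
  qed
  have suminf: "(\<Sum>k. f k t) = of_real (power_kernel \<sigma> t) * exp (- (1 - z) * of_real t)" for t
    using fsum by (simp add: sums_iff)
  have int: "integrable lborel (f k)" for k
    using f_int by (auto simp: has_bochner_integral_iff)
  have "(\<lambda>k. integral\<^sup>L lborel (f k)) sums (LINT t|lborel. (\<Sum>k. f k t))"
    by (rule sums_integral) (use int nsum isum in auto)
  moreover have "(\<lambda>k. integral\<^sup>L lborel (f k)) sums (Gamma (of_real \<sigma>) * (1 - z) powr (- of_real \<sigma>))"
  proof -
    have "integral\<^sup>L lborel (f k) = Gamma (of_real \<sigma>) * (((- of_real \<sigma>) gchoose k) * (- z) ^ k)" for k
    proof -
      have "integral\<^sup>L lborel (f k) = z ^ k * of_real (Gamma (\<sigma> + real k) / fact k)"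
        using f_int[of k] by (simp add: has_bochner_integral_iff)
      also have "\<dots> = Gamma (of_real \<sigma>) * (((- of_real \<sigma>) gchoose k) * (- z) ^ k)"
        unfolding coeff
        using gbinomial_of_real[of "- \<sigma>" k]
        by (simp add: power_minus[of z] Gamma_complex_of_real mult_ac)
      finally show ?thesis .
    qed
    moreover have "(\<lambda>k. ((- of_real \<sigma>) gchoose k) * (- z) ^ k) sums (1 - z) powr (- of_real \<sigma>)"
      using gen_binomial_complex[of "- z" "- of_real \<sigma>"] assms by simp
    ultimately show ?thesis by (simp add: sums_mult)
  qed
  ultimately have "(LINT t|lborel. (\<Sum>k. f k t)) = Gamma (of_real \<sigma>) * (1 - z) powr (- of_real \<sigma>)"
    by (rule sums_unique2)
  moreover have "integrable lborel (\<lambda>t. \<Sum>k. f k t)"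
    by (rule integrable_suminf) (use int nsum isum in auto)
  ultimately show ?thesis
    unfolding suminf by (simp add: has_bochner_integral_iff)
qed

text \<open>Rescaling \<open>t\<close> by a large positive real \<open>l\<close> moves
  \<open>s\<close> to \<open>s / l\<close>, which lies in the unit disc about 1 where the series
  argument applies.\<close>

lemma power_kernel_laplace:
  assumes "\<sigma> > 0" "Re s > 0"
  shows "has_bochner_integral lborel (\<lambda>t. of_real (power_kernel \<sigma> t) * exp (- s * of_real t))
           (Gamma (of_real \<sigma>) * s powr (- of_real \<sigma>))"
proof -
  \<comment> \<open>For this value |l - s|^2 = l^2 - 2 l Re s + |s|^2 = l^2 - |s|^2, which is less
    than l^2.\<close>
  define l where "l = (norm s)\<^sup>2 / Re s"
  have "l > 0" using assms(2) unfolding l_def by (intro divide_pos_pos) auto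
  have "norm (of_real l - s) < l"
  proof (rule power2_less_imp_less)
    have "(norm (of_real l - s))\<^sup>2 = l\<^sup>2 - 2 * (l * Re s) + (norm s)\<^sup>2"
      unfolding cmod_power2 by (simp add: power2_diff algebra_simps)
    also have "l * Re s = (norm s)\<^sup>2" using assms(2) by (simp add: l_def)
    finally show "(norm (of_real l - s))\<^sup>2 < l\<^sup>2" using assms(2) by auto
  qed (use \<open>l > 0\<close> in auto)
  then have "norm (1 - s / l) < 1"
    using \<open>l > 0\<close> by (simp add: diff_divide_eq_iff norm_divide field_simps)
  from power_kernel_laplace_near_one[OF assms(1) this]
  have 1: "has_bochner_integral lborel (\<lambda>t. of_real (power_kernel \<sigma> t) * exp (- (s / l) * of_real t))
           (Gamma (of_real \<sigma>) * (s / l) powr (- of_real \<sigma>))" by simp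
  have scale: "power_kernel \<sigma> (l * t) = l powr (\<sigma> - 1) * power_kernel \<sigma> t" for t
    using \<open>l > 0\<close> by (auto simp: power_kernel_def powr_mult zero_less_mult_iff)
  have "has_bochner_integral lborel (\<lambda>t. of_real (power_kernel \<sigma> (0 + l * t)) * exp (- (s / l) * of_real (0 + l * t)))
           ((Gamma (of_real \<sigma>) * (s / l) powr (- of_real \<sigma>)) /\<^sub>R \<bar>l\<bar>)"
    using \<open>l > 0\<close> by (intro lborel_has_bochner_integral_real_affine_iff[THEN iffD1] 1) simp
  moreover have "of_real (power_kernel \<sigma> (0 + l * t)) * exp (- (s / l) * of_real (0 + l * t))
      = of_real (l powr (\<sigma> - 1)) * (of_real (power_kernel \<sigma> t) * exp (- s * of_real t))" for t
    using \<open>l > 0\<close> by (simp add: scale)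
  moreover have "(Gamma (of_real \<sigma>) * (s / l) powr (- of_real \<sigma>)) /\<^sub>R \<bar>l\<bar>
      = of_real (1 / l) * Gamma (of_real \<sigma>) * (s / l) powr (- of_real \<sigma>)"
    using \<open>l > 0\<close> by (simp add: scaleR_conv_of_real divide_inverse)
  ultimately have "has_bochner_integral lborel (\<lambda>t. of_real (l powr (\<sigma> - 1)) * (of_real (power_kernel \<sigma> t) * exp (- s * of_real t)))
           (of_real (1 / l) * Gamma (of_real \<sigma>) * (s / l) powr (- of_real \<sigma>))"
    by (simp only:)
  from has_bochner_integral_mult_right[OF this, of "of_real (l powr (1 - \<sigma>))"]
  have "has_bochner_integral lborel (\<lambda>t. of_real (power_kernel \<sigma> t) * exp (- s * of_real t))
     (of_real (l powr (1 - \<sigma>)) * (of_real (1 / l) * Gamma (of_real \<sigma>) * (s / l) powr (- of_real \<sigma>)))"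
    using \<open>l > 0\<close> by (simp flip: mult.assoc of_real_mult powr_add)
  moreover have "of_real (l powr (1 - \<sigma>)) * (of_real (1 / l) * Gamma (of_real \<sigma>) * (s / l) powr (- of_real \<sigma>))
      = Gamma (of_real \<sigma>) * s powr (- of_real \<sigma>)"
  proof -
    have "s / l = of_real (1 / l) * s" by simp
    \<comment> \<open>The complex power splits here because one factor is a positive real.\<close>
    also have "\<dots> powr (- of_real \<sigma>) = of_real (1 / l) powr (- of_real \<sigma>) * s powr (- of_real \<sigma>)"
      using \<open>l > 0\<close> by (intro powr_times_real_left) auto
    also have "complex_of_real (1 / l) powr (- of_real \<sigma>) = of_real ((1 / l) powr (- \<sigma>))"
      using \<open>l > 0\<close> by (subst powr_of_real[symmetric]) auto
    finally have "(s / l) powr (- of_real \<sigma>) = of_real (l powr \<sigma>) * s powr (- of_real \<sigma>)"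
      using \<open>l > 0\<close> by (simp add: powr_divide powr_minus field_simps)
    moreover have "l powr (1 - \<sigma>) * (1 / l) * l powr \<sigma> = 1"
      using \<open>l > 0\<close> by (simp add: powr_diff)
    then have "complex_of_real (l powr (1 - \<sigma>)) * of_real (1 / l) * of_real (l powr \<sigma>) = 1"
      by (metis of_real_1 of_real_mult)
    moreover have "A * (B * G * (L * S)) = A * B * L * (G * S)" for A B G L S :: complex
      by (simp add: mult_ac)
    ultimately show ?thesis by (simp only: mult_1)
  qed
  ultimately show ?thesis by simp
qed

subsection \<open>Fourier inversion\<close>

text \<open>Inversion is proved by Abel summation: the weight \<open>exp (- \<epsilon> \<bar>\<omega>\<bar>)\<close> produces the Poisson kernel, whose integral
  over an interval is a difference of arctangents.\<close>

lemma has_bochner_integral_exp_neg_halfline: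
  assumes "Re s > 0"
  shows "has_bochner_integral lborel (\<lambda>t. of_real (indicator {0<..} t) * exp (- s * of_real t)) (1 / s)"
proof -
  have "s \<noteq> 0" using assms by auto
  have "(complex_of_real (power_kernel 1 t)) = of_real (indicator {0<..} t)" for t
    by (auto simp: power_kernel_def)
  then show ?thesis
    using power_kernel_laplace[of 1 s] assms \<open>s \<noteq> 0\<close> by (simp add: powr_minus field_simps)
qed

text \<open>The line is cut at 0 into two decaying exponentials with rates
  \<open>\<epsilon> - \<i> * t\<close> and \<open>\<epsilon> + \<i> * t\<close>; the sum of their
  reciprocals is the stated value.\<close>

lemma poisson_kernel:
  assumes "\<epsilon> > 0"
  shows "has_bochner_integral lborel (\<lambda>\<omega>. of_real (exp (- \<epsilon> * \<bar>\<omega>\<bar>)) * cis (\<omega> * t)) (of_real (2 * \<epsilon> / (\<epsilon>\<^sup>2 + t\<^sup>2)))"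
proof -
  let ?h = "\<lambda>s t. complex_of_real (indicator {0<..} t) * exp (- s * of_real t)"
  have h: "has_bochner_integral lborel (?h s) (1 / s)" if "Re s > 0" for s
    by (rule has_bochner_integral_exp_neg_halfline[OF that])
  define a where "a = of_real \<epsilon> - \<i> * of_real t"
  define b where "b = of_real \<epsilon> + \<i> * of_real t"
  have ab: "Re a > 0" "Re b > 0" using assms by (auto simp: a_def b_def)
  then have nz: "a \<noteq> 0" "b \<noteq> 0" by auto
  have 1: "has_bochner_integral lborel (\<lambda>\<omega>. ?h a \<omega> + ?h b (0 + (-1) * \<omega>)) (1 / a + (1 / b) /\<^sub>R \<bar>-1\<bar>)"
    by (intro has_bochner_integral_add h ab lborel_has_bochner_integral_real_affine_iff[THEN iffD1]) simp
  have val: "1 / a + (1 / b) /\<^sub>R \<bar>-1\<bar> = of_real (2 * \<epsilon> / (\<epsilon>\<^sup>2 + t\<^sup>2))"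
  proof -
    have "1 / a + (1 / b) /\<^sub>R \<bar>-1\<bar> = (a + b) / (a * b)"
      using nz by (simp add: field_simps)
    also have "a + b = of_real (2 * \<epsilon>)" by (simp add: a_def b_def)
    also have "a * b = of_real (\<epsilon>\<^sup>2 + t\<^sup>2)"
      by (simp add: a_def b_def algebra_simps power2_eq_square)
    finally show ?thesis by simp
  qed
  have polar: "of_real (exp x) * cis y = exp (of_real x + \<i> * of_real y)" for x y
    by (simp add: exp_add exp_of_real cis_conv_exp)
  have eq: "?h a \<omega> + ?h b (0 + (-1) * \<omega>) = of_real (exp (- \<epsilon> * \<bar>\<omega>\<bar>)) * cis (\<omega> * t)" if "\<omega> \<noteq> 0" for \<omega>
  proof (cases "\<omega> > 0")
    case True
    have "- a * of_real \<omega> = of_real (- \<epsilon> * \<omega>) + \<i> * of_real (\<omega> * t)"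
      by (simp add: a_def algebra_simps)
    then show ?thesis using True unfolding polar by simp
  next
    case False
    have "- b * of_real (- \<omega>) = of_real (- \<epsilon> * - \<omega>) + \<i> * of_real (\<omega> * t)"
      by (simp add: b_def algebra_simps)
    then show ?thesis using False that unfolding polar by (simp add: add.commute)
  qed
  \<comment> \<open>Both half lines are open, so the point 0 is missed and equality holds only
    almost everywhere.\<close>
  have AE: "AE \<omega> in lborel. ?h a \<omega> + ?h b (0 + (-1) * \<omega>) = of_real (exp (- \<epsilon> * \<bar>\<omega>\<bar>)) * cis (\<omega> * t)"
    using AE_lborel_singleton[of 0] by eventually_elim (use eq in auto)
  show ?thesis
    by (rule has_bochner_integral_cong_AE[THEN iffD1, OF _ _ AE 1[unfolded val]]) auto
qed

section \<open>Abel means of the inverse transform\<close>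

lemma integrable_pair_mult:
  fixes f g :: "real \<Rightarrow> complex"
  assumes f: "integrable lborel f" and g: "integrable lborel g"
  shows "integrable (lborel \<Otimes>\<^sub>M lborel) (\<lambda>(x, y). f x * g y)"
proof (rule lborel_pair.Fubini_integrable)
  have [measurable]: "f \<in> borel_measurable borel" "g \<in> borel_measurable borel"
    using f g by auto
  show "(\<lambda>(x, y). f x * g y) \<in> borel_measurable (lborel \<Otimes>\<^sub>M lborel)"
    by measurable
  show "integrable lborel (\<lambda>x. LINT y|lborel. norm (case (x, y) of (x, y) \<Rightarrow> f x * g y))"
    using f by (simp add: norm_mult)
  show "AE x in lborel. integrable lborel (\<lambda>y. case (x, y) of (x, y) \<Rightarrow> f x * g y)"
    using g by simp
qed

lemma continuous_on_ft:
  assumes "integrable lborel f"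
  shows "continuous_on UNIV (ft f)"
  unfolding continuous_on_sequentially
proof (intro allI ballI impI)
  fix X :: "nat \<Rightarrow> real" and a assume "(\<forall>n. X n \<in> UNIV) \<and> X \<longlonglongrightarrow> a"
  then have X: "X \<longlonglongrightarrow> a" by simp
  have [measurable]: "f \<in> borel_measurable borel" using assms by auto
  show "(ft f \<circ> X) \<longlonglongrightarrow> ft f a"
    unfolding ft_def o_def
  proof (rule integral_dominated_convergence[where w = "\<lambda>x. norm (f x)"])
    show "AE x in lborel. (\<lambda>i. cis (- (X i * x)) * f x) \<longlonglongrightarrow> cis (- (a * x)) * f x"
      unfolding cis_conv_exp by (auto intro!: tendsto_intros X)
  qed (use assms in \<open>auto simp: norm_mult\<close>)
qed

lemma ft_measurable: "integrable lborel f \<Longrightarrow> ft f \<in> borel_measurable borel"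
  by (intro borel_measurable_continuous_onI continuous_on_ft)

text \<open>The damping factor makes the double integrand absolutely integrable, so Fubini applies
  without integrability of \<open>ft f\<close>; the inner integral is the Poisson kernel.\<close>

lemma abel_mean_ft:
  assumes f: "integrable lborel f" and "\<epsilon> > 0"
  shows "(LINT \<omega>|lborel. of_real (exp (- \<epsilon> * \<bar>\<omega>\<bar>)) * cis (\<omega> * x) * ft f \<omega>)
       = (LINT y|lborel. f y * of_real (2 * \<epsilon> / (\<epsilon>\<^sup>2 + (x - y)\<^sup>2)))"
proof -
  have [measurable]: "f \<in> borel_measurable borel" using f by auto
  let ?E = "\<lambda>\<omega>. complex_of_real (exp (- \<epsilon> * \<bar>\<omega>\<bar>))"
  have E: "integrable lborel ?E"
    using poisson_kernel[OF \<open>\<epsilon> > 0\<close>, of 0] by (simp add: has_bochner_integral_iff)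
  have int: "integrable (lborel \<Otimes>\<^sub>M lborel) (\<lambda>(\<omega>, y). ?E \<omega> * cis (\<omega> * (x - y)) * f y)"
    by (rule Bochner_Integration.integrable_bound[OF integrable_pair_mult[OF E f]]) (auto simp: norm_mult)
  have cis_eq: "cis (\<omega> * x) * cis (- (\<omega> * y)) = cis (\<omega> * (x - y))" for \<omega> y
    by (simp add: cis_mult algebra_simps)
  have "(LINT \<omega>|lborel. ?E \<omega> * cis (\<omega> * x) * ft f \<omega>)
      = (LINT \<omega>|lborel. LINT y|lborel. ?E \<omega> * cis (\<omega> * x) * (cis (- (\<omega> * y)) * f y))"
    unfolding ft_def by (simp only: Bochner_Integration.integral_mult_right_zero)
  also have "\<dots> = (LINT \<omega>|lborel. LINT y|lborel. ?E \<omega> * cis (\<omega> * (x - y)) * f y)"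
    by (simp only: cis_eq[symmetric] mult.assoc)
  also have "\<dots> = (LINT y|lborel. LINT \<omega>|lborel. ?E \<omega> * cis (\<omega> * (x - y)) * f y)"
    by (rule lborel_pair.Fubini_integral[OF int, symmetric])
  also have "\<dots> = (LINT y|lborel. f y * of_real (2 * \<epsilon> / (\<epsilon>\<^sup>2 + (x - y)\<^sup>2)))"
    unfolding Bochner_Integration.integral_mult_left_zero
      has_bochner_integral_integral_eq[OF poisson_kernel[OF \<open>\<epsilon> > 0\<close>]]
    by (simp only: mult.commute)
  finally show ?thesis .
qed

lemma integral_poisson_kernel_interval:
  assumes "\<epsilon> > 0" "a \<le> b"
  shows "(LINT x|lborel. indicator {a..b} x * (2 * \<epsilon> / (\<epsilon>\<^sup>2 + (x - y)\<^sup>2)))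
       = 2 * (arctan ((b - y) / \<epsilon>) - arctan ((a - y) / \<epsilon>))"
proof -
  have nz: "\<epsilon>\<^sup>2 + (x - y)\<^sup>2 \<noteq> 0" for x
    using assms(1) by (simp add: sum_power2_eq_zero_iff)
  have "((\<lambda>x. 2 * \<epsilon> / (\<epsilon>\<^sup>2 + (x - y)\<^sup>2)) has_integral 2 * arctan ((b - y) / \<epsilon>) - 2 * arctan ((a - y) / \<epsilon>)) {a..b}"
  proof (rule fundamental_theorem_of_calculus[OF \<open>a \<le> b\<close>])
    fix x
    have "((\<lambda>x. 2 * arctan ((x - y) / \<epsilon>)) has_real_derivative 2 * (inverse (1 + ((x - y) / \<epsilon>)\<^sup>2) * (1 / \<epsilon>))) (at x within {a..b})"
      by (auto intro!: derivative_eq_intros simp: divide_inverse)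
    also have "2 * (inverse (1 + ((x - y) / \<epsilon>)\<^sup>2) * (1 / \<epsilon>)) = 2 * \<epsilon> / (\<epsilon>\<^sup>2 + (x - y)\<^sup>2)"
      using nz[of x] assms by (simp add: divide_simps power2_eq_square)
    finally show "((\<lambda>x. 2 * arctan ((x - y) / \<epsilon>)) has_vector_derivative 2 * \<epsilon> / (\<epsilon>\<^sup>2 + (x - y)\<^sup>2)) (at x within {a..b})"
      by (simp add: has_real_derivative_iff_has_vector_derivative)
  qed
  moreover have "set_integrable lborel {a..b} (\<lambda>x. 2 * \<epsilon> / (\<epsilon>\<^sup>2 + (x - y)\<^sup>2))"
    using assms(1) by (intro borel_integrable_atLeastAtMost') (auto intro!: continuous_intros simp: nz)
  from set_borel_integral_eq_integral(2)[OF this]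
  have "(LINT x|lborel. indicator {a..b} x * (2 * \<epsilon> / (\<epsilon>\<^sup>2 + (x - y)\<^sup>2))) = integral {a..b} (\<lambda>x. 2 * \<epsilon> / (\<epsilon>\<^sup>2 + (x - y)\<^sup>2))"
    by (simp add: set_lebesgue_integral_def)
  ultimately show ?thesis
    by (simp add: integral_unique)
qed

lemma interval_integral_abel_mean:
  assumes f: "integrable lborel f" and "\<epsilon> > 0" "a \<le> b"
  shows "(LINT x|lborel. of_real (indicator {a..b} x) * (LINT \<omega>|lborel. of_real (exp (- \<epsilon> * \<bar>\<omega>\<bar>)) * cis (\<omega> * x) * ft f \<omega>))
       = (LINT y|lborel. f y * of_real (2 * (arctan ((b - y) / \<epsilon>) - arctan ((a - y) / \<epsilon>))))"
proof -
  have [measurable]: "f \<in> borel_measurable borel" using f by auto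
  let ?I = "\<lambda>x. complex_of_real (indicator {a..b} x)"
  let ?P = "\<lambda>x y. 2 * \<epsilon> / (\<epsilon>\<^sup>2 + (x - y)\<^sup>2)"
  have I: "integrable lborel ?I"
    by (intro integrable_of_real) (simp add: emeasure_lborel_Icc_eq)
  \<comment> \<open>For fixed \<epsilon> the Poisson kernel is bounded, which suffices for Fubini
    with an integrable \<open>f\<close> and a bounded interval.\<close>
  have bound: "\<bar>?P x y\<bar> \<le> 2 / \<epsilon>" for x y
    using \<open>\<epsilon> > 0\<close> by (simp add: divide_simps power2_eq_square abs_mult add_pos_nonneg)
  have int: "integrable (lborel \<Otimes>\<^sub>M lborel) (\<lambda>(x, y). ?I x * (f y * of_real (?P x y)))"
  proof (rule Bochner_Integration.integrable_bound)
    show "integrable (lborel \<Otimes>\<^sub>M lborel) (\<lambda>z. of_real (2 / \<epsilon>) * (case z of (x, y) \<Rightarrow> ?I x * f y))"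
      by (intro integrable_mult_right integrable_pair_mult I f)
    show "AE z in lborel \<Otimes>\<^sub>M lborel. norm (case z of (x, y) \<Rightarrow> ?I x * (f y * of_real (?P x y)))
        \<le> norm (of_real (2 / \<epsilon>) * (case z of (x, y) \<Rightarrow> ?I x * f y))"
    proof (intro AE_I2, clarify)
      fix x y
      have "norm (?I x * (f y * of_real (?P x y))) = norm (?I x * f y) * \<bar>?P x y\<bar>"
        by (simp only: norm_mult norm_of_real mult.assoc)
      also have "\<dots> \<le> norm (?I x * f y) * (2 / \<epsilon>)"
        by (intro mult_left_mono bound) auto
      also have "\<dots> = norm (of_real (2 / \<epsilon>) * (?I x * f y))"
        using \<open>\<epsilon> > 0\<close> by (simp only: norm_mult norm_of_real) simp
      finally show "norm (?I x * (f y * of_real (?P x y))) \<le> norm (of_real (2 / \<epsilon>) * (?I x * f y))" .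
    qed
  qed measurable
  have "(LINT x|lborel. ?I x * (LINT \<omega>|lborel. of_real (exp (- \<epsilon> * \<bar>\<omega>\<bar>)) * cis (\<omega> * x) * ft f \<omega>))
      = (LINT x|lborel. LINT y|lborel. ?I x * (f y * of_real (?P x y)))"
    unfolding abel_mean_ft[OF f \<open>\<epsilon> > 0\<close>] by (simp only: Bochner_Integration.integral_mult_right_zero)
  also have "\<dots> = (LINT y|lborel. LINT x|lborel. ?I x * (f y * of_real (?P x y)))"
    by (rule lborel_pair.Fubini_integral[OF int, symmetric])
  also have "\<dots> = (LINT y|lborel. f y * (LINT x|lborel. of_real (indicator {a..b} x * ?P x y)))"
    by (simp only: Bochner_Integration.integral_mult_right_zero[symmetric] of_real_mult mult.left_commute)
  also have "\<dots> = (LINT y|lborel. f y * of_real (2 * (arctan ((b - y) / \<epsilon>) - arctan ((a - y) / \<epsilon>))))"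
    by (simp only: integral_complex_of_real integral_poisson_kernel_interval[OF assms(2-3)])
  finally show ?thesis .
qed

lemma tendsto_arctan_scaled:
  fixes e :: "nat \<Rightarrow> real"
  assumes "filterlim e (at_right 0) sequentially"
  shows "(\<lambda>n. arctan (t / e n)) \<longlonglongrightarrow> pi / 2 * sgn t"
proof -
  have inv: "filterlim (\<lambda>n. inverse (e n)) at_top sequentially"
    using filterlim_compose[OF filterlim_inverse_at_top_right assms] .
  consider "t > 0" | "t < 0" | "t = 0" by linarith
  then show ?thesis
  proof cases
    case 1
    then have "filterlim (\<lambda>n. t * inverse (e n)) at_top sequentially"
      by (intro filterlim_tendsto_pos_mult_at_top[OF tendsto_const _ inv])
    from filterlim_compose[OF tendsto_arctan_at_top this] show ?thesis
      using 1 unfolding divide_inverse[of t] by simp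
  next
    case 2
    then have "filterlim (\<lambda>n. t * inverse (e n)) at_bot sequentially"
      by (intro filterlim_tendsto_neg_mult_at_bot[OF tendsto_const _ inv])
    from filterlim_compose[OF tendsto_arctan_at_bot this] show ?thesis
      using 2 unfolding divide_inverse[of t] by simp
  qed simp
qed

text \<open>The limit of the Abel means over \<open>{a..b}\<close> is computed twice: on the
  frequency side by domination with \<open>norm (ft f)\<close>, and on the space side through
  arctangents that tend to a multiple of the indicator of the interval.\<close>

lemma interval_integral_inverse_ft:
  assumes f: "integrable lborel f" and F: "integrable lborel (ft f)" and "a < b"
  shows "(LINT x|lborel. of_real (indicator {a..b} x) * (LINT \<omega>|lborel. cis (\<omega> * x) * ft f \<omega>))
       = of_real (2 * pi) * (LINT y|lborel. of_real (indicator {a..b} y) * f y)"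
proof -
  have [measurable]: "f \<in> borel_measurable borel" "ft f \<in> borel_measurable borel" using f F by auto
  define e where "e n = 1 / (real n + 1)" for n
  have e: "e n > 0" for n by (simp add: e_def)
  have e0: "e \<longlonglongrightarrow> 0" unfolding e_def[abs_def] by real_asymp
  have e_right: "filterlim e (at_right 0) sequentially"
    unfolding e_def[abs_def] by real_asymp
  let ?I = "\<lambda>x. complex_of_real (indicator {a..b} x)"
  let ?A = "\<lambda>n x. LINT \<omega>|lborel. of_real (exp (- e n * \<bar>\<omega>\<bar>)) * cis (\<omega> * x) * ft f \<omega>"
  have I: "integrable lborel ?I"
    by (intro integrable_of_real) (simp add: emeasure_lborel_Icc_eq)
  have damp: "norm (of_real (exp (- e n * \<bar>\<omega>\<bar>)) * cis (\<omega> * x) * ft f \<omega>) \<le> norm (ft f \<omega>)" for n x \<omega>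
  proof -
    have "exp (- e n * \<bar>\<omega>\<bar>) \<le> 1" using e[of n] by simp
    then show ?thesis by (simp add: norm_mult mult_left_le_one_le)
  qed
  have bound_aux: "\<bar>2 * (s - t)\<bar> \<le> 2 * pi" if "- (pi / 2) < s \<and> s < pi / 2" "- (pi / 2) < t \<and> t < pi / 2" for s t :: real
    using that by (simp add: abs_le_iff field_simps)
  define M where "M = (LINT \<omega>|lborel. norm (ft f \<omega>))"
  have "(\<lambda>n. LINT x|lborel. ?I x * ?A n x) \<longlonglongrightarrow> (LINT x|lborel. ?I x * (LINT \<omega>|lborel. cis (\<omega> * x) * ft f \<omega>))"
  proof (rule integral_dominated_convergence[where w = "\<lambda>x. norm (?I x) * M"])
    show "integrable lborel (\<lambda>x. norm (?I x) * M)" by (intro integrable_mult_left integrable_norm I)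
    have "(\<lambda>n. ?A n x) \<longlonglongrightarrow> (LINT \<omega>|lborel. cis (\<omega> * x) * ft f \<omega>)" for x
    proof (rule integral_dominated_convergence[where w = "\<lambda>\<omega>. norm (ft f \<omega>)"])
      show "AE \<omega> in lborel. (\<lambda>n. complex_of_real (exp (- e n * \<bar>\<omega>\<bar>)) * cis (\<omega> * x) * ft f \<omega>) \<longlonglongrightarrow> cis (\<omega> * x) * ft f \<omega>"
      proof (intro AE_I2)
        fix \<omega>
        have "(\<lambda>n. complex_of_real (exp (- e n * \<bar>\<omega>\<bar>)) * cis (\<omega> * x) * ft f \<omega>) \<longlonglongrightarrow> complex_of_real (exp (- 0 * \<bar>\<omega>\<bar>)) * cis (\<omega> * x) * ft f \<omega>"
          by (intro tendsto_intros e0)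
        then show "(\<lambda>n. complex_of_real (exp (- e n * \<bar>\<omega>\<bar>)) * cis (\<omega> * x) * ft f \<omega>) \<longlonglongrightarrow> cis (\<omega> * x) * ft f \<omega>" by simp
      qed
      show "AE \<omega> in lborel. norm (complex_of_real (exp (- e n * \<bar>\<omega>\<bar>)) * cis (\<omega> * x) * ft f \<omega>) \<le> norm (ft f \<omega>)" for n
        using damp by (intro AE_I2)
    qed (use F in simp_all)
    then show "AE x in lborel. (\<lambda>n. ?I x * ?A n x) \<longlonglongrightarrow> ?I x * (LINT \<omega>|lborel. cis (\<omega> * x) * ft f \<omega>)"
      by (intro AE_I2 tendsto_mult tendsto_const)
    have bd: "norm (?A n x) \<le> M" for n x
      unfolding M_def
      by (rule order_trans[OF integral_norm_bound], rule integral_mono'[OF integrable_norm[OF F]])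
        (rule damp, rule norm_ge_zero)
    show "AE x in lborel. norm (?I x * ?A n x) \<le> norm (?I x) * M" for n
      unfolding norm_mult[of "?I _"] by (intro AE_I2 mult_left_mono bd norm_ge_zero)
  qed measurable
  moreover have "(\<lambda>n. LINT x|lborel. ?I x * ?A n x) \<longlonglongrightarrow> (LINT y|lborel. of_real (2 * pi) * (?I y * f y))"
    unfolding interval_integral_abel_mean[OF f e less_imp_le[OF \<open>a < b\<close>]]
  proof (rule integral_dominated_convergence[where w = "\<lambda>y. 2 * pi * norm (f y)"])
    \<comment> \<open>The difference of the two signs is 2 inside the interval and 0 outside; the
      endpoints, where it is 1, form a null set.\<close>
    show "AE y in lborel. (\<lambda>n. f y * of_real (2 * (arctan ((b - y) / e n) - arctan ((a - y) / e n)))) \<longlonglongrightarrow> of_real (2 * pi) * (?I y * f y)"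
      using AE_lborel_singleton[of a] AE_lborel_singleton[of b]
    proof eventually_elim
      case (elim y)
      have "(\<lambda>n. f y * of_real (2 * (arctan ((b - y) / e n) - arctan ((a - y) / e n))))
         \<longlonglongrightarrow> f y * of_real (2 * (pi / 2 * sgn (b - y) - pi / 2 * sgn (a - y)))"
        by (intro tendsto_intros tendsto_arctan_scaled e_right)
      also have "f y * of_real (2 * (pi / 2 * sgn (b - y) - pi / 2 * sgn (a - y))) = of_real (2 * pi) * (?I y * f y)"
        using elim \<open>a < b\<close> by (auto simp: sgn_if indicator_def)
      finally show ?case .
    qed
    show "AE y in lborel. norm (f y * of_real (2 * (arctan ((b - y) / e n) - arctan ((a - y) / e n)))) \<le> 2 * pi * norm (f y)" for n
    proof (intro AE_I2)
      fix y
      have "\<bar>2 * (arctan ((b - y) / e n) - arctan ((a - y) / e n))\<bar> \<le> 2 * pi"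
        by (rule bound_aux; rule arctan_bounded)
      from mult_left_mono[OF this norm_ge_zero[of "f y"]]
      show "norm (f y * of_real (2 * (arctan ((b - y) / e n) - arctan ((a - y) / e n)))) \<le> 2 * pi * norm (f y)"
        unfolding norm_mult norm_of_real mult.commute[of "2 * pi"] .
    qed
  qed (use f in simp_all)
  ultimately have "(LINT x|lborel. ?I x * (LINT \<omega>|lborel. cis (\<omega> * x) * ft f \<omega>)) = (LINT y|lborel. of_real (2 * pi) * (?I y * f y))"
    by (rule LIMSEQ_unique)
  then show ?thesis
    unfolding Bochner_Integration.integral_mult_right_zero .
qed

text \<open>Lebesgue differentiation: off a null set \<open>w x\<close> is the limit of the averages
  of \<open>w\<close> over \<open>{x..x + h}\<close>, all of which are zero.\<close>

lemma AE_zero_if_interval_integrals_zero: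
  fixes w :: "real \<Rightarrow> complex"
  assumes int: "\<And>a b. w integrable_on {a..b}" and zero: "\<And>a b. a < b \<Longrightarrow> integral {a..b} w = 0"
  shows "AE x in lebesgue. w x = 0"
proof -
  have "w integrable_on cbox a b" for a b using int by (simp add: cbox_interval)
  then obtain N where N: "negligible N" and
    dens: "\<And>x e. x \<notin> N \<Longrightarrow> 0 < e \<Longrightarrow> \<exists>d>0. \<forall>h. 0 < h \<and> h < d \<longrightarrow> norm (integral (cbox x (x + h *\<^sub>R One)) w /\<^sub>R h ^ DIM(real) - w x) < e"
    by (rule integrable_ccontinuous_explicit) blast
  have "w x = 0" if xN: "x \<notin> N" for x
  proof (rule ccontr)
    assume "w x \<noteq> 0"
    then obtain d where "d > 0" and d: "\<And>h. 0 < h \<Longrightarrow> h < d \<Longrightarrow> norm (integral (cbox x (x + h *\<^sub>R One)) w /\<^sub>R h ^ DIM(real) - w x) < norm (w x)"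
      using dens[OF xN, of "norm (w x)"] by auto
    have "integral {x..x + d / 2} w = 0" using \<open>d > 0\<close> by (intro zero) auto
    with d[of "d / 2"] \<open>d > 0\<close> show False by simp
  qed
  then have "{x. w x \<noteq> 0} \<subseteq> N" by auto
  then show ?thesis
    using N by (intro AE_I'[of N]) (auto simp: negligible_iff_null_sets)
qed

text \<open>By the preceding results, \<open>2 * pi * f\<close> and the continuous inverse transform
  have equal integrals over every interval, hence agree almost everywhere.\<close>

theorem ft_inversion:
  assumes f: "integrable lborel f" and F: "integrable lborel (ft f)"
  shows "AE x in lborel. f x = (LINT \<omega>|lborel. cis (\<omega> * x) * ft f \<omega>) / of_real (2 * pi)"
proof -
  define v where "v x = (LINT \<omega>|lborel. cis (\<omega> * x) * ft f \<omega>)" for x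
  define w where "w x = of_real (2 * pi) * f x - v x" for x
  have "v = (\<lambda>x. ft (ft f) (- x))"
    by (simp add: fun_eq_iff v_def ft_def mult.commute)
  then have cont: "continuous_on S v" for S
    by (auto intro!: continuous_on_compose2[OF continuous_on_ft[OF F]] continuous_intros)
  have fi: "set_integrable lborel {a..b} f" for a b
    unfolding set_integrable_def by (intro integrable_mult_indicator f) simp
  have vi: "set_integrable lborel {a..b} v" for a b
    by (intro borel_integrable_atLeastAtMost' cont)
  have wi: "set_integrable lborel {a..b} w" for a b
    unfolding w_def by (intro set_integral_diff set_integrable_mult_right fi vi)
  have "integral {a..b} w = 0" if "a < b" for a b
  proof -
    have "integral {a..b} w = (LINT x:{a..b}|lborel. w x)"
      using set_borel_integral_eq_integral(2)[OF wi] by simp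
    also have "\<dots> = of_real (2 * pi) * (LINT x:{a..b}|lborel. f x) - (LINT x:{a..b}|lborel. v x)"
      unfolding w_def by (subst set_integral_diff(2)) (auto intro!: fi vi)
    also have "\<dots> = 0"
      using interval_integral_inverse_ft[OF f F that]
      by (simp only: set_lebesgue_integral_def v_def scaleR_conv_of_real diff_self)
    finally show ?thesis .
  qed
  from AE_zero_if_interval_integrals_zero[OF set_borel_integral_eq_integral(1)[OF wi] this]
  have "AE x in lborel. w x = 0" by (simp add: AE_completion_iff)
  then show ?thesis
    by eventually_elim (simp add: w_def eq_divide_eq mult.commute[of "f _"] flip: v_def)
qed

subsection \<open>Differentiation of inverse transforms\<close>

text \<open>The factor \<open>1 / (2 * pi)\<close> is omitted; the final proof absorbs it into the
  function being transformed.\<close>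

definition ift :: "(real \<Rightarrow> complex) \<Rightarrow> real \<Rightarrow> complex" where
  "ift \<phi> x = (LINT \<omega>|lborel. cis (\<omega> * x) * \<phi> \<omega>)"

lemma ift_eq_ft: "ift \<phi> x = ft \<phi> (- x)"
  by (simp add: ift_def ft_def mult.commute)

lemma continuous_on_ift: "integrable lborel \<phi> \<Longrightarrow> continuous_on UNIV (ift \<phi>)"
  unfolding ift_eq_ft[abs_def]
  by (rule continuous_on_compose2[OF continuous_on_ft]) (auto intro!: continuous_intros)

text \<open>Turns the derivative into a limit of quotients, which can be taken along sequences and
  thus treated by dominated convergence.\<close>

lemma has_vector_derivative_iff_quotient:
  fixes f :: "real \<Rightarrow> complex"
  shows "(f has_vector_derivative D) (at x) \<longleftrightarrow> ((\<lambda>y. (f y - f x) /\<^sub>R (y - x)) \<longlongrightarrow> D) (at x)"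
proof -
  have "\<forall>\<^sub>F y in at x. norm (f y - f x - (y - x) *\<^sub>R D) / norm (y - x)
      = norm ((f y - f x) /\<^sub>R (y - x) - D)"
    unfolding eventually_at_filter
  proof (intro always_eventually allI impI)
    fix y assume "y \<noteq> x"
    then have "f y - f x - (y - x) *\<^sub>R D = (y - x) *\<^sub>R ((f y - f x) /\<^sub>R (y - x) - D)"
      by (simp add: scaleR_diff_right)
    then show "norm (f y - f x - (y - x) *\<^sub>R D) / norm (y - x) = norm ((f y - f x) /\<^sub>R (y - x) - D)"
      using \<open>y \<noteq> x\<close> by (simp only: norm_scaleR) simp
  qed
  then have "(f has_vector_derivative D) (at x)
      \<longleftrightarrow> ((\<lambda>y. norm ((f y - f x) /\<^sub>R (y - x) - D)) \<longlongrightarrow> 0) (at x)"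
    unfolding has_vector_derivative_def has_derivative_iff_norm
    by (simp only: tendsto_cong bounded_linear_scaleR_left simp_thms)
  then show ?thesis
    unfolding tendsto_norm_zero_iff LIM_zero_iff .
qed

lemma norm_cis_diff_le: "norm (cis a - cis b) \<le> \<bar>a - b\<bar>"
proof -
  have "cis a - cis b = cis a * (1 - cis (- (a - b)))"
    by (simp add: right_diff_distrib cis_mult)
  also have "norm \<dots> = norm (cis (- (a - b)) - 1)"
    by (simp add: norm_mult norm_minus_commute)
  also have "\<dots> \<le> \<bar>- (a - b)\<bar>"
    using iexp_approx1[of "- (a - b)" 0] by (simp only: cis_conv_exp) simp
  finally show ?thesis by simp
qed

text \<open>Differentiation under the integral: since \<open>cis\<close> is 1-Lipschitz, the
  difference quotients of the integrand are dominated by |\<omega>| times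
  \<open>norm (\<phi> \<omega>)\<close>.\<close>

lemma ift_has_vector_derivative:
  assumes \<phi>: "integrable lborel \<phi>" and \<phi>': "integrable lborel (\<lambda>\<omega>. \<i> * of_real \<omega> * \<phi> \<omega>)"
  shows "(ift \<phi> has_vector_derivative ift (\<lambda>\<omega>. \<i> * of_real \<omega> * \<phi> \<omega>) x) (at x)"
unfolding has_vector_derivative_iff_quotient tendsto_at_iff_sequentially
proof (intro allI impI)
  fix X :: "nat \<Rightarrow> real"
  assume "\<forall>i. X i \<in> UNIV - {x}" and X: "X \<longlonglongrightarrow> x"
  then have Xne: "X i \<noteq> x" for i by auto
  have [measurable]: "\<phi> \<in> borel_measurable borel" using \<phi> by auto
  have quot: "(ift \<phi> (X n) - ift \<phi> x) /\<^sub>R (X n - x)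
     = (LINT \<omega>|lborel. (cis (\<omega> * X n) - cis (\<omega> * x)) /\<^sub>R (X n - x) * \<phi> \<omega>)" for n
  proof -
    have "ift \<phi> (X n) - ift \<phi> x = (LINT \<omega>|lborel. cis (\<omega> * X n) * \<phi> \<omega> - cis (\<omega> * x) * \<phi> \<omega>)"
      unfolding ift_def
      by (rule Bochner_Integration.integral_diff[symmetric]) (auto intro!: integrable_cis_mult \<phi>)
    then have "(ift \<phi> (X n) - ift \<phi> x) /\<^sub>R (X n - x)
      = (LINT \<omega>|lborel. (cis (\<omega> * X n) * \<phi> \<omega> - cis (\<omega> * x) * \<phi> \<omega>) /\<^sub>R (X n - x))"
      by simp
    then show ?thesis by (simp add: left_diff_distrib)
  qed
  show "((\<lambda>y. (ift \<phi> y - ift \<phi> x) /\<^sub>R (y - x)) \<circ> X) \<longlonglongrightarrow> ift (\<lambda>\<omega>. \<i> * of_real \<omega> * \<phi> \<omega>) x"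
    unfolding o_def quot unfolding ift_def
  proof (rule integral_dominated_convergence[where w = "\<lambda>\<omega>. norm (\<i> * of_real \<omega> * \<phi> \<omega>)"])
    show "AE \<omega> in lborel. (\<lambda>n. (cis (\<omega> * X n) - cis (\<omega> * x)) /\<^sub>R (X n - x) * \<phi> \<omega>)
        \<longlonglongrightarrow> cis (\<omega> * x) * (\<i> * of_real \<omega> * \<phi> \<omega>)"
    proof (intro AE_I2)
      fix \<omega>
      have "((\<lambda>z. exp (\<i> * of_real \<omega> * z)) has_field_derivative exp (\<i> * of_real \<omega> * of_real x) * (\<i> * of_real \<omega>)) (at (of_real x))"
        by (auto intro!: derivative_eq_intros)
      then have "((\<lambda>y. (exp (\<i> * of_real \<omega> * y) - exp (\<i> * of_real \<omega> * of_real x)) / (y - of_real x))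
          \<longlongrightarrow> exp (\<i> * of_real \<omega> * of_real x) * (\<i> * of_real \<omega>)) (at (of_real x))"
        unfolding has_field_derivative_iff .
      then have "((\<lambda>y. (exp (\<i> * of_real \<omega> * y) - exp (\<i> * of_real \<omega> * of_real x)) / (y - of_real x)) \<circ> (\<lambda>n. of_real (X n)))
          \<longlonglongrightarrow> exp (\<i> * of_real \<omega> * of_real x) * (\<i> * of_real \<omega>)"
        unfolding tendsto_at_iff_sequentially using Xne X by (simp add: tendsto_of_real_iff)
      then have "(\<lambda>n. (cis (\<omega> * X n) - cis (\<omega> * x)) /\<^sub>R (X n - x)) \<longlonglongrightarrow> cis (\<omega> * x) * (\<i> * of_real \<omega>)"
        by (simp add: o_def cis_conv_exp scaleR_conv_of_real divide_inverse mult_ac)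
      from tendsto_mult_right[OF this, of "\<phi> \<omega>"]
      show "(\<lambda>n. (cis (\<omega> * X n) - cis (\<omega> * x)) /\<^sub>R (X n - x) * \<phi> \<omega>) \<longlonglongrightarrow> cis (\<omega> * x) * (\<i> * of_real \<omega> * \<phi> \<omega>)"
        by (simp add: mult.assoc)
    qed
    show "AE \<omega> in lborel. norm ((cis (\<omega> * X n) - cis (\<omega> * x)) /\<^sub>R (X n - x) * \<phi> \<omega>) \<le> norm (\<i> * of_real \<omega> * \<phi> \<omega>)" for n
    proof (intro AE_I2)
      fix \<omega>
      have "norm (cis (\<omega> * X n) - cis (\<omega> * x)) \<le> \<bar>\<omega>\<bar> * \<bar>X n - x\<bar>"
        using norm_cis_diff_le[of "\<omega> * X n" "\<omega> * x"] by (simp add: right_diff_distrib[symmetric] abs_mult)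
      then have "norm ((cis (\<omega> * X n) - cis (\<omega> * x)) /\<^sub>R (X n - x)) \<le> \<bar>\<omega>\<bar>"
        using Xne[of n] unfolding norm_scaleR by (simp add: inverse_eq_divide divide_le_eq)
      then show "norm ((cis (\<omega> * X n) - cis (\<omega> * x)) /\<^sub>R (X n - x) * \<phi> \<omega>) \<le> norm (\<i> * of_real \<omega> * \<phi> \<omega>)"
        unfolding norm_mult[of _ "\<phi> \<omega>"] by (intro mult_right_mono) (auto simp: norm_mult)
    qed
  qed (use \<phi>' in simp_all)
qed

lemma nth_deriv_ift:
  assumes "\<And>j. j \<le> n \<Longrightarrow> integrable lborel (\<lambda>\<omega>. (\<i> * of_real \<omega>) ^ j * \<phi> \<omega>)"
  shows "n_times_differentiable n (ift \<phi>) \<and> nth_deriv n (ift \<phi>) = ift (\<lambda>\<omega>. (\<i> * of_real \<omega>) ^ n * \<phi> \<omega>)"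
  using assms
proof (induction n arbitrary: \<phi>)
  case 0
  then show ?case by (simp add: n_times_differentiable_def nth_deriv_def)
next
  case (Suc n)
  define \<psi> where "\<psi> = (\<lambda>\<omega>. \<i> * of_real \<omega> * \<phi> \<omega>)"
  have power: "(\<lambda>\<omega>. (\<i> * of_real \<omega>) ^ j * \<psi> \<omega>) = (\<lambda>\<omega>. (\<i> * of_real \<omega>) ^ Suc j * \<phi> \<omega>)" for j
    by (simp add: \<psi>_def fun_eq_iff mult_ac)
  have "integrable lborel \<phi>" "integrable lborel \<psi>"
    using Suc.prems[of 0] Suc.prems[of 1] by (auto simp: \<psi>_def)
  then have d: "(ift \<phi> has_vector_derivative ift \<psi> x) (at x)" for x
    unfolding \<psi>_def by (rule ift_has_vector_derivative)
  then have "(\<lambda>x. vector_derivative (ift \<phi>) (at x)) = ift \<psi>"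
    by (auto simp: vector_derivative_at)
  moreover have "n_times_differentiable n (ift \<psi>) \<and> nth_deriv n (ift \<psi>) = ift (\<lambda>\<omega>. (\<i> * of_real \<omega>) ^ n * \<psi> \<omega>)"
    using Suc.prems by (intro Suc.IH) (simp only: power Suc_le_mono)
  moreover have "\<forall>x. ift \<phi> differentiable (at x)"
    using d by (auto intro: differentiableI_vector)
  ultimately show ?case
    unfolding n_times_differentiable_Suc nth_deriv_Suc power by simp
qed

subsection \<open>Fractional integrals\<close>

text \<open>A single power kernel decays too slowly at infinity, but the difference of two
  translates gains a power of \<open>t\<close>. Its singularities at 0 and \<eta> are integrable,
  and on each side of \<eta> the integrand has constant sign with an explicit antiderivative that
  has finite limits.\<close>

lemma integrable_power_kernel_diff:
  assumes "0 < \<sigma>" "\<sigma> < 1" "\<eta> > 0"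
  shows "integrable lborel (\<lambda>t. power_kernel \<sigma> t - power_kernel \<sigma> (t - \<eta>))"
proof -
  have lim0: "((\<lambda>t. t powr \<sigma> / \<sigma>) \<longlongrightarrow> 0) (at_right 0)"
    using assms by real_asymp
  have lim1: "((\<lambda>t. t powr \<sigma> / \<sigma>) \<longlongrightarrow> \<eta> powr \<sigma> / \<sigma>) (at_left \<eta>)"
    using assms by (auto intro!: tendsto_intros)
  have near: "set_integrable lborel (einterval (ereal 0) (ereal \<eta>)) (\<lambda>t. t powr (\<sigma> - 1))"
  proof (rule interval_integral_FTC_nonneg(1)[where F = "\<lambda>t. t powr \<sigma> / \<sigma>"])
    show "(((\<lambda>t. t powr \<sigma> / \<sigma>) \<circ> real_of_ereal) \<longlongrightarrow> 0) (at_right (ereal 0))"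
      using lim0 by (simp add: ereal_tendsto_simps)
    show "(((\<lambda>t. t powr \<sigma> / \<sigma>) \<circ> real_of_ereal) \<longlongrightarrow> \<eta> powr \<sigma> / \<sigma>) (at_left (ereal \<eta>))"
      using lim1 by (simp add: ereal_tendsto_simps)
  qed (use assms in \<open>auto intro!: derivative_eq_intros continuous_intros simp: field_simps\<close>)
  have lim2: "((\<lambda>t. ((t - \<eta>) powr \<sigma> - t powr \<sigma>) / \<sigma>) \<longlongrightarrow> - (\<eta> powr \<sigma>) / \<sigma>) (at_right \<eta>)"
  proof -
    have "((\<lambda>t. ((t - \<eta>) powr \<sigma> - t powr \<sigma>) / \<sigma>) \<longlongrightarrow> ((\<eta> - \<eta>) powr \<sigma> - \<eta> powr \<sigma>) / \<sigma>) (at_right \<eta>)"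
      using assms by (intro tendsto_intros tendsto_powr2) (auto simp: eventually_at_right_field intro!: exI[of _ "\<eta> + 1"] tendsto_eq_intros)
    then show ?thesis by simp
  qed
  have lim3: "((\<lambda>t. ((t - \<eta>) powr \<sigma> - t powr \<sigma>) / \<sigma>) \<longlongrightarrow> 0) at_top"
    using assms by real_asymp
  have far: "set_integrable lborel (einterval (ereal \<eta>) \<infinity>) (\<lambda>t. (t - \<eta>) powr (\<sigma> - 1) - t powr (\<sigma> - 1))"
  proof (rule interval_integral_FTC_nonneg(1)[where F = "\<lambda>t. ((t - \<eta>) powr \<sigma> - t powr \<sigma>) / \<sigma>"])
    show "(((\<lambda>t. ((t - \<eta>) powr \<sigma> - t powr \<sigma>) / \<sigma>) \<circ> real_of_ereal) \<longlongrightarrow> - (\<eta> powr \<sigma>) / \<sigma>) (at_right (ereal \<eta>))"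
      using lim2 by (simp add: ereal_tendsto_simps)
    show "(((\<lambda>t. ((t - \<eta>) powr \<sigma> - t powr \<sigma>) / \<sigma>) \<circ> real_of_ereal) \<longlongrightarrow> 0) (at_left \<infinity>)"
      using lim3 by (simp add: ereal_tendsto_simps)
    fix t assume t: "ereal \<eta> < ereal t"
    show "((\<lambda>t. ((t - \<eta>) powr \<sigma> - t powr \<sigma>) / \<sigma>) has_real_derivative (t - \<eta>) powr (\<sigma> - 1) - t powr (\<sigma> - 1)) (at t)"
      using t assms by (auto intro!: derivative_eq_intros simp: field_simps)
    show "isCont (\<lambda>t. (t - \<eta>) powr (\<sigma> - 1) - t powr (\<sigma> - 1)) t"
      using t assms by (auto intro!: continuous_intros)
  next
    show "AE t in lborel. ereal \<eta> < ereal t \<longrightarrow> ereal t < \<infinity> \<longrightarrow> 0 \<le> (t - \<eta>) powr (\<sigma> - 1) - t powr (\<sigma> - 1)"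
      using assms by (auto intro!: powr_mono2')
  qed auto
  \<comment> \<open>The second piece enters with a minus sign because beyond \<eta> the translated
    kernel is the larger one.\<close>
  have "integrable lborel (\<lambda>t. indicator {0<..<\<eta>} t *\<^sub>R t powr (\<sigma> - 1)
          - indicator {\<eta><..} t *\<^sub>R ((t - \<eta>) powr (\<sigma> - 1) - t powr (\<sigma> - 1)))"
    using near far unfolding set_integrable_def
    by (intro Bochner_Integration.integrable_diff) (simp_all add: einterval_def greaterThanLessThan_def greaterThan_def lessThan_def Collect_conj_eq[symmetric])
  moreover have "AE t in lborel. indicator {0<..<\<eta>} t *\<^sub>R t powr (\<sigma> - 1)
          - indicator {\<eta><..} t *\<^sub>R ((t - \<eta>) powr (\<sigma> - 1) - t powr (\<sigma> - 1)) = power_kernel \<sigma> t - power_kernel \<sigma> (t - \<eta>)"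
    using AE_lborel_singleton[of \<eta>]
    by eventually_elim (use assms in \<open>auto simp: power_kernel_def indicator_def\<close>)
  ultimately show ?thesis
    by (subst (asm) integrable_cong_AE) auto
qed

definition ckernel :: "real \<Rightarrow> real \<Rightarrow> complex" where
  "ckernel \<sigma> t = of_real (power_kernel \<sigma> t)"

lemma ckernel_measurable [measurable]: "ckernel \<sigma> \<in> borel_measurable borel"
  unfolding ckernel_def[abs_def] by measurable

lemma ckernel_nonpos: "t \<le> 0 \<Longrightarrow> ckernel \<sigma> t = 0"
  by (simp add: ckernel_def power_kernel_def)

lemma integrable_bdiff_ckernel:
  assumes "0 < \<sigma>" "\<sigma> < 1" "\<eta> > 0"
  shows "integrable lborel (bdiff \<eta> (ckernel \<sigma>))"
proof -
  have "bdiff \<eta> (ckernel \<sigma>) = (\<lambda>t. complex_of_real (power_kernel \<sigma> t - power_kernel \<sigma> (t - \<eta>)))"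
    by (simp add: bdiff_def fun_eq_iff ckernel_def)
  then show ?thesis
    by (simp only: integrable_of_real integrable_power_kernel_diff[OF assms])
qed

lemma i_times_notin_nonpos_Reals: "\<omega> \<noteq> 0 \<Longrightarrow> \<i> * of_real \<omega> \<notin> \<real>\<^sub>\<le>\<^sub>0"
  by (auto simp: complex_nonpos_Reals_iff)

text \<open>The Laplace transform is known at \<open>s = \<epsilon> + \<i> * \<omega>\<close>;
  letting \<epsilon> tend to 0 reaches the imaginary axis. The limit is taken for the difference,
  which is integrable and therefore serves as its own dominating function.\<close>

lemma ft_bdiff_ckernel:
  assumes "0 < \<sigma>" "\<sigma> < 1" "\<eta> > 0" "\<omega> \<noteq> 0"
  shows "ft (bdiff \<eta> (ckernel \<sigma>)) \<omega>
       = (1 - cis (- (\<omega> * \<eta>))) * (Gamma (of_real \<sigma>) * (\<i> * of_real \<omega>) powr (- of_real \<sigma>))"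
proof -
  let ?D = "bdiff \<eta> (ckernel \<sigma>)"
  define e where "e n = 1 / (real n + 1)" for n
  have e: "e n > 0" for n by (simp add: e_def)
  have e0: "e \<longlonglongrightarrow> 0" unfolding e_def[abs_def] by real_asymp
  define s where "s n = of_real (e n) + \<i> * of_real \<omega>" for n
  have s: "Re (s n) > 0" for n using e[of n] by (simp add: s_def)
  have "s \<longlonglongrightarrow> of_real 0 + \<i> * of_real \<omega>"
    unfolding s_def[abs_def] by (intro tendsto_intros e0)
  then have s_lim: "s \<longlonglongrightarrow> \<i> * of_real \<omega>" by simp
  have D_int: "integrable lborel ?D"
    by (rule integrable_bdiff_ckernel[OF assms(1-3)])
  then have [measurable]: "?D \<in> borel_measurable borel" by auto
  \<comment> \<open>The damping factor is at most 1 only for nonnegative \<open>t\<close>, so the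
    vanishing on the other half line is needed for the domination.\<close>
  have D0: "?D t = 0" if "t \<le> 0" for t
    using that assms by (simp add: bdiff_def ckernel_nonpos)
  have val: "(LINT t|lborel. exp (- s n * of_real t) * ?D t)
      = (1 - exp (- s n * of_real \<eta>)) * (Gamma (of_real \<sigma>) * s n powr (- of_real \<sigma>))" for n
  proof -
    let ?F = "Gamma (of_real \<sigma>) * s n powr (- of_real \<sigma>)"
    let ?g = "\<lambda>t. ckernel \<sigma> t * exp (- s n * of_real t)"
    have g: "has_bochner_integral lborel ?g ?F"
      unfolding ckernel_def by (rule power_kernel_laplace[OF assms(1) s])
    then have g_int: "integrable lborel ?g" by (simp add: has_bochner_integral_iff)
    have "exp (- s n * of_real t) * ?D t = ?g t - exp (- s n * of_real \<eta>) * ?g (t - \<eta>)" for t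
    proof -
      have "exp (- s n * of_real t) = exp (- s n * of_real \<eta>) * exp (- s n * of_real (t - \<eta>))"
        by (simp add: exp_add[symmetric] algebra_simps)
      then show ?thesis by (simp add: bdiff_def algebra_simps)
    qed
    then have "(LINT t|lborel. exp (- s n * of_real t) * ?D t)
       = (LINT t|lborel. ?g t - exp (- s n * of_real \<eta>) * ?g (t - \<eta>))" by (simp only:)
    also have "\<dots> = (LINT t|lborel. ?g t) - exp (- s n * of_real \<eta>) * (LINT t|lborel. ?g (t - \<eta>))"
      by (simp only: Bochner_Integration.integral_mult_right_zero
        Bochner_Integration.integral_diff[OF g_int integrable_mult_right[OF integrable_shift[OF g_int]]])
    also have "\<dots> = ?F - exp (- s n * of_real \<eta>) * ?F"
      unfolding integral_shift[of ?g] using g by (simp only: has_bochner_integral_iff)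
    finally show ?thesis by (simp add: algebra_simps)
  qed
  have "(\<lambda>n. LINT t|lborel. exp (- s n * of_real t) * ?D t) \<longlonglongrightarrow> ft ?D \<omega>"
    unfolding ft_def
  proof (rule integral_dominated_convergence[where w = "\<lambda>t. norm (?D t)"])
    show "AE t in lborel. (\<lambda>n. exp (- s n * of_real t) * ?D t) \<longlonglongrightarrow> cis (- (\<omega> * t)) * ?D t"
    proof (intro AE_I2)
      fix t
      have "(\<lambda>n. exp (- s n * of_real t) * ?D t) \<longlonglongrightarrow> exp (- (\<i> * of_real \<omega>) * of_real t) * ?D t"
        by (intro tendsto_intros s_lim)
      then show "(\<lambda>n. exp (- s n * of_real t) * ?D t) \<longlonglongrightarrow> cis (- (\<omega> * t)) * ?D t"
        by (simp add: cis_conv_exp mult.assoc)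
    qed
    show "AE t in lborel. norm (exp (- s n * of_real t) * ?D t) \<le> norm (?D t)" for n
    proof (intro AE_I2)
      fix t
      show "norm (exp (- s n * of_real t) * ?D t) \<le> norm (?D t)"
      proof (cases "t \<le> 0")
        case False
        then have "norm (exp (- s n * of_real t)) \<le> 1"
          using e[of n] by (simp add: s_def)
        then show ?thesis
          unfolding norm_mult by (intro mult_left_le_one_le) auto
      qed (simp add: D0)
    qed
  qed (use D_int in simp_all)
  moreover have "(\<lambda>n. LINT t|lborel. exp (- s n * of_real t) * ?D t)
     \<longlonglongrightarrow> (1 - exp (- (\<i> * of_real \<omega>) * of_real \<eta>)) * (Gamma (of_real \<sigma>) * (\<i> * of_real \<omega>) powr (- of_real \<sigma>))"
    unfolding val
    by (intro tendsto_intros s_lim tendsto_powr_complex i_times_notin_nonpos_Reals assms)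
  ultimately have "ft ?D \<omega> = (1 - exp (- (\<i> * of_real \<omega>) * of_real \<eta>)) * (Gamma (of_real \<sigma>) * (\<i> * of_real \<omega>) powr (- of_real \<sigma>))"
    by (rule LIMSEQ_unique)
  then show ?thesis by (simp add: cis_conv_exp mult.assoc)
qed

text \<open>Up to the factor \<open>1 / Gamma \<sigma>\<close> the Riemann-Liouville integral of
  order \<sigma>, after the substitution of \<open>x - t\<close> for the variable of
  integration.\<close>

definition frac_int :: "real \<Rightarrow> (real \<Rightarrow> complex) \<Rightarrow> real \<Rightarrow> complex" where
  "frac_int \<sigma> f x = (LINT t|lborel. f (x - t) * ckernel \<sigma> t)"

text \<open>Translation invariance moves the difference from the function to the kernel, where it
  produces an integrable kernel.\<close>

lemma bdiff_frac_int:
  assumes int: "\<And>x. integrable lborel (\<lambda>t. f (x - t) * ckernel \<sigma> t)"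
  shows "bdiff \<eta> (frac_int \<sigma> f) x = (LINT t|lborel. f (x - t) * bdiff \<eta> (ckernel \<sigma>) t)"
proof -
  have shift: "(\<lambda>t. f (x - t) * ckernel \<sigma> (t - \<eta>)) = (\<lambda>t. (\<lambda>t. f (x - \<eta> - t) * ckernel \<sigma> t) (t - \<eta>))"
    by (simp add: fun_eq_iff)
  have "frac_int \<sigma> f (x - \<eta>) = (LINT t|lborel. f (x - t) * ckernel \<sigma> (t - \<eta>))"
    unfolding frac_int_def shift by (rule integral_shift[symmetric])
  moreover have "integrable lborel (\<lambda>t. f (x - t) * ckernel \<sigma> (t - \<eta>))"
    unfolding shift by (rule integrable_shift[OF int])
  ultimately show ?thesis
    using int[of x] unfolding bdiff_def right_diff_distrib by (simp add: frac_int_def)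
qed

text \<open>The transform of the \<open>n\<close>-fold difference is known in two ways, by the
  multiplier \<open>M\<close> and by a power of the box kernel. Comparing them at one step \<eta>
  where the difference factor is nonzero isolates the transform of the derivative.\<close>

lemma ft_nth_deriv_of_bdiff:
  assumes F: "n_times_differentiable n F" "integrable lborel (nth_deriv n F)" and "\<omega> \<noteq> 0"
    and M: "\<And>\<eta>. \<eta> > 0 \<Longrightarrow> ft ((bdiff \<eta> ^^ n) F) \<omega> = (1 - cis (- (\<omega> * \<eta>))) ^ n * M"
  shows "ft (nth_deriv n F) \<omega> = (\<i> * of_real \<omega>) ^ n * M"
proof -
  \<comment> \<open>With this step \<open>\<omega> * \<eta>\<close> is \<open>pi\<close> or
    \<open>- pi\<close>, so the difference factor equals 2 and can be divided out.\<close>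
  define \<eta> where "\<eta> = pi / \<bar>\<omega>\<bar>"
  have "\<eta> > 0" using assms by (simp add: \<eta>_def)
  have "1 - cis (- (\<omega> * \<eta>)) = 2"
    using assms(3) by (auto simp: \<eta>_def abs_if complex_eq_iff)
  note two = this
  have "\<i> * of_real \<omega> * ft (box_kernel \<eta>) \<omega> = 2"
    using ft_box_kernel[OF \<open>\<eta> > 0\<close>, of \<omega>] two by simp
  then have "2 ^ n * ft (nth_deriv n F) \<omega> = (\<i> * of_real \<omega>) ^ n * (ft (box_kernel \<eta>) \<omega> ^ n * ft (nth_deriv n F) \<omega>)"
    by (simp flip: power_mult_distrib mult.assoc)
  also have "ft (box_kernel \<eta>) \<omega> ^ n * ft (nth_deriv n F) \<omega> = 2 ^ n * M"
    using bdiff_pow_nth_deriv[OF F \<open>\<eta> > 0\<close>] M[OF \<open>\<eta> > 0\<close>] two by simp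
  finally show ?thesis by simp
qed

lemma ft_nth_deriv:
  assumes "n_times_differentiable n f" "integrable lborel (nth_deriv n f)" "integrable lborel f" "\<omega> \<noteq> 0"
  shows "ft (nth_deriv n f) \<omega> = (\<i> * of_real \<omega>) ^ n * ft f \<omega>"
  using assms by (intro ft_nth_deriv_of_bdiff) (auto simp: ft_bdiff_pow)

text \<open>One of the \<open>n\<close> differences is spent on the kernel, which makes the
  fractional integral a convolution of integrable functions; the other \<open>n - 1\<close> act on
  that integrable function.\<close>

lemma ft_nth_deriv_frac_int:
  assumes f: "integrable lborel f" and int: "\<And>x. integrable lborel (\<lambda>t. f (x - t) * ckernel \<sigma> t)"
    and "0 < \<sigma>" "\<sigma> < 1" "n > 0"
    and "n_times_differentiable n (frac_int \<sigma> f)" "integrable lborel (nth_deriv n (frac_int \<sigma> f))" "\<omega> \<noteq> 0"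
  shows "ft (nth_deriv n (frac_int \<sigma> f)) \<omega>
       = (\<i> * of_real \<omega>) ^ n * (Gamma (of_real \<sigma>) * (\<i> * of_real \<omega>) powr (- of_real \<sigma>) * ft f \<omega>)"
proof (rule ft_nth_deriv_of_bdiff[OF assms(6-8)])
  fix \<eta> :: real assume "\<eta> > 0"
  note D = integrable_bdiff_ckernel[OF assms(3,4) \<open>\<eta> > 0\<close>]
  obtain m where n: "n = Suc m" using \<open>n > 0\<close> by (cases n) auto
  have eq: "bdiff \<eta> (frac_int \<sigma> f) = (\<lambda>x. LINT t|lborel. f (x - t) * bdiff \<eta> (ckernel \<sigma>) t)"
    using bdiff_frac_int[OF int] by (simp add: fun_eq_iff)
  have "ft ((bdiff \<eta> ^^ n) (frac_int \<sigma> f)) \<omega> = ft ((bdiff \<eta> ^^ m) (bdiff \<eta> (frac_int \<sigma> f))) \<omega>"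
    by (simp add: n funpow_swap1)
  also have "\<dots> = (1 - cis (- (\<omega> * \<eta>))) ^ m * (ft f \<omega> * ft (bdiff \<eta> (ckernel \<sigma>)) \<omega>)"
    unfolding eq by (simp add: ft_bdiff_pow integrable_convolution[OF f D] ft_convolution[OF f D])
  also have "\<dots> = (1 - cis (- (\<omega> * \<eta>))) ^ n * (Gamma (of_real \<sigma>) * (\<i> * of_real \<omega>) powr (- of_real \<sigma>) * ft f \<omega>)"
    unfolding ft_bdiff_ckernel[OF assms(3,4) \<open>\<eta> > 0\<close> \<open>\<omega> \<noteq> 0\<close>] n by (simp add: mult_ac)
  finally show "ft ((bdiff \<eta> ^^ n) (frac_int \<sigma> f)) \<omega>
      = (1 - cis (- (\<omega> * \<eta>))) ^ n * (Gamma (of_real \<sigma>) * (\<i> * of_real \<omega>) powr (- of_real \<sigma>) * ft f \<omega>)" .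
qed

text \<open>With the factor \<open>exp (- \<epsilon> t)\<close> the kernel is integrable, so Fubini
  yields the Laplace transform at \<open>\<epsilon> + \<i> * \<omega>\<close>; both sides then
  converge by domination. The result holds at every \<open>x\<close> with an absolutely convergent
  integral, not just almost everywhere.\<close>

lemma frac_int_ift:
  assumes int: "integrable lborel (\<lambda>t. f (x - t) * ckernel \<sigma> t)" and f: "f \<in> borel_measurable borel"
    and inv: "AE y in lborel. f y = ift \<phi> y" and \<phi>: "integrable lborel \<phi>"
    and \<phi>': "integrable lborel (\<lambda>\<omega>. (\<i> * of_real \<omega>) powr (- of_real \<sigma>) * \<phi> \<omega>)" and "\<sigma> > 0"
  shows "frac_int \<sigma> f x = ift (\<lambda>\<omega>. Gamma (of_real \<sigma>) * ((\<i> * of_real \<omega>) powr (- of_real \<sigma>) * \<phi> \<omega>)) x"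
proof -
  have [measurable]: "\<phi> \<in> borel_measurable borel" "f \<in> borel_measurable borel"
    "(\<lambda>\<omega>. (\<i> * of_real \<omega>) powr (- of_real \<sigma>) * \<phi> \<omega>) \<in> borel_measurable borel" using \<phi> f \<phi>' by auto
  define e where "e n = 1 / (real n + 1)" for n
  have e: "e n > 0" for n by (simp add: e_def)
  have e0: "e \<longlonglongrightarrow> 0" unfolding e_def[abs_def] by real_asymp
  define s where "s n \<omega> = of_real (e n) + \<i> * of_real \<omega>" for n \<omega>
  have s: "Re (s n \<omega>) > 0" for n \<omega> using e[of n] by (simp add: s_def)
  have s_lim: "(\<lambda>n. s n \<omega>) \<longlonglongrightarrow> \<i> * of_real \<omega>" for \<omega>
  proof -
    have "(\<lambda>n. s n \<omega>) \<longlonglongrightarrow> of_real 0 + \<i> * of_real \<omega>"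
      unfolding s_def[abs_def] by (intro tendsto_intros e0)
    then show ?thesis by simp
  qed
  let ?k = "\<lambda>n t. ckernel \<sigma> t * of_real (exp (- e n * t))"
  have k: "integrable lborel (?k n)" for n
  proof -
    have "integrable lborel (\<lambda>t. ckernel \<sigma> t * exp (- of_real (e n) * of_real t))"
      unfolding ckernel_def using power_kernel_laplace[OF \<open>\<sigma> > 0\<close>, of "of_real (e n)"] e[of n]
      by (simp add: has_bochner_integral_iff)
    then show ?thesis by (simp add: exp_of_real[symmetric])
  qed
  \<comment> \<open>Reflection and translation preserve null sets, so for each fixed
    \<open>x\<close> the function may be replaced by its inverse transform under the
    integral.\<close>
  have AEx: "AE t in lborel. f (x - t) = ift \<phi> (x - t)"
  proof -
    have "AE y in distr lborel borel (\<lambda>t. x + (-1) * t). f y = ift \<phi> y"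
      using inv by (subst (asm) lborel_real_affine[of "-1" x]) (simp_all add: AE_density)
    then have "AE t in lborel. f (x + (-1) * t) = ift \<phi> (x + (-1) * t)"
      by (rule AE_distrD[rotated]) simp
    then show ?thesis by simp
  qed
  have reg: "(LINT t|lborel. f (x - t) * ?k n t)
      = (LINT \<omega>|lborel. cis (\<omega> * x) * (Gamma (of_real \<sigma>) * (s n \<omega> powr (- of_real \<sigma>) * \<phi> \<omega>)))" for n
  proof -
    have int2: "integrable (lborel \<Otimes>\<^sub>M lborel) (\<lambda>(t, \<omega>). cis (\<omega> * (x - t)) * \<phi> \<omega> * ?k n t)"
      by (rule Bochner_Integration.integrable_bound[OF integrable_pair_mult[OF k[of n] \<phi>]])
        (auto simp: norm_mult)
    have cis_exp: "cis (\<omega> * (x - t)) * of_real (exp (- e n * t)) = cis (\<omega> * x) * exp (- s n \<omega> * of_real t)" for \<omega> t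
      by (simp add: cis_conv_exp exp_of_real[symmetric] exp_add[symmetric] s_def algebra_simps)
    have [measurable]: "ift \<phi> \<in> borel_measurable borel"
      by (intro borel_measurable_continuous_onI continuous_on_ift \<phi>)
    have "(LINT t|lborel. f (x - t) * ?k n t) = (LINT t|lborel. ift \<phi> (x - t) * ?k n t)"
      using AEx by (intro integral_cong_AE) auto
    also have "\<dots> = (LINT t|lborel. LINT \<omega>|lborel. cis (\<omega> * (x - t)) * \<phi> \<omega> * ?k n t)"
      unfolding ift_def by (simp only: Bochner_Integration.integral_mult_left_zero)
    also have "\<dots> = (LINT \<omega>|lborel. LINT t|lborel. cis (\<omega> * (x - t)) * \<phi> \<omega> * ?k n t)"
      by (rule lborel_pair.Fubini_integral[OF int2, symmetric])
    also have "\<dots> = (LINT \<omega>|lborel. LINT t|lborel. cis (\<omega> * x) * \<phi> \<omega> * (ckernel \<sigma> t * exp (- s n \<omega> * of_real t)))"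
    proof -
      have "cis (\<omega> * (x - t)) * \<phi> \<omega> * ?k n t = cis (\<omega> * x) * \<phi> \<omega> * (ckernel \<sigma> t * exp (- s n \<omega> * of_real t))" for \<omega> t
        using cis_exp[of \<omega> t] by (simp add: mult_ac)
      then show ?thesis by (simp only:)
    qed
    also have "\<dots> = (LINT \<omega>|lborel. cis (\<omega> * x) * \<phi> \<omega> * (Gamma (of_real \<sigma>) * s n \<omega> powr (- of_real \<sigma>)))"
      unfolding Bochner_Integration.integral_mult_right_zero ckernel_def
        has_bochner_integral_integral_eq[OF power_kernel_laplace[OF \<open>\<sigma> > 0\<close> s]] ..
    finally show ?thesis by (simp add: mult_ac)
  qed
  have "(\<lambda>n. LINT t|lborel. f (x - t) * ?k n t) \<longlonglongrightarrow> frac_int \<sigma> f x"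
    unfolding frac_int_def
  proof (rule integral_dominated_convergence[where w = "\<lambda>t. norm (f (x - t) * ckernel \<sigma> t)"])
    show "AE t in lborel. (\<lambda>n. f (x - t) * ?k n t) \<longlonglongrightarrow> f (x - t) * ckernel \<sigma> t"
    proof (intro AE_I2)
      fix t
      have "(\<lambda>n. f (x - t) * ?k n t) \<longlonglongrightarrow> f (x - t) * (ckernel \<sigma> t * of_real (exp (- 0 * t)))"
        by (intro tendsto_intros e0)
      then show "(\<lambda>n. f (x - t) * ?k n t) \<longlonglongrightarrow> f (x - t) * ckernel \<sigma> t" by simp
    qed
    show "AE t in lborel. norm (f (x - t) * ?k n t) \<le> norm (f (x - t) * ckernel \<sigma> t)" for n
    proof (intro AE_I2)
      fix t
      show "norm (f (x - t) * ?k n t) \<le> norm (f (x - t) * ckernel \<sigma> t)"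
      proof (cases "t \<le> 0")
        case False
        then have "exp (- e n * t) \<le> 1" using e[of n] by simp
        then show ?thesis by (simp add: norm_mult mult_left_le mult_left_mono)
      qed (simp add: ckernel_nonpos)
    qed
  qed (use int in simp_all)
  moreover have "(\<lambda>n. LINT t|lborel. f (x - t) * ?k n t)
     \<longlonglongrightarrow> ift (\<lambda>\<omega>. Gamma (of_real \<sigma>) * ((\<i> * of_real \<omega>) powr (- of_real \<sigma>) * \<phi> \<omega>)) x"
    unfolding reg ift_def
  proof (rule integral_dominated_convergence[where w = "\<lambda>\<omega>. norm (Gamma (of_real \<sigma>) * ((\<i> * of_real \<omega>) powr (- of_real \<sigma>) * \<phi> \<omega>))"])
    show "AE \<omega> in lborel. (\<lambda>n. cis (\<omega> * x) * (Gamma (of_real \<sigma>) * (s n \<omega> powr (- of_real \<sigma>) * \<phi> \<omega>)))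
       \<longlonglongrightarrow> cis (\<omega> * x) * (Gamma (of_real \<sigma>) * ((\<i> * of_real \<omega>) powr (- of_real \<sigma>) * \<phi> \<omega>))"
      using AE_lborel_singleton[of 0]
      by eventually_elim (intro tendsto_intros s_lim tendsto_powr_complex i_times_notin_nonpos_Reals)
    show "AE \<omega> in lborel. norm (cis (\<omega> * x) * (Gamma (of_real \<sigma>) * (s n \<omega> powr (- of_real \<sigma>) * \<phi> \<omega>)))
       \<le> norm (Gamma (of_real \<sigma>) * ((\<i> * of_real \<omega>) powr (- of_real \<sigma>) * \<phi> \<omega>))" for n
      using AE_lborel_singleton[of 0]
    proof eventually_elim
      case (elim \<omega>)
      \<comment> \<open>Moving off the imaginary axis only increases the modulus, so the negative
        power is dominated by its boundary value.\<close>
      have "\<bar>\<omega>\<bar> \<le> norm (s n \<omega>)"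
        using abs_Im_le_cmod[of "s n \<omega>"] by (simp add: s_def)
      then have "norm (s n \<omega>) powr - \<sigma> \<le> \<bar>\<omega>\<bar> powr - \<sigma>"
        using elim \<open>\<sigma> > 0\<close> by (intro powr_mono2') auto
      then have "norm (s n \<omega> powr (- of_real \<sigma>)) \<le> norm ((\<i> * of_real \<omega>) powr (- of_real \<sigma>))"
        by (simp add: norm_powr_real_powr' norm_mult)
      then show ?case
        unfolding norm_mult by (auto intro!: mult_left_mono mult_right_mono)
    qed
    show "integrable lborel (\<lambda>\<omega>. norm (Gamma (of_real \<sigma>) * ((\<i> * of_real \<omega>) powr (- of_real \<sigma>) * \<phi> \<omega>)))"
      by (intro integrable_norm integrable_mult_right \<phi>')
    have "(\<lambda>\<omega>. s n \<omega> powr (- of_real \<sigma>)) \<in> borel_measurable borel" for n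
    proof (intro borel_measurable_continuous_onI continuous_on_powr_complex)
      show "continuous_on UNIV (s n)" unfolding s_def[abs_def] by (intro continuous_intros)
      show "UNIV \<subseteq> {\<omega>. 0 \<le> Re (s n \<omega>) \<or> Im (s n \<omega>) \<noteq> 0}"
        using s[of n] by (auto intro: less_imp_le)
      show "0 < Re (- of_real \<sigma>)" if "s n \<omega> = 0" for \<omega>
        using s[of n \<omega>] that by simp
    qed (intro continuous_intros)
    then show "(\<lambda>\<omega>. cis (\<omega> * x) * (Gamma (of_real \<sigma>) * (s n \<omega> powr (- of_real \<sigma>) * \<phi> \<omega>))) \<in> borel_measurable lborel" for n
      by simp
  qed measurable
  ultimately show ?thesis by (rule LIMSEQ_unique)
qed

subsection \<open>Gruenwald sums\<close>

text \<open>The binomial coefficients are of order \<open>k powr (- \<alpha> - 1)\<close>, and this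
  is summable for \<alpha> > 0.\<close>

lemma summable_gruenwald_coeff:
  assumes "\<alpha> > 0"
  shows "summable (\<lambda>k. \<bar>gruenwald_coeff \<alpha> k\<bar>)"
proof -
  have abs: "\<bar>gruenwald_coeff \<alpha> k\<bar> = \<bar>\<alpha> gchoose k\<bar>" for k
    by (simp add: gruenwald_coeff_def abs_mult)
  \<comment> \<open>For integer \<alpha> this limit is 0; only the boundedness of the sequence is
    used.\<close>
  have "(\<lambda>n. norm ((\<alpha> gchoose n) / ((-1) ^ n / exp ((\<alpha> + 1) * of_real (ln (real n)))))) \<longlonglongrightarrow> norm (inverse (Gamma (- \<alpha>)))"
    by (intro tendsto_norm gbinomial_asymptotic)
  then have "Bseq (\<lambda>n. norm ((\<alpha> gchoose n) / ((-1) ^ n / exp ((\<alpha> + 1) * of_real (ln (real n))))))"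
    by (intro convergent_imp_Bseq convergentI)
  then obtain K where K: "\<And>n. norm ((\<alpha> gchoose n) / ((-1) ^ n / exp ((\<alpha> + 1) * of_real (ln (real n))))) \<le> K"
    unfolding Bseq_def by auto
  have "summable (\<lambda>n. K * real n powr (- (\<alpha> + 1)))"
    using assms by (intro summable_mult) (simp add: summable_real_powr_iff)
  then show ?thesis
  proof (rule summable_comparison_test')
    fix n :: nat assume "n \<ge> 1"
    then have "exp ((\<alpha> + 1) * ln (real n)) = real n powr (\<alpha> + 1)" by (simp add: powr_def)
    then have "\<bar>\<alpha> gchoose n\<bar> * real n powr (\<alpha> + 1) \<le> K"
      using K[of n] by (simp add: abs_mult abs_divide power_abs)
    then show "norm \<bar>gruenwald_coeff \<alpha> n\<bar> \<le> K * real n powr (- (\<alpha> + 1))"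
      using \<open>n \<ge> 1\<close> unfolding abs powr_minus by (simp add: field_simps)
  qed
qed

text \<open>The binomial series is continued to the boundary of the unit disc by uniform convergence.\<close>

lemma gruenwald_series:
  fixes z :: complex
  assumes "\<alpha> > 0" "norm z = 1"
  shows "(\<lambda>k. of_real (gruenwald_coeff \<alpha> k) * z ^ k) sums (1 - z) powr of_real \<alpha>"
proof -
  define f where "f w = (\<Sum>k. complex_of_real (gruenwald_coeff \<alpha> k) * w ^ k)" for w
  have bound: "norm (complex_of_real (gruenwald_coeff \<alpha> k) * w ^ k) \<le> \<bar>gruenwald_coeff \<alpha> k\<bar>" if "w \<in> cball 0 1" for w k
    using that by (simp add: norm_mult norm_power mult_left_le power_le_one)
  have "uniform_limit (cball 0 1) (\<lambda>n w. \<Sum>k<n. complex_of_real (gruenwald_coeff \<alpha> k) * w ^ k) f sequentially"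
    unfolding f_def by (rule Weierstrass_m_test[OF bound summable_gruenwald_coeff[OF assms(1)]])
  then have cont: "continuous_on (cball 0 1) f"
    by (rule uniform_limit_theorem[rotated]) (auto intro!: always_eventually continuous_intros)
  define X where "X n = of_real (1 - 1 / (real n + 1)) * z" for n
  have Xnorm: "norm (X n) < 1" for n
    using assms(2) by (simp add: X_def norm_mult del: of_real_diff)
  have Xlim: "X \<longlonglongrightarrow> z"
  proof -
    have "(\<lambda>n. 1 - 1 / (real n + 1)) \<longlonglongrightarrow> 1" by real_asymp
    then have "X \<longlonglongrightarrow> of_real 1 * z"
      unfolding X_def[abs_def] by (intro tendsto_intros)
    then show ?thesis by simp
  qed
  have f_lim: "(\<lambda>n. f (X n)) \<longlonglongrightarrow> f z"
    using continuous_on_tendsto_compose[OF cont Xlim] assms(2) Xnorm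
    by (auto intro!: always_eventually less_imp_le)
  have f_X: "f (X n) = (1 - X n) powr of_real \<alpha>" for n
  proof -
    have "complex_of_real (gruenwald_coeff \<alpha> k) * X n ^ k = (of_real \<alpha> gchoose k) * (- X n) ^ k" for k
      unfolding gruenwald_coeff_def gbinomial_of_real power_minus[of "X n"] by simp
    then show ?thesis
      using gen_binomial_complex[of "- X n" "of_real \<alpha>"] Xnorm[of n] by (simp add: f_def sums_iff)
  qed
  have "(\<lambda>n. (1 - X n) powr of_real \<alpha>) \<longlonglongrightarrow> (1 - z) powr of_real \<alpha>"
  proof (intro tendsto_powr_complex' tendsto_intros Xlim)
    \<comment> \<open>On the unit circle \<open>1 - z\<close> has positive real part unless
      \<open>z = 1\<close>. The branch cut is therefore met only at 0, where a positive exponent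
      keeps the power continuous.\<close>
    have "Re z \<le> 1" using assms(2) complex_Re_le_cmod[of z] by simp
    moreover have "z = 1" if "Re z = 1"
    proof -
      have "(Im z)\<^sup>2 = 0" using assms(2) that cmod_power2[of z] by simp
      then show ?thesis using that by (simp add: complex_eq_iff)
    qed
    ultimately show "1 - z \<notin> \<real>\<^sub>\<le>\<^sub>0 \<or> 1 - z = 0 \<and> 0 < Re (complex_of_real \<alpha>)"
      using assms(1) by (auto simp: complex_nonpos_Reals_iff)
  qed
  with f_lim have "f z = (1 - z) powr of_real \<alpha>"
    unfolding f_X by (rule LIMSEQ_unique)
  moreover have "summable (\<lambda>k. complex_of_real (gruenwald_coeff \<alpha> k) * z ^ k)"
    using bound[of z] assms(2)
    by (intro summable_comparison_test'[OF summable_gruenwald_coeff[OF assms(1)]]) auto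
  ultimately show ?thesis unfolding f_def by (simp add: sums_iff)
qed

text \<open>A translation by \<open>k * h\<close> multiplies the transform by
  \<open>cis (- (\<omega> * h)) ^ k\<close>, so the sum becomes the binomial series on the unit
  circle. Absolute summability of the coefficients permits the exchange with the integral.\<close>

lemma gruenwald_ift:
  assumes "\<alpha> > 0" and \<phi>: "integrable lborel \<phi>"
  shows "gruenwald_term \<alpha> h s (ift \<phi>) x sums
     (LINT \<omega>|lborel. cis (\<omega> * x) * (cis (s * (\<omega> * h)) * (1 - cis (- (\<omega> * h))) powr of_real \<alpha> * \<phi> \<omega>))"
proof -
  have [measurable]: "\<phi> \<in> borel_measurable borel" using \<phi> by auto
  define f where "f k \<omega> = of_real (gruenwald_coeff \<alpha> k) * (cis (\<omega> * (x - (real k - of_int s) * h)) * \<phi> \<omega>)" for k \<omega>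
  have f_int: "integrable lborel (f k)" for k
    unfolding f_def by (intro integrable_mult_right integrable_cis_mult \<phi>) simp
  have norm_f: "norm (f k \<omega>) = \<bar>gruenwald_coeff \<alpha> k\<bar> * norm (\<phi> \<omega>)" for k \<omega>
    by (simp add: f_def norm_mult)
  have "(\<lambda>k. integral\<^sup>L lborel (f k)) sums (LINT \<omega>|lborel. (\<Sum>k. f k \<omega>))"
  proof (rule sums_integral[OF f_int])
    show "AE \<omega> in lborel. summable (\<lambda>k. norm (f k \<omega>))"
      unfolding norm_f using summable_gruenwald_coeff[OF assms(1)] by (simp add: summable_mult2)
    show "summable (\<lambda>k. LINT \<omega>|lborel. norm (f k \<omega>))"
      unfolding norm_f using summable_gruenwald_coeff[OF assms(1)] by (simp add: summable_mult2)
  qed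
  moreover have "integral\<^sup>L lborel (f k) = gruenwald_term \<alpha> h s (ift \<phi>) x k" for k
    unfolding f_def by (simp add: gruenwald_term_def ift_def scaleR_conv_of_real)
  moreover have "(\<Sum>k. f k \<omega>) = cis (\<omega> * x) * (cis (s * (\<omega> * h)) * (1 - cis (- (\<omega> * h))) powr of_real \<alpha> * \<phi> \<omega>)" for \<omega>
  proof -
    have "f k \<omega> = of_real (gruenwald_coeff \<alpha> k) * cis (- (\<omega> * h)) ^ k * (cis (\<omega> * x) * cis (s * (\<omega> * h)) * \<phi> \<omega>)" for k
    proof -
      have "cis (\<omega> * (x - (real k - of_int s) * h)) = cis (- (\<omega> * h)) ^ k * (cis (\<omega> * x) * cis (s * (\<omega> * h)))"
        unfolding Complex.DeMoivre cis_mult by (rule arg_cong[where f = cis]) (simp add: algebra_simps)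
      then show ?thesis by (simp only: f_def mult.assoc)
    qed
    moreover have "(\<lambda>k. of_real (gruenwald_coeff \<alpha> k) * cis (- (\<omega> * h)) ^ k * (cis (\<omega> * x) * cis (s * (\<omega> * h)) * \<phi> \<omega>))
       sums ((1 - cis (- (\<omega> * h))) powr of_real \<alpha> * (cis (\<omega> * x) * cis (s * (\<omega> * h)) * \<phi> \<omega>))"
      by (intro sums_mult2 gruenwald_series assms) simp
    ultimately show ?thesis by (simp add: sums_iff mult_ac)
  qed
  ultimately show ?thesis by (simp only:)
qed

text \<open>The error is the inverse transform of the symbol difference at
  \<open>\<theta> = \<omega> * h\<close>. The modulus of \<open>cis\<close> is 1, so the L1 bound on
  the frequency side is uniform in \<open>x\<close>.\<close>

lemma wsgd_error_ift:
  fixes p q r :: int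
  assumes "\<alpha> > 0" "p \<noteq> q" "p \<noteq> r" "q \<noteq> r"
    and \<phi>: "integrable lborel \<phi>" and \<phi>\<^sub>\<alpha>: "integrable lborel (\<lambda>\<omega>. (\<i> * of_real \<omega>) powr of_real \<alpha> * \<phi> \<omega>)"
    and \<phi>\<^sub>3: "integrable lborel (\<lambda>\<omega>. \<bar>\<omega>\<bar> powr (\<alpha> + 3) * norm (\<phi> \<omega>))"
  shows "\<exists>C. \<forall>h>0. \<forall>x. norm (wsgd \<alpha> p q r h (ift \<phi>) x - ift (\<lambda>\<omega>. (\<i> * of_real \<omega>) powr of_real \<alpha> * \<phi> \<omega>) x) \<le> C * h ^ 3"
proof -
  have [measurable]: "\<phi> \<in> borel_measurable borel" using \<phi> by auto
  obtain C where C: "\<And>\<theta>::real. norm ((wsgd_weight \<alpha> p q r * cis (p * \<theta>) + wsgd_weight \<alpha> q p r * cis (q * \<theta>)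
      + wsgd_weight \<alpha> r p q * cis (r * \<theta>)) * (1 - cis (- \<theta>)) powr of_real \<alpha>
      - (\<i> * of_real \<theta>) powr of_real \<alpha>) \<le> C * \<bar>\<theta>\<bar> powr (\<alpha> + 3)"
    using wsgd_symbol_bound[OF assms(1-4)] by blast
  have "C \<ge> 0"
    using order_trans[OF norm_ge_zero C[of 1]] by simp
  define I where "I = (LINT \<omega>|lborel. \<bar>\<omega>\<bar> powr (\<alpha> + 3) * norm (\<phi> \<omega>))"
  have "norm (wsgd \<alpha> p q r h (ift \<phi>) x - ift (\<lambda>\<omega>. (\<i> * of_real \<omega>) powr of_real \<alpha> * \<phi> \<omega>) x) \<le> C * I * h ^ 3"
    if "h > 0" for h x
  proof -
    define G where "G s \<omega> = cis (\<omega> * x) * (cis (real_of_int s * (\<omega> * h)) * (1 - cis (- (\<omega> * h))) powr of_real \<alpha> * \<phi> \<omega>)" for s \<omega>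
    have symbol_meas [measurable]: "(\<lambda>\<omega>. (1 - cis (- (\<omega> * h))) powr of_real \<alpha>) \<in> borel_measurable borel"
    proof (intro borel_measurable_continuous_onI)
      \<comment> \<open>\<open>1 - cis t\<close> stays in the closed right half plane and meets the
        imaginary axis only at 0, so its power is continuous for \<alpha> > 0.\<close>
      have "Re (1 - cis t) \<ge> 0" "Re (1 - cis t) = 0 \<Longrightarrow> 1 - cis t = 0" for t
        by (auto simp: complex_eq_iff) (metis cos_one_sin_zero)
      then show "continuous_on UNIV (\<lambda>\<omega>. (1 - cis (- (\<omega> * h))) powr of_real \<alpha>)"
        using assms(1)
        by (intro continuous_on_powr_complex continuous_intros)
           (auto simp: complex_nonpos_Reals_iff)
    qed
    have G_int: "integrable lborel (G s)" for s
    proof (rule Bochner_Integration.integrable_bound)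
      show "integrable lborel (\<lambda>\<omega>. of_real (2 powr \<alpha>) * \<phi> \<omega>)" using \<phi> by simp
      show "AE \<omega> in lborel. norm (G s \<omega>) \<le> norm (of_real (2 powr \<alpha>) * \<phi> \<omega>)"
      proof (intro AE_I2)
        fix \<omega>
        have "norm (1 - cis (- (\<omega> * h))) \<le> 2"
          using norm_triangle_ineq4[of 1 "cis (- (\<omega> * h))"] by simp
        then have "norm (1 - cis (- (\<omega> * h))) powr \<alpha> \<le> 2 powr \<alpha>"
          using assms(1) by (intro powr_mono2) auto
        then show "norm (G s \<omega>) \<le> norm (of_real (2 powr \<alpha>) * \<phi> \<omega>)"
          by (simp add: G_def norm_mult norm_powr_real_powr' mult_right_mono)
      qed
    qed (simp add: G_def[abs_def])
    have sg: "shifted_gruenwald \<alpha> h s (ift \<phi>) x = of_real (h powr - \<alpha>) * (LINT \<omega>|lborel. G s \<omega>)" for s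
      using gruenwald_ift[OF assms(1) \<phi>, of h s x]
      by (simp add: shifted_gruenwald_def G_def sums_iff scaleR_conv_of_real powr_minus divide_inverse mult.commute)
    define W where "W \<theta> = wsgd_weight \<alpha> p q r * cis (p * \<theta>) + wsgd_weight \<alpha> q p r * cis (q * \<theta>)
      + wsgd_weight \<alpha> r p q * cis (r * \<theta>)" for \<theta> :: real
    define E where "E \<omega> = cis (\<omega> * x) * (of_real (h powr - \<alpha>) * (W (\<omega> * h) * (1 - cis (- (\<omega> * h))) powr of_real \<alpha>
        - (\<i> * of_real (\<omega> * h)) powr of_real \<alpha>) * \<phi> \<omega>)" for \<omega>
    \<comment> \<open>The exact symbol is homogeneous of degree \<alpha> under positive scaling,
      which brings both parts of the error under the common factor
      \<open>h powr - \<alpha>\<close>.\<close>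
    have scale: "of_real (h powr - \<alpha>) * (\<i> * of_real (\<omega> * h)) powr of_real \<alpha> = (\<i> * of_real \<omega>) powr of_real \<alpha>" for \<omega>
    proof -
      have "(\<i> * of_real (\<omega> * h)) powr of_real \<alpha> = (of_real h * (\<i> * of_real \<omega>)) powr of_real \<alpha>"
        by (simp add: mult_ac)
      also have "\<dots> = of_real h powr of_real \<alpha> * (\<i> * of_real \<omega>) powr of_real \<alpha>"
        using \<open>h > 0\<close> by (intro powr_times_real_left) auto
      also have "complex_of_real h powr of_real \<alpha> = of_real (h powr \<alpha>)"
        using \<open>h > 0\<close> by (simp add: powr_of_real)
      finally show ?thesis
        using \<open>h > 0\<close> by (simp add: powr_minus)
    qed
    have "wsgd \<alpha> p q r h (ift \<phi>) x - ift (\<lambda>\<omega>. (\<i> * of_real \<omega>) powr of_real \<alpha> * \<phi> \<omega>) x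
      = (LINT \<omega>|lborel. of_real (wsgd_weight \<alpha> p q r * h powr - \<alpha>) * G p \<omega> + of_real (wsgd_weight \<alpha> q p r * h powr - \<alpha>) * G q \<omega>
          + of_real (wsgd_weight \<alpha> r p q * h powr - \<alpha>) * G r \<omega> - cis (\<omega> * x) * ((\<i> * of_real \<omega>) powr of_real \<alpha> * \<phi> \<omega>))"
    proof -
      have "integrable lborel (\<lambda>\<omega>. cis (\<omega> * x) * ((\<i> * of_real \<omega>) powr of_real \<alpha> * \<phi> \<omega>))"
        by (intro integrable_cis_mult \<phi>\<^sub>\<alpha>) simp
      then show ?thesis
        using G_int unfolding wsgd_def sg ift_def scaleR_conv_of_real by simp
    qed
    also have "\<dots> = (LINT \<omega>|lborel. E \<omega>)"
    proof (intro Bochner_Integration.integral_cong refl)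
      fix \<omega>
      show "of_real (wsgd_weight \<alpha> p q r * h powr - \<alpha>) * G p \<omega> + of_real (wsgd_weight \<alpha> q p r * h powr - \<alpha>) * G q \<omega>
          + of_real (wsgd_weight \<alpha> r p q * h powr - \<alpha>) * G r \<omega> - cis (\<omega> * x) * ((\<i> * of_real \<omega>) powr of_real \<alpha> * \<phi> \<omega>) = E \<omega>"
        unfolding scale[of \<omega>, symmetric] E_def W_def G_def by (simp add: algebra_simps)
    qed
    also have "norm \<dots> \<le> (LINT \<omega>|lborel. norm (E \<omega>))" by (rule integral_norm_bound)
    \<comment> \<open>The symbol bound supplies \<open>h powr (\<alpha> + 3)\<close>, and the
      prefactor \<open>h powr - \<alpha>\<close> leaves \<open>h ^ 3\<close>.\<close>
    also have "\<dots> \<le> (LINT \<omega>|lborel. C * h ^ 3 * (\<bar>\<omega>\<bar> powr (\<alpha> + 3) * norm (\<phi> \<omega>)))"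
    proof (rule integral_mono'[OF integrable_mult_right[OF \<phi>\<^sub>3]])
      fix \<omega>
      have "norm (E \<omega>) = h powr - \<alpha> * norm (W (\<omega> * h) * (1 - cis (- (\<omega> * h))) powr of_real \<alpha>
        - (\<i> * of_real (\<omega> * h)) powr of_real \<alpha>) * norm (\<phi> \<omega>)"
        unfolding E_def norm_mult by simp
      also have "\<dots> \<le> h powr - \<alpha> * (C * \<bar>\<omega> * h\<bar> powr (\<alpha> + 3)) * norm (\<phi> \<omega>)"
        unfolding W_def by (intro mult_right_mono mult_left_mono C) auto
      also have "\<bar>\<omega> * h\<bar> powr (\<alpha> + 3) = \<bar>\<omega>\<bar> powr (\<alpha> + 3) * h powr (\<alpha> + 3)"
        using \<open>h > 0\<close> by (simp add: abs_mult powr_mult)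
      also have "h powr - \<alpha> * (C * (\<bar>\<omega>\<bar> powr (\<alpha> + 3) * h powr (\<alpha> + 3))) * norm (\<phi> \<omega>)
        = C * (h powr - \<alpha> * h powr (\<alpha> + 3)) * (\<bar>\<omega>\<bar> powr (\<alpha> + 3) * norm (\<phi> \<omega>))"
        by (simp only: mult_ac)
      also have "h powr - \<alpha> * h powr (\<alpha> + 3) = h ^ 3"
        using \<open>h > 0\<close> by (simp add: powr_add[symmetric])
      finally show "norm (E \<omega>) \<le> C * h ^ 3 * (\<bar>\<omega>\<bar> powr (\<alpha> + 3) * norm (\<phi> \<omega>))" .
    qed (use \<open>C \<ge> 0\<close> \<open>h > 0\<close> in simp)
    also have "\<dots> = C * I * h ^ 3" by (simp add: I_def)
    finally show ?thesis .
  qed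
  then show ?thesis by blast
qed

subsection \<open>Assembling the estimate\<close>

text \<open>On \<open>{0<..1}\<close> the power is at most \<open>exp 1\<close> times the Gamma
  integrand of order \<open>\<gamma> + 1\<close>; the negative side follows by reflection.\<close>

lemma integrable_powr_near_zero:
  fixes \<gamma> :: real
  assumes "\<gamma> > -1"
  shows "integrable lborel (\<lambda>t. indicator {-1..1} t * \<bar>t\<bar> powr \<gamma>)"
proof -
  let ?g = "\<lambda>t. power_kernel (\<gamma> + 1) t * exp (- t)"
  have g: "integrable lborel ?g"
    using has_bochner_integral_power_kernel_exp[of "\<gamma> + 1"] assms by (simp add: has_bochner_integral_iff)
  then have "integrable lborel (\<lambda>t. exp 1 * (?g t + ?g (0 + (-1) * t)))"
    by (intro integrable_mult_right Bochner_Integration.integrable_add lborel_integrable_real_affine) auto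
  then show ?thesis
  proof (rule Bochner_Integration.integrable_bound)
    show "AE t in lborel. norm (indicator {-1..1} t * \<bar>t\<bar> powr \<gamma>) \<le> norm (exp 1 * (?g t + ?g (0 + (-1) * t)))"
    proof (intro AE_I2)
      fix t :: real
      consider "t = 0" | "\<bar>t\<bar> > 1" | "0 < t" "t \<le> 1" | "t < 0" "-1 \<le> t" by fastforce
      then show "norm (indicator {-1..1} t * \<bar>t\<bar> powr \<gamma>) \<le> norm (exp 1 * (?g t + ?g (0 + (-1) * t)))"
      proof cases
        case 3
        have "t powr \<gamma> * 1 \<le> t powr \<gamma> * exp (1 - t)"
          using 3 by (intro mult_left_mono) auto
        then show ?thesis using 3 by (simp add: power_kernel_def exp_diff exp_minus field_simps)
      next
        case 4
        have "(- t) powr \<gamma> * 1 \<le> (- t) powr \<gamma> * exp (1 + t)"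
          using 4 by (intro mult_left_mono) auto
        then show ?thesis using 4 by (simp add: power_kernel_def exp_add field_simps)
      qed (auto simp: indicator_def)
    qed
  qed measurable
qed

lemma integrable_powr_mult:
  fixes \<gamma> \<beta> :: real
  assumes [measurable]: "\<phi> \<in> borel_measurable borel" and M: "\<And>\<omega>. norm (\<phi> \<omega>) \<le> M"
    and int: "integrable lborel (\<lambda>\<omega>. \<bar>\<omega>\<bar> powr \<beta> * norm (\<phi> \<omega>))" and "-1 < \<gamma>" "\<gamma> \<le> \<beta>"
  shows "integrable lborel (\<lambda>\<omega>. \<bar>\<omega>\<bar> powr \<gamma> * norm (\<phi> \<omega>))"
proof (rule Bochner_Integration.integrable_bound)
  show "integrable lborel (\<lambda>\<omega>. (indicator {-1..1} \<omega> * \<bar>\<omega>\<bar> powr \<gamma>) * M + \<bar>\<omega>\<bar> powr \<beta> * norm (\<phi> \<omega>))"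
    by (intro Bochner_Integration.integrable_add integrable_mult_left integrable_powr_near_zero int assms)
  show "AE \<omega> in lborel. norm (\<bar>\<omega>\<bar> powr \<gamma> * norm (\<phi> \<omega>))
      \<le> norm ((indicator {-1..1} \<omega> * \<bar>\<omega>\<bar> powr \<gamma>) * M + \<bar>\<omega>\<bar> powr \<beta> * norm (\<phi> \<omega>))"
  proof (intro AE_I2)
    fix \<omega> :: real
    have "0 \<le> M" using order_trans[OF norm_ge_zero M] .
    show "norm (\<bar>\<omega>\<bar> powr \<gamma> * norm (\<phi> \<omega>))
      \<le> norm ((indicator {-1..1} \<omega> * \<bar>\<omega>\<bar> powr \<gamma>) * M + \<bar>\<omega>\<bar> powr \<beta> * norm (\<phi> \<omega>))"
    proof (cases "\<bar>\<omega>\<bar> \<le> 1")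
      case True
      have "\<bar>\<omega>\<bar> powr \<gamma> * norm (\<phi> \<omega>) \<le> \<bar>\<omega>\<bar> powr \<gamma> * M + \<bar>\<omega>\<bar> powr \<beta> * norm (\<phi> \<omega>)"
        using mult_left_mono[OF M[of \<omega>], of "\<bar>\<omega>\<bar> powr \<gamma>"] by (simp add: add_increasing2)
      moreover have "indicator {-1..1} \<omega> = (1::real)" using True by (auto simp: indicator_def)
      ultimately show ?thesis using \<open>0 \<le> M\<close> by simp
    next
      case False
      then have "\<bar>\<omega>\<bar> powr \<gamma> \<le> \<bar>\<omega>\<bar> powr \<beta>" using assms by (intro powr_mono) auto
      moreover have "indicator {-1..1} \<omega> = (0::real)" using False by (auto simp: indicator_def)
      ultimately show ?thesis by (simp add: mult_right_mono)
    qed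
  qed
qed measurable

section \<open>Complex powers on the imaginary axis\<close>

lemma i_powr_measurable [measurable]:
  "(\<lambda>\<omega>. (\<i> * of_real \<omega>) powr of_real \<gamma>) \<in> borel_measurable borel"
proof -
  have eq: "(\<lambda>\<omega>. (\<i> * of_real \<omega>) powr of_real \<gamma>)
     = (\<lambda>\<omega>. if \<omega> = 0 then 0 else exp (of_real \<gamma> * (of_real (ln \<bar>\<omega>\<bar>) + \<i> * of_real (sgn \<omega> * pi / 2))))"
    by (simp add: fun_eq_iff powr_def Ln_i_times)
  show ?thesis unfolding eq by measurable
qed

lemma integrable_i_powr_mult:
  assumes "\<phi> \<in> borel_measurable borel" "\<And>\<omega>. norm (\<phi> \<omega>) \<le> M"
    and "integrable lborel (\<lambda>\<omega>. \<bar>\<omega>\<bar> powr \<beta> * norm (\<phi> \<omega>))" and "-1 < \<gamma>" "\<gamma> \<le> \<beta>"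
  shows "integrable lborel (\<lambda>\<omega>. (\<i> * of_real \<omega>) powr of_real \<gamma> * \<phi> \<omega>)"
  using assms(1)
  by (intro Bochner_Integration.integrable_bound[OF integrable_powr_mult[OF assms]])
     (auto simp: norm_mult norm_i_times_powr)

lemma i_power_powr:
  "\<omega> \<noteq> 0 \<Longrightarrow> (\<i> * of_real \<omega>) ^ n * (\<i> * of_real \<omega>) powr of_real \<gamma> = (\<i> * of_real \<omega>) powr of_real (real n + \<gamma>)"
  by (simp add: powr_add powr_nat')

text \<open>Positivity of \<open>n\<close> matters at \<omega> = 0: \<open>0 ^ 0\<close> is 1 while
  \<open>0 powr 0\<close> is 0.\<close>

lemma i_power_eq_powr:
  "n > 0 \<Longrightarrow> (\<i> * of_real \<omega>) ^ n = (\<i> * of_real \<omega>) powr of_real (real n)"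
  by (simp add: powr_nat')

lemma ift_cong_nonzero:
  assumes "\<And>\<omega>. \<omega> \<noteq> 0 \<Longrightarrow> \<phi> \<omega> = \<psi> \<omega>" and [measurable]: "\<phi> \<in> borel_measurable borel" "\<psi> \<in> borel_measurable borel"
  shows "ift \<phi> = ift \<psi>"
proof
  fix x
  have "AE \<omega> in lborel. cis (\<omega> * x) * \<phi> \<omega> = cis (\<omega> * x) * \<psi> \<omega>"
    using AE_lborel_singleton[of 0] by eventually_elim (simp add: assms)
  then show "ift \<phi> x = ift \<psi> x"
    unfolding ift_def by (intro integral_cong_AE) auto
qed

section \<open>Borel representatives and measurability\<close>

lemma ex_borel_measurable_complex:
  fixes u :: "real \<Rightarrow> complex"
  assumes "u \<in> borel_measurable lebesgue"
  shows "\<exists>f\<in>borel_measurable borel. AE x in lborel. u x = f x"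
proof -
  have re: "(\<lambda>x. Re (u x)) \<in> borel_measurable lebesgue" and im: "(\<lambda>x. Im (u x)) \<in> borel_measurable lebesgue"
    using assms unfolding borel_measurable_complex_iff by blast+
  obtain a where a: "a \<in> borel_measurable lborel" "AE x in lborel. Re (u x) = a x"
    using completion_ex_borel_measurable_real[OF re] by blast
  obtain b where b: "b \<in> borel_measurable lborel" "AE x in lborel. Im (u x) = b x"
    using completion_ex_borel_measurable_real[OF im] by blast
  from a(2) b(2) have "AE x in lborel. u x = of_real (a x) + \<i> * of_real (b x)"
    by eventually_elim (simp add: complex_eq_iff)
  moreover have "(\<lambda>x. complex_of_real (a x) + \<i> * complex_of_real (b x)) \<in> borel_measurable borel"
    using a(1) b(1) by simp
  ultimately show ?thesis by (rule bexI)
qed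

lemma fourier_eq_ft:
  assumes "f \<in> borel_measurable borel"
  shows "fourier f = ft f"
proof
  fix \<omega>
  have "fourier f \<omega> = (LINT x|lebesgue. cis (- (\<omega> * x)) * f x)"
    by (simp add: fourier_def cis_conv_exp)
  also have "\<dots> = ft f \<omega>"
    unfolding ft_def using assms by (intro integral_completion) simp
  finally show "fourier f \<omega> = ft f \<omega>" .
qed

text \<open>The derivative is a pointwise limit of difference quotients of a continuous function,
  along the steps \<open>1 / (n + 1)\<close>.\<close>

lemma vector_derivative_measurable:
  fixes f :: "real \<Rightarrow> complex"
  assumes "\<And>x. f differentiable (at x)"
  shows "(\<lambda>x. vector_derivative f (at x)) \<in> borel_measurable borel"
proof (rule borel_measurable_LIMSEQ_metric)
  have "continuous_on UNIV f"
    using assms by (intro continuous_at_imp_continuous_on) (auto intro: differentiable_imp_continuous_within)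
  then have [measurable]: "f \<in> borel_measurable borel" by (rule borel_measurable_continuous_onI)
  show "(\<lambda>x. (f (x + 1 / (real n + 1)) - f x) /\<^sub>R (1 / (real n + 1))) \<in> borel_measurable borel" for n
    by measurable
  fix x
  have "(f has_vector_derivative vector_derivative f (at x)) (at x)"
    using assms vector_derivative_works by blast
  then have lim: "((\<lambda>y. (f y - f x) /\<^sub>R (y - x)) \<longlongrightarrow> vector_derivative f (at x)) (at x)"
    unfolding has_vector_derivative_iff_quotient .
  have "filterlim (\<lambda>n. x + 1 / (real n + 1)) (at x) sequentially"
  proof (rule filterlim_atI)
    show "(\<lambda>n. x + 1 / (real n + 1)) \<longlonglongrightarrow> x" by real_asymp
  qed simp
  from filterlim_compose[OF lim this]
  show "(\<lambda>n. (f (x + 1 / (real n + 1)) - f x) /\<^sub>R (1 / (real n + 1))) \<longlonglongrightarrow> vector_derivative f (at x)"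
    by simp
qed

lemma nth_deriv_measurable:
  assumes "n_times_differentiable n f" "n > 0"
  shows "nth_deriv n f \<in> borel_measurable borel"
proof -
  obtain m where n: "n = Suc m" using \<open>n > 0\<close> by (cases n) auto
  have "nth_deriv n f = (\<lambda>x. vector_derivative (nth_deriv m f) (at x))"
    by (simp add: n fun_eq_iff nth_deriv_Suc')
  then show ?thesis
    using assms by (auto intro!: vector_derivative_measurable simp: n_times_differentiable_def n)
qed

text \<open>The set where two continuous functions differ is open, and a nonempty open set is not
  negligible.\<close>

lemma continuous_AE_eq_imp_eq:
  fixes f g :: "real \<Rightarrow> complex"
  assumes "continuous_on UNIV f" "continuous_on UNIV g" "AE x in lborel. f x = g x"
  shows "f = g"
proof -
  have "open {x. f x \<noteq> g x}"
    using assms(1,2) by (rule open_Collect_neq)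
  moreover have "AE x in lebesgue. x \<notin> {x. f x \<noteq> g x}"
    using assms(3) by (simp add: AE_completion)
  then have "negligible {x. f x \<noteq> g x}"
    unfolding negligible_iff_null_sets by (subst AE_iff_null_sets) (use \<open>open _\<close> in auto)
  ultimately have "{x. f x \<noteq> g x} = {}"
    using open_not_negligible by blast
  then show ?thesis by auto
qed

text \<open>For each fixed \<open>x\<close> the integral ignores null sets, so \<open>u\<close> may
  be replaced by its Borel representative at every point \<open>x\<close>; the reflection
  \<open>\<xi> = x - t\<close> does the rest.\<close>

lemma rl_integral_eq_frac_int:
  fixes \<gamma> :: real
  defines "\<sigma> \<equiv> real (nat \<lceil>\<gamma>\<rceil>) - \<gamma>"
  assumes u: "u \<in> borel_measurable lebesgue" and f: "f \<in> borel_measurable borel" and uf: "AE x in lborel. u x = f x"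
  shows "set_integrable lebesgue {..<x} (rl_integrand \<gamma> u x) \<longleftrightarrow> integrable lborel (\<lambda>t. f (x - t) * ckernel \<sigma> t)"
    and "rl_integral \<gamma> u x = frac_int \<sigma> f x"
proof -
  note [measurable] = f
  define H where "H \<xi> = f \<xi> * ckernel \<sigma> (x - \<xi>)" for \<xi>
  have [measurable]: "H \<in> borel_measurable borel" unfolding H_def[abs_def] by measurable
  have ae: "AE \<xi> in lebesgue. indicator {..<x} \<xi> *\<^sub>R rl_integrand \<gamma> u x \<xi> = H \<xi>"
  proof -
    have "AE \<xi> in lborel. indicator {..<x} \<xi> *\<^sub>R rl_integrand \<gamma> u x \<xi> = H \<xi>"
      using uf
    proof eventually_elim
      case (elim \<xi>)
      have "(x - \<xi>) powr (\<sigma> - 1) = inverse ((x - \<xi>) powr (\<gamma> - real (nat \<lceil>\<gamma>\<rceil>) + 1))"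
        by (simp add: \<sigma>_def flip: powr_minus)
      with elim show ?case
        by (auto simp: rl_integrand_def H_def ckernel_def power_kernel_def indicator_def scaleR_conv_of_real)
    qed
    then show ?thesis by (rule AE_completion)
  qed
  have meas: "(\<lambda>\<xi>. indicator {..<x} \<xi> *\<^sub>R rl_integrand \<gamma> u x \<xi>) \<in> borel_measurable lebesgue"
  proof -
    have "(\<lambda>\<xi>. inverse ((x - \<xi>) powr (\<gamma> - real (nat \<lceil>\<gamma>\<rceil>) + 1))) \<in> borel_measurable borel" by measurable
    then have "(\<lambda>\<xi>. inverse ((x - \<xi>) powr (\<gamma> - real (nat \<lceil>\<gamma>\<rceil>) + 1))) \<in> borel_measurable lebesgue"
      by (intro measurable_completion) simp
    moreover have "(indicator {..<x} :: real \<Rightarrow> real) \<in> borel_measurable lebesgue"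
      by (intro measurable_completion) simp
    ultimately show ?thesis
      unfolding rl_integrand_def using u by (intro borel_measurable_scaleR)
  qed
  have H_leb: "H \<in> borel_measurable lebesgue"
    by (intro measurable_completion) simp
  have affine: "H (x + (-1) * t) = f (x - t) * ckernel \<sigma> t" for t
    by (simp add: H_def)
  have "set_integrable lebesgue {..<x} (rl_integrand \<gamma> u x) \<longleftrightarrow> integrable lebesgue H"
    unfolding set_integrable_def by (rule integrable_cong_AE[OF meas H_leb ae])
  also have "\<dots> \<longleftrightarrow> integrable lborel H"
    by (intro integrable_completion) simp
  also have "\<dots> \<longleftrightarrow> integrable lborel (\<lambda>t. f (x - t) * ckernel \<sigma> t)"
    using lborel_integrable_real_affine_iff[of "-1" H x] unfolding affine by simp
  finally show "set_integrable lebesgue {..<x} (rl_integrand \<gamma> u x) \<longleftrightarrow> integrable lborel (\<lambda>t. f (x - t) * ckernel \<sigma> t)" .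
  have "rl_integral \<gamma> u x = integral\<^sup>L lebesgue H"
    unfolding rl_integral_def set_lebesgue_integral_def by (rule integral_cong_AE[OF meas H_leb ae])
  also have "\<dots> = integral\<^sup>L lborel H"
    by (intro integral_completion) simp
  also have "\<dots> = frac_int \<sigma> f x"
    using lborel_integral_real_affine[of "-1" H x] unfolding affine frac_int_def by simp
  finally show "rl_integral \<gamma> u x = frac_int \<sigma> f x" .
qed

lemma n_times_differentiable_mono:
  "n_times_differentiable n f \<Longrightarrow> m \<le> n \<Longrightarrow> n_times_differentiable m f"
  by (simp add: n_times_differentiable_def)

lemma ift_cmult: "ift (\<lambda>\<omega>. c * \<phi> \<omega>) x = c * ift \<phi> x"
  unfolding ift_def by (simp add: mult.left_commute)

text \<open>Collects what depends on whether \<alpha> is an integer. In the integer case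
  \<open>u\<close> is itself continuous; otherwise it enters only through its fractional integral.
  The last claim takes an inverse representation as a premise because inversion becomes available
  only after the second claim has given decay of \<open>ft f\<close>.\<close>

lemma rl_deriv_representation:
  fixes \<alpha> :: real and u f :: "real \<Rightarrow> complex"
  assumes "\<alpha> > 0" and u: "u \<in> borel_measurable lebesgue" and f: "integrable lborel f" and uf: "AE x in lborel. u x = f x"
    and diff: "rl_differentiable (\<alpha> + 3) u"
    and g: "integrable lebesgue (rl_deriv (\<alpha> + 3) u)"
  shows "rl_deriv (\<alpha> + 3) u \<in> borel_measurable borel"
    and "\<omega> \<noteq> 0 \<Longrightarrow> ft (rl_deriv (\<alpha> + 3) u) \<omega> = (\<i> * of_real \<omega>) powr of_real (\<alpha> + 3) * ft f \<omega>"
    and "rl_differentiable \<alpha> u"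
    and "\<And>\<psi>. \<psi> \<in> borel_measurable borel \<Longrightarrow> AE x in lborel. f x = ift \<psi> x \<Longrightarrow>
       (\<And>\<gamma>. -1 < \<gamma> \<Longrightarrow> \<gamma> \<le> \<alpha> + 3 \<Longrightarrow> integrable lborel (\<lambda>\<omega>. (\<i> * of_real \<omega>) powr of_real \<gamma> * \<psi> \<omega>)) \<Longrightarrow>
       integrable lborel \<psi> \<Longrightarrow>
       rl_deriv \<alpha> u = ift (\<lambda>\<omega>. (\<i> * of_real \<omega>) powr of_real \<alpha> * \<psi> \<omega>)"
proof -
  define m where "m = nat \<lceil>\<alpha>\<rceil>"
  have "m > 0" using \<open>\<alpha> > 0\<close> by (simp add: m_def)
  have m3: "nat \<lceil>\<alpha> + 3\<rceil> = m + 3" "nat (\<lceil>\<alpha>\<rceil> + 3) = m + 3"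
    using \<open>\<alpha> > 0\<close> by (simp_all add: m_def nat_add_distrib)
  \<comment> \<open>Orders \<alpha> and \<alpha> + 3 fall into the same case and have the same
    \<sigma>, so they are derivatives of the same function, of orders \<open>m\<close> and
    \<open>m + 3\<close>.\<close>
  have Ints_iff: "\<alpha> + 3 \<in> \<int> \<longleftrightarrow> \<alpha> \<in> \<int>"
    using Ints_add[of \<alpha> 3] Ints_diff[of "\<alpha> + 3" 3] by auto
  have [measurable]: "f \<in> borel_measurable borel" using f by auto
  have "rl_deriv (\<alpha> + 3) u \<in> borel_measurable borel \<and>
    (\<forall>\<omega>. \<omega> \<noteq> 0 \<longrightarrow> ft (rl_deriv (\<alpha> + 3) u) \<omega> = (\<i> * of_real \<omega>) powr of_real (\<alpha> + 3) * ft f \<omega>) \<and>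
    rl_differentiable \<alpha> u \<and>
    (\<forall>\<psi>. \<psi> \<in> borel_measurable borel \<longrightarrow> (AE x in lborel. f x = ift \<psi> x) \<longrightarrow>
       (\<forall>\<gamma>. -1 < \<gamma> \<longrightarrow> \<gamma> \<le> \<alpha> + 3 \<longrightarrow> integrable lborel (\<lambda>\<omega>. (\<i> * of_real \<omega>) powr of_real \<gamma> * \<psi> \<omega>)) \<longrightarrow>
       integrable lborel \<psi> \<longrightarrow>
       rl_deriv \<alpha> u = ift (\<lambda>\<omega>. (\<i> * of_real \<omega>) powr of_real \<alpha> * \<psi> \<omega>))"
  proof (cases "\<alpha> \<in> \<int>")
    case True
    have \<alpha>: "\<alpha> = real m"
      using True \<open>\<alpha> > 0\<close> by (auto simp: m_def elim!: Ints_cases)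
    have g_eq: "rl_deriv (\<alpha> + 3) u = nth_deriv (m + 3) u"
      using True by (simp add: rl_deriv_def[abs_def] Ints_iff m3)
    have ndiff: "n_times_differentiable (m + 3) u"
      using diff True by (simp add: rl_differentiable_def Ints_iff m3)
    then have "u differentiable (at x)" for x
      using n_times_differentiable_Suc[of "m + 2" u] by (simp add: numeral_eq_Suc)
    then have u_cont: "continuous_on UNIV u"
      by (intro continuous_at_imp_continuous_on) (auto intro: differentiable_imp_continuous_within)
    then have [measurable]: "u \<in> borel_measurable borel"
      by (rule borel_measurable_continuous_onI)
    have u_int: "integrable lborel u"
      using f uf by (subst integrable_cong_AE[of _ _ f]) auto
    have ft_u: "ft u = ft f"
    proof
      fix \<omega>
      show "ft u \<omega> = ft f \<omega>"
        unfolding ft_def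
      proof (intro integral_cong_AE)
        show "AE x in lborel. cis (- (\<omega> * x)) * u x = cis (- (\<omega> * x)) * f x"
          using uf by eventually_elim simp
      qed auto
    qed
    have g_meas: "nth_deriv (m + 3) u \<in> borel_measurable borel"
      by (rule nth_deriv_measurable[OF ndiff]) simp
    have g_int: "integrable lborel (nth_deriv (m + 3) u)"
      using g g_meas unfolding g_eq by (simp add: integrable_completion)
    show ?thesis
    proof (intro conjI allI impI)
      show "rl_deriv (\<alpha> + 3) u \<in> borel_measurable borel" unfolding g_eq by (rule g_meas)
      show "rl_differentiable \<alpha> u"
        using n_times_differentiable_mono[OF ndiff, of m] True by (simp add: rl_differentiable_def m_def)
    next
      fix \<omega> :: real assume "\<omega> \<noteq> 0"
      from ft_nth_deriv[OF ndiff g_int u_int this]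
      show "ft (rl_deriv (\<alpha> + 3) u) \<omega> = (\<i> * of_real \<omega>) powr of_real (\<alpha> + 3) * ft f \<omega>"
        unfolding g_eq ft_u using i_power_eq_powr[of "m + 3" \<omega>] by (simp add: \<alpha>)
    next
      fix \<psi> assume [measurable]: "\<psi> \<in> borel_measurable borel" and inv: "AE x in lborel. f x = ift \<psi> x"
        and int: "\<forall>\<gamma>. -1 < \<gamma> \<longrightarrow> \<gamma> \<le> \<alpha> + 3 \<longrightarrow> integrable lborel (\<lambda>\<omega>. (\<i> * of_real \<omega>) powr of_real \<gamma> * \<psi> \<omega>)"
        and \<psi>: "integrable lborel \<psi>"
      from uf inv have "AE x in lborel. u x = ift \<psi> x" by eventually_elim simp
      \<comment> \<open>The equality is upgraded from almost everywhere to everywhere by continuity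
        of both sides.\<close>
      then have u_eq: "u = ift \<psi>"
        by (rule continuous_AE_eq_imp_eq[OF u_cont continuous_on_ift[OF \<psi>]])
      \<comment> \<open>The exponent 0 is treated apart because of the differing values of
        \<open>^\<close> and \<open>powr\<close> at 0.\<close>
      have "integrable lborel (\<lambda>\<omega>. (\<i> * of_real \<omega>) ^ j * \<psi> \<omega>)" if "j \<le> m" for j
      proof (cases "j = 0")
        case False
        then show ?thesis
          using int[rule_format, of "real j"] that by (simp add: i_power_eq_powr \<alpha>)
      qed (simp add: \<psi>)
      then have "nth_deriv m u = ift (\<lambda>\<omega>. (\<i> * of_real \<omega>) ^ m * \<psi> \<omega>)"
        unfolding u_eq using nth_deriv_ift by blast
      then show "rl_deriv \<alpha> u = ift (\<lambda>\<omega>. (\<i> * of_real \<omega>) powr of_real \<alpha> * \<psi> \<omega>)"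
        using True \<open>m > 0\<close> by (simp add: rl_deriv_def[abs_def] i_power_eq_powr flip: m_def) (simp add: \<alpha>)
    qed
  next
    case False
    define \<sigma> where "\<sigma> = real m - \<alpha>"
    have "\<lceil>\<alpha>\<rceil> \<noteq> \<alpha>" using False by (metis Ints_of_int)
    then have "\<alpha> < \<lceil>\<alpha>\<rceil>" using le_of_int_ceiling[of \<alpha>] by linarith
    then have \<sigma>: "0 < \<sigma>" "\<sigma> < 1"
      using \<open>\<alpha> > 0\<close> ceiling_correct[of \<alpha>] by (auto simp: \<sigma>_def m_def)
    have G: "Gamma \<sigma> > 0" using \<sigma> by (simp add: Gamma_real_pos)
    have sig3: "real (nat \<lceil>\<alpha> + 3\<rceil>) - (\<alpha> + 3) = \<sigma>" by (simp add: m3 \<sigma>_def)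
    have sig: "real (nat \<lceil>\<alpha>\<rceil>) - \<alpha> = \<sigma>" by (simp add: m_def \<sigma>_def)
    note rl3 = rl_integral_eq_frac_int[where \<gamma> = "\<alpha> + 3" and u = u and f = f, unfolded sig3, OF u _ uf]
    note rl = rl_integral_eq_frac_int[where \<gamma> = \<alpha> and u = u and f = f, unfolded sig, OF u _ uf]
    have rl3_eq: "rl_integral (\<alpha> + 3) u = frac_int \<sigma> f" and rl_eq: "rl_integral \<alpha> u = frac_int \<sigma> f"
      using rl3(2) rl(2) by (auto simp: fun_eq_iff)
    have g_eq: "rl_deriv (\<alpha> + 3) u = (\<lambda>x. nth_deriv (m + 3) (frac_int \<sigma> f) x /\<^sub>R Gamma \<sigma>)"
      using False unfolding rl_deriv_def[abs_def] by (simp add: Ints_iff rl3_eq m3 sig3[unfolded m3] cong: if_cong) (simp add: \<sigma>_def)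
    have int: "integrable lborel (\<lambda>t. f (x - t) * ckernel \<sigma> t)" for x
      using diff False rl3(1) by (simp add: rl_differentiable_def Ints_iff)
    have ndiff: "n_times_differentiable (m + 3) (frac_int \<sigma> f)"
      using diff False by (simp add: rl_differentiable_def Ints_iff m3 rl3_eq)
    have g_meas: "nth_deriv (m + 3) (frac_int \<sigma> f) \<in> borel_measurable borel"
      by (rule nth_deriv_measurable[OF ndiff]) simp
    then have g_meas': "rl_deriv (\<alpha> + 3) u \<in> borel_measurable borel"
      unfolding g_eq by simp
    have "integrable lborel (rl_deriv (\<alpha> + 3) u)"
      using g g_meas' by (simp add: integrable_completion)
    then have "integrable lborel (\<lambda>x. Gamma \<sigma> *\<^sub>R rl_deriv (\<alpha> + 3) u x)"
      by simp
    then have g_int: "integrable lborel (nth_deriv (m + 3) (frac_int \<sigma> f))"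
      unfolding g_eq using G by simp
    show ?thesis
    proof (intro conjI allI impI)
      show "rl_deriv (\<alpha> + 3) u \<in> borel_measurable borel" by (rule g_meas')
      show "rl_differentiable \<alpha> u"
        using n_times_differentiable_mono[OF ndiff, of m] False int rl(1)
        by (simp add: rl_differentiable_def rl_eq flip: m_def)
    next
      fix \<omega> :: real assume "\<omega> \<noteq> 0"
      have "ft (rl_deriv (\<alpha> + 3) u) \<omega> = ft (nth_deriv (m + 3) (frac_int \<sigma> f)) \<omega> /\<^sub>R Gamma \<sigma>"
        unfolding g_eq ft_def by simp
      also have "\<dots> = ((\<i> * of_real \<omega>) ^ (m + 3) * (\<i> * of_real \<omega>) powr of_real (- \<sigma>)) * ft f \<omega>"
        using G ft_nth_deriv_frac_int[OF f int \<sigma> _ ndiff g_int \<open>\<omega> \<noteq> 0\<close>]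
        by (simp add: Gamma_complex_of_real scaleR_conv_of_real)
      also have "(\<i> * of_real \<omega>) ^ (m + 3) * (\<i> * of_real \<omega>) powr of_real (- \<sigma>) = (\<i> * of_real \<omega>) powr of_real (\<alpha> + 3)"
        unfolding i_power_powr[OF \<open>\<omega> \<noteq> 0\<close>] by (simp add: \<sigma>_def add.commute)
      finally show "ft (rl_deriv (\<alpha> + 3) u) \<omega> = (\<i> * of_real \<omega>) powr of_real (\<alpha> + 3) * ft f \<omega>" .
    next
      fix \<psi> assume [measurable]: "\<psi> \<in> borel_measurable borel" and inv: "AE x in lborel. f x = ift \<psi> x"
        and \<psi>_int: "\<forall>\<gamma>. -1 < \<gamma> \<longrightarrow> \<gamma> \<le> \<alpha> + 3 \<longrightarrow> integrable lborel (\<lambda>\<omega>. (\<i> * of_real \<omega>) powr of_real \<gamma> * \<psi> \<omega>)"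
        and \<psi>: "integrable lborel \<psi>"
      define \<rho> where "\<rho> \<omega> = Gamma (of_real \<sigma>) * ((\<i> * of_real \<omega>) powr (- of_real \<sigma>) * \<psi> \<omega>)" for \<omega>
      have base: "integrable lborel (\<lambda>\<omega>. (\<i> * of_real \<omega>) powr (- of_real \<sigma>) * \<psi> \<omega>)"
        using \<psi>_int[rule_format, of "- \<sigma>"] \<sigma> \<open>\<alpha> > 0\<close> by simp
      have [measurable]: "\<rho> \<in> borel_measurable borel"
        unfolding \<rho>_def[abs_def] by (rule borel_measurable_times[OF borel_measurable_const]) (use base in auto)
      have frac_eq: "frac_int \<sigma> f = ift \<rho>"
        unfolding \<rho>_def[abs_def] using frac_int_ift[OF int _ inv \<psi> base \<sigma>(1)] by (auto simp: fun_eq_iff)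
      have \<rho>_eq: "(\<i> * of_real \<omega>) ^ j * \<rho> \<omega> = Gamma (of_real \<sigma>) * ((\<i> * of_real \<omega>) powr of_real (real j - \<sigma>) * \<psi> \<omega>)"
        if "\<omega> \<noteq> 0" for j \<omega>
      proof -
        have "(\<i> * of_real \<omega>) ^ j * \<rho> \<omega> = Gamma (of_real \<sigma>) * ((\<i> * of_real \<omega>) ^ j * (\<i> * of_real \<omega>) powr of_real (- \<sigma>) * \<psi> \<omega>)"
          by (simp add: \<rho>_def mult_ac)
        then show ?thesis unfolding i_power_powr[OF that] by simp
      qed
      \<comment> \<open>The exponents \<open>real j - \<sigma>\<close> lie between
        \<open>- \<sigma> > -1\<close> and \<open>real m - \<sigma> = \<alpha>\<close>, inside the
        admissible range.\<close>
      have \<rho>_int: "integrable lborel (\<lambda>\<omega>. (\<i> * of_real \<omega>) ^ j * \<rho> \<omega>)" if "j \<le> m" for j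
      proof -
        have "integrable lborel (\<lambda>\<omega>. Gamma (of_real \<sigma>) * ((\<i> * of_real \<omega>) powr of_real (real j - \<sigma>) * \<psi> \<omega>))"
          using that \<sigma> by (intro integrable_mult_right \<psi>_int[rule_format]) (auto simp: \<sigma>_def)
        moreover have "AE \<omega> in lborel. Gamma (of_real \<sigma>) * ((\<i> * of_real \<omega>) powr of_real (real j - \<sigma>) * \<psi> \<omega>) = (\<i> * of_real \<omega>) ^ j * \<rho> \<omega>"
          using AE_lborel_singleton[of 0] by eventually_elim (rule \<rho>_eq[symmetric])
        moreover from calculation(1) have "(\<lambda>\<omega>. Gamma (of_real \<sigma>) * ((\<i> * of_real \<omega>) powr of_real (real j - \<sigma>) * \<psi> \<omega>)) \<in> borel_measurable lborel"
          by auto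
        moreover have "(\<lambda>\<omega>. (\<i> * of_real \<omega>) ^ j * \<rho> \<omega>) \<in> borel_measurable lborel" by simp
        ultimately show ?thesis using integrable_cong_AE by blast
      qed
      have "nth_deriv m (frac_int \<sigma> f) = ift (\<lambda>\<omega>. (\<i> * of_real \<omega>) ^ m * \<rho> \<omega>)"
        unfolding frac_eq using nth_deriv_ift[OF \<rho>_int] by blast
      also have "\<dots> = ift (\<lambda>\<omega>. Gamma (of_real \<sigma>) * ((\<i> * of_real \<omega>) powr of_real \<alpha> * \<psi> \<omega>))"
      proof (rule ift_cong_nonzero)
        show "(\<i> * of_real \<omega>) ^ m * \<rho> \<omega> = Gamma (of_real \<sigma>) * ((\<i> * of_real \<omega>) powr of_real \<alpha> * \<psi> \<omega>)"
          if "\<omega> \<noteq> 0" for \<omega>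
          unfolding \<rho>_eq[OF that] by (simp add: \<sigma>_def)
      qed measurable
      finally have eq: "nth_deriv m (frac_int \<sigma> f) x = Gamma (of_real \<sigma>) * ift (\<lambda>\<omega>. (\<i> * of_real \<omega>) powr of_real \<alpha> * \<psi> \<omega>) x" for x
        by (simp add: ift_cmult)
      show "rl_deriv \<alpha> u = ift (\<lambda>\<omega>. (\<i> * of_real \<omega>) powr of_real \<alpha> * \<psi> \<omega>)"
      proof
        fix x
        have "rl_deriv \<alpha> u x = nth_deriv m (frac_int \<sigma> f) x /\<^sub>R Gamma \<sigma>"
          using False by (simp add: rl_deriv_def rl_eq sig flip: m_def) (simp add: \<sigma>_def)
        then show "rl_deriv \<alpha> u x = ift (\<lambda>\<omega>. (\<i> * of_real \<omega>) powr of_real \<alpha> * \<psi> \<omega>) x"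
          using G unfolding eq by (simp add: Gamma_complex_of_real scaleR_conv_of_real)
      qed
    qed
  qed
  then show "rl_deriv (\<alpha> + 3) u \<in> borel_measurable borel"
    and "\<omega> \<noteq> 0 \<Longrightarrow> ft (rl_deriv (\<alpha> + 3) u) \<omega> = (\<i> * of_real \<omega>) powr of_real (\<alpha> + 3) * ft f \<omega>"
    and "rl_differentiable \<alpha> u"
    and "\<And>\<psi>. \<psi> \<in> borel_measurable borel \<Longrightarrow> AE x in lborel. f x = ift \<psi> x \<Longrightarrow>
       (\<And>\<gamma>. -1 < \<gamma> \<Longrightarrow> \<gamma> \<le> \<alpha> + 3 \<Longrightarrow> integrable lborel (\<lambda>\<omega>. (\<i> * of_real \<omega>) powr of_real \<gamma> * \<psi> \<omega>)) \<Longrightarrow>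
       integrable lborel \<psi> \<Longrightarrow>
       rl_deriv \<alpha> u = ift (\<lambda>\<omega>. (\<i> * of_real \<omega>) powr of_real \<alpha> * \<psi> \<omega>)"
    by blast+
qed

theorem theorem3:
  fixes \<alpha> :: real and p q r :: int and u :: "real \<Rightarrow> complex"
  assumes "\<alpha> > 0"
    and "p \<noteq> q" and "p \<noteq> r" and "q \<noteq> r"
    and "integrable lebesgue u"
    and "rl_differentiable (\<alpha> + 3) u"
    and "integrable lebesgue (rl_deriv (\<alpha> + 3) u)"
    and "integrable lebesgue (fourier (rl_deriv (\<alpha> + 3) u))"
  shows "rl_differentiable \<alpha> u \<and>
    (\<exists>v. continuous_on UNIV v \<and> (AE x in lebesgue. v x = u x) \<and>
      (\<forall>h>0. \<forall>s x. summable (gruenwald_term \<alpha> h s v x)) \<and>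
      (\<exists>C. \<forall>\<^sub>F h in at_right 0. \<forall>x.
         norm (wsgd \<alpha> p q r h v x - rl_deriv \<alpha> u x) \<le> C * h ^ 3))"
proof -
  have u_meas: "u \<in> borel_measurable lebesgue" using assms(5) by auto
  obtain f where f_meas [measurable]: "f \<in> borel_measurable borel" and uf: "AE x in lborel. u x = f x"
    using ex_borel_measurable_complex[OF u_meas] by blast
  have "integrable lebesgue f"
    using assms(5) u_meas AE_completion[OF uf] measurable_completion[of f lborel borel]
    by (subst integrable_cong_AE[of f _ u]) (auto elim: eventually_mono)
  then have f: "integrable lborel f" by (simp add: integrable_completion)
  define g where "g = rl_deriv (\<alpha> + 3) u"
  define \<phi> where "\<phi> = ft f"
  note repr = rl_deriv_representation[OF assms(1) u_meas f uf assms(6,7)]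
  have g_meas: "g \<in> borel_measurable borel" unfolding g_def by (rule repr(1))
  have g_int: "integrable lborel g"
    using assms(7) g_meas by (simp add: g_def integrable_completion)
  have ft_g_int: "integrable lborel (ft g)"
    using assms(8) ft_measurable[OF g_int] fourier_eq_ft[OF g_meas] by (simp add: g_def integrable_completion)
  have [measurable]: "\<phi> \<in> borel_measurable borel"
    unfolding \<phi>_def by (rule ft_measurable[OF f])
  have bound: "norm (\<phi> \<omega>) \<le> (LINT x|lborel. norm (f x))" for \<omega>
    unfolding \<phi>_def by (rule norm_ft_le)
  \<comment> \<open>This is where integrability of the transform of the top derivative enters: away
    from 0 its norm is exactly this weighted norm of \<open>\<phi>\<close>.\<close>
  have \<phi>\<^sub>3: "integrable lborel (\<lambda>\<omega>. \<bar>\<omega>\<bar> powr (\<alpha> + 3) * norm (\<phi> \<omega>))"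
  proof -
    have "AE \<omega> in lborel. norm (ft g \<omega>) = \<bar>\<omega>\<bar> powr (\<alpha> + 3) * norm (\<phi> \<omega>)"
      using AE_lborel_singleton[of 0]
    proof eventually_elim
      case (elim \<omega>)
      show ?case
        unfolding g_def repr(2)[OF elim] \<phi>_def norm_mult norm_i_times_powr ..
    qed
    moreover have "(\<lambda>\<omega>. norm (ft g \<omega>)) \<in> borel_measurable lborel"
      using ft_g_int by auto
    ultimately show ?thesis
      using integrable_norm[OF ft_g_int] by (subst integrable_cong_AE[of _ _ "\<lambda>\<omega>. norm (ft g \<omega>)"]) auto
  qed
  have powr_int: "integrable lborel (\<lambda>\<omega>. (\<i> * of_real \<omega>) powr of_real \<gamma> * \<phi> \<omega>)" if "-1 < \<gamma>" "\<gamma> \<le> \<alpha> + 3" for \<gamma>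
    by (rule integrable_i_powr_mult[OF _ bound \<phi>\<^sub>3 that]) simp
  \<comment> \<open>The exponent 0 is admissible, and the corresponding power is 1 except at the
    single point 0.\<close>
  have \<phi>_int: "integrable lborel \<phi>"
  proof -
    have "AE \<omega> in lborel. (\<i> * of_real \<omega>) powr of_real 0 * \<phi> \<omega> = \<phi> \<omega>"
      using AE_lborel_singleton[of 0] by eventually_elim simp
    then show ?thesis
      using powr_int[of 0] assms(1) integrable_cong_AE[of "\<lambda>\<omega>. (\<i> * of_real \<omega>) powr of_real 0 * \<phi> \<omega>" lborel \<phi>] by auto
  qed
  \<comment> \<open>The inversion constant is moved into \<open>\<psi>\<close>, so that
    \<open>ift \<psi>\<close> is the continuous representative \<open>v\<close> of the
    claim.\<close>
  define c where "c = complex_of_real (1 / (2 * pi))"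
  define \<psi> where "\<psi> \<omega> = c * \<phi> \<omega>" for \<omega>
  have \<psi>: "integrable lborel \<psi>" unfolding \<psi>_def using \<phi>_int by simp
  then have [measurable]: "\<psi> \<in> borel_measurable borel" by auto
  have inv: "AE x in lborel. f x = ift \<psi> x"
    using ft_inversion[OF f \<phi>_int[unfolded \<phi>_def]]
    unfolding \<psi>_def ift_cmult by eventually_elim (simp add: ift_def c_def \<phi>_def)
  have \<psi>_powr: "integrable lborel (\<lambda>\<omega>. (\<i> * of_real \<omega>) powr of_real \<gamma> * \<psi> \<omega>)" if "-1 < \<gamma>" "\<gamma> \<le> \<alpha> + 3" for \<gamma>
    using integrable_mult_right[OF powr_int[OF that], of c] by (simp add: \<psi>_def mult.left_commute)
  have \<psi>\<^sub>3: "integrable lborel (\<lambda>\<omega>. \<bar>\<omega>\<bar> powr (\<alpha> + 3) * norm (\<psi> \<omega>))"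
    using integrable_mult_right[OF \<phi>\<^sub>3, of "norm c"] by (simp add: \<psi>_def norm_mult mult.left_commute)
  have D: "rl_deriv \<alpha> u = ift (\<lambda>\<omega>. (\<i> * of_real \<omega>) powr of_real \<alpha> * \<psi> \<omega>)"
    by (rule repr(4)[OF _ inv \<psi>_powr \<psi>]) auto
  obtain C where C: "\<And>h x. h > 0 \<Longrightarrow> norm (wsgd \<alpha> p q r h (ift \<psi>) x - rl_deriv \<alpha> u x) \<le> C * h ^ 3"
    using wsgd_error_ift[OF assms(1-4) \<psi> \<psi>_powr \<psi>\<^sub>3] assms(1) unfolding D by auto
  from uf inv have "AE x in lborel. ift \<psi> x = u x" by eventually_elim simp
  then have "AE x in lebesgue. ift \<psi> x = u x" by (rule AE_completion)
  moreover have "summable (gruenwald_term \<alpha> h s (ift \<psi>) x)" for h s x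
    using gruenwald_ift[OF assms(1) \<psi>] by (rule sums_summable)
  \<comment> \<open>The estimate is available for every positive \<open>h\<close>, in particular as
    \<open>h\<close> tends to 0 from the right.\<close>
  moreover have "\<forall>\<^sub>F h in at_right 0. \<forall>x. norm (wsgd \<alpha> p q r h (ift \<psi>) x - rl_deriv \<alpha> u x) \<le> C * h ^ 3"
    using C by (auto simp: eventually_at_filter intro!: always_eventually)
  ultimately show ?thesis
    using repr(3) continuous_on_ift[OF \<psi>] by blast
qed

end
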